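(* Let $\sigma>0$, $k>0$, $n\ge1$, $P=\mathcal N(0,\sigma^2)$, and let $Q_n=\sum_{i=1}^nw_i\delta_{y_i}$ with $y_1<\dots<y_n$, $w_i\ge0$, $\sum_iw_i=1$. With the bins $I_i$ and barycenters $\bar x_i$ defined in the context, the functional $J(Q)=k^2W_2^2(P,Q)+\operatorname{mmse}(Q)$ satisfies $$J(Q_n)=k^2\Bigl[\bigl(\sigma^2-\sum_iw_i\bar x_i^2\bigr)+\sum_iw_i(y_i-\bar x_i)^2\Bigr]+\Bigl[\sum_iw_iy_i^2-\int_{\mathbb R}\frac{g(z)^2}{p_Z(z)}\,dz\Bigr],$$ where $p_Z(z)=\sum_iw_i\phi(z-y_i)$ and $g(z)=\sum_iw_iy_i\phi(z-y_i)$, the first bracket being $W_2^2(P,Q_n)$ and the second $\operatorname{mmse}(Q_n)$. Hence $J_n^\star:=\inf\{J(Q):Q\text{ supported on at most }n\text{ points}\}$ equals the minimum of this expression over the $n$ levels $y_1<\dots<y_n$ and the $n-1$ thresholds $\zeta_1<\dots<\zeta_{n-1}$ (equivalently, over the weights $w$ in the probability simplex $\Delta_{n-1}$): a smooth, nonconvex program in $2n-1$ variables, whose transport part is in closed form and whose estimation part is a single one-dimensional Gaussian-mixture integral (smooth, with closed-form gradient). The levels $y_i$ are the outputs and the bins $I_i$ the decision regions of the $n$-level first controller $f_n(x)=\sum_{i=1}^ny_i\mathbf 1_{I_i}(x)$.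
   Context: $\phi$ is the standard normal density, $\Phi$ the standard normal CDF, and $\Phi_\sigma,\phi_\sigma$ the CDF and density of $P=\mathcal N(0,\sigma^2)$. $W_i=\sum_{j\le i}w_j$ ($W_0=0$); thresholds $\zeta_i=F_P^{-1}(W_i)=\sigma\Phi^{-1}(W_i)$, $\zeta_0=-\infty$, $\zeta_n=+\infty$; bins $I_i=(\zeta_{i-1},\zeta_i]$, so that $w_i=P(I_i)=\Phi_\sigma(\zeta_i)-\Phi_\sigma(\zeta_{i-1})$; $\mu_i=\int_{I_i}x\,dP=\sigma^2(\phi_\sigma(\zeta_{i-1})-\phi_\sigma(\zeta_i))$ and $\bar x_i=\mu_i/w_i$ (terms with $w_i=0$ contribute zero). $W_2^2(P,Q)=\inf_\pi\int(x-y)^2\,\pi(dx,dy)$ over couplings of $P,Q$. $\operatorname{mmse}(Q)=\mathbb E[\operatorname{Var}(Y\mid Y+N)]$ for independent $Y\sim Q$, $N\sim\mathcal N(0,1)$. A first controller is a map $f$ with state $Y=f(X_0)$, $X_0\sim P$.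
   Formalization: Nonconvexity of the program is asserted only for n ≥ 2: for n = 1 the objective equals k²(σ²+y₁²), which is convex, so the word "nonconvex" fails there. *)

theory Defs
  imports "HOL-Probability.Probability"
begin

definition gauss :: "real \<Rightarrow> real measure" where
  "gauss \<sigma> = density lborel (normal_density 0 \<sigma>)"

definition couplings :: "real measure \<Rightarrow> real measure \<Rightarrow> (real \<times> real) measure set" where
  "couplings P Q = {\<pi>. sets \<pi> = sets (borel \<Otimes>\<^sub>M borel) \<and>
     distr \<pi> borel fst = P \<and> distr \<pi> borel snd = Q}"

text \<open>Extended-real valued, so that the value is meaningful (possibly infinite) without any
  second-moment assumption.\<close>

definition wasserstein2_sq :: "real measure \<Rightarrow> real measure \<Rightarrow> ereal" where
  "wasserstein2_sq P Q =
     (INF \<pi>\<in>couplings P Q. enn2ereal (\<integral>\<^sup>+ (x, y). ennreal ((x - y)\<^sup>2) \<partial>\<pi>))"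

definition cond_var :: "'a measure \<Rightarrow> 'a measure \<Rightarrow> ('a \<Rightarrow> real) \<Rightarrow> 'a \<Rightarrow> real" where
  "cond_var M F X = real_cond_exp M F (\<lambda>\<omega>. (X \<omega> - real_cond_exp M F X \<omega>)\<^sup>2)"

text \<open>The pair of the state \<open>Y\<close> and the noise \<open>N\<close> is realised as the two coordinates of a product
  space; conditioning is on the sigma-algebra generated by \<open>Y + N\<close>.\<close>

definition mmse :: "real measure \<Rightarrow> real" where
  "mmse Q = (let M = Q \<Otimes>\<^sub>M std_normal_distribution;
                 F = vimage_algebra (space M) (\<lambda>\<omega>. fst \<omega> + snd \<omega>) borel
             in \<integral>\<omega>. cond_var M F fst \<omega> \<partial>M)"

definition J :: "real \<Rightarrow> real \<Rightarrow> real measure \<Rightarrow> ereal" where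
  "J \<sigma> k Q = ereal (k\<^sup>2) * wasserstein2_sq (gauss \<sigma>) Q + ereal (mmse Q)"

definition at_most_points :: "nat \<Rightarrow> real measure set" where
  "at_most_points n = {Q. prob_space Q \<and> sets Q = sets borel \<and>
     (\<exists>S. finite S \<and> card S \<le> n \<and> emeasure Q (- S) = 0)}"

definition J_star :: "real \<Rightarrow> real \<Rightarrow> nat \<Rightarrow> ereal" where
  "J_star \<sigma> k n = (INF Q\<in>at_most_points n. J \<sigma> k Q)"

text \<open>Vectors are functions on \<open>nat\<close> of which only the coordinates with indices \<open>1, \<dots>, n\<close>
  (levels, weights) or \<open>0, \<dots>, n\<close> (thresholds) matter.\<close>

definition levels :: "nat \<Rightarrow> (nat \<Rightarrow> real) set" where
  "levels n = {y. strict_mono_on {1..n} y}"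

definition weight_simplex :: "nat \<Rightarrow> (nat \<Rightarrow> real) set" where
  "weight_simplex n = {w. (\<forall>i\<in>{1..n}. 0 \<le> w i) \<and> (\<Sum>i=1..n. w i) = 1}"

definition discrete_law :: "nat \<Rightarrow> (nat \<Rightarrow> real) \<Rightarrow> (nat \<Rightarrow> real) \<Rightarrow> real measure" where
  "discrete_law n y w = distr (point_measure {1..n} (\<lambda>i. ennreal (w i))) borel y"

text \<open>The generalised inverse of the distribution function; for a Gaussian it is
  \<open>-\<infinity>\<close> at \<open>0\<close> and \<open>\<infinity>\<close> at \<open>1\<close>.\<close>

definition quantile :: "real measure \<Rightarrow> real \<Rightarrow> ereal" where
  "quantile P u = (INF x\<in>{x. u \<le> cdf P x}. ereal x)"

definition thresholds_of :: "real \<Rightarrow> (nat \<Rightarrow> real) \<Rightarrow> nat \<Rightarrow> ereal" where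
  "thresholds_of \<sigma> w i = quantile (gauss \<sigma>) (\<Sum>j=1..i. w j)"

definition bin :: "(nat \<Rightarrow> ereal) \<Rightarrow> nat \<Rightarrow> real set" where
  "bin \<zeta> i = {x. \<zeta> (i - 1) < ereal x \<and> ereal x \<le> \<zeta> i}"

definition bin_moment :: "real \<Rightarrow> (nat \<Rightarrow> ereal) \<Rightarrow> nat \<Rightarrow> real" where
  "bin_moment \<sigma> \<zeta> i = (LINT x:bin \<zeta> i|gauss \<sigma>. x)"

definition barycenter :: "real \<Rightarrow> (nat \<Rightarrow> ereal) \<Rightarrow> (nat \<Rightarrow> real) \<Rightarrow> nat \<Rightarrow> real" where
  "barycenter \<sigma> \<zeta> w i = bin_moment \<sigma> \<zeta> i / w i"

text \<open>Gaussian density and distribution function on the extended line.\<close>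

definition dens_ext :: "real \<Rightarrow> ereal \<Rightarrow> real" where
  "dens_ext \<sigma> u = (if \<bar>u\<bar> = \<infinity> then 0 else normal_density 0 \<sigma> (real_of_ereal u))"

definition cdf_ext :: "real \<Rightarrow> ereal \<Rightarrow> real" where
  "cdf_ext \<sigma> u = measure (gauss \<sigma>) {x. ereal x \<le> u}"

definition controller :: "nat \<Rightarrow> (nat \<Rightarrow> real) \<Rightarrow> (nat \<Rightarrow> ereal) \<Rightarrow> real \<Rightarrow> real" where
  "controller n y \<zeta> x = (\<Sum>i=1..n. y i * indicator (bin \<zeta> i) x)"

definition mix_dens :: "nat \<Rightarrow> (nat \<Rightarrow> real) \<Rightarrow> (nat \<Rightarrow> real) \<Rightarrow> real \<Rightarrow> real" where
  "mix_dens n y w z = (\<Sum>i=1..n. w i * std_normal_density (z - y i))"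

definition mix_num :: "nat \<Rightarrow> (nat \<Rightarrow> real) \<Rightarrow> (nat \<Rightarrow> real) \<Rightarrow> real \<Rightarrow> real" where
  "mix_num n y w z = (\<Sum>i=1..n. w i * y i * std_normal_density (z - y i))"

definition transport_part ::
  "real \<Rightarrow> nat \<Rightarrow> (nat \<Rightarrow> real) \<Rightarrow> (nat \<Rightarrow> real) \<Rightarrow> (nat \<Rightarrow> ereal) \<Rightarrow> real" where
  "transport_part \<sigma> n y w \<zeta> =
     (\<sigma>\<^sup>2 - (\<Sum>i=1..n. w i * (barycenter \<sigma> \<zeta> w i)\<^sup>2))
      + (\<Sum>i=1..n. w i * (y i - barycenter \<sigma> \<zeta> w i)\<^sup>2)"

definition estimation_part :: "nat \<Rightarrow> (nat \<Rightarrow> real) \<Rightarrow> (nat \<Rightarrow> real) \<Rightarrow> real" where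
  "estimation_part n y w =
     (\<Sum>i=1..n. w i * (y i)\<^sup>2) - (\<integral>z. (mix_num n y w z)\<^sup>2 / mix_dens n y w z \<partial>lborel)"

definition objective ::
  "real \<Rightarrow> real \<Rightarrow> nat \<Rightarrow> (nat \<Rightarrow> real) \<Rightarrow> (nat \<Rightarrow> real) \<Rightarrow> (nat \<Rightarrow> ereal) \<Rightarrow> real" where
  "objective \<sigma> k n y w \<zeta> = k\<^sup>2 * transport_part \<sigma> n y w \<zeta> + estimation_part n y w"

text \<open>A point \<open>v\<close> packs the \<open>2 n - 1\<close> real variables: the levels are \<open>v 1, \<dots>, v n\<close> and the
  finite thresholds are \<open>v (n + 1), \<dots>, v (n + (n - 1))\<close>.\<close>

definition thr :: "nat \<Rightarrow> (nat \<Rightarrow> real) \<Rightarrow> nat \<Rightarrow> ereal" where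
  "thr n v i = (if i = 0 then - \<infinity> else if n \<le> i then \<infinity> else ereal (v (n + i)))"

definition weights_of :: "real \<Rightarrow> (nat \<Rightarrow> ereal) \<Rightarrow> nat \<Rightarrow> real" where
  "weights_of \<sigma> \<zeta> i = cdf_ext \<sigma> (\<zeta> i) - cdf_ext \<sigma> (\<zeta> (i - 1))"

definition prog_domain :: "nat \<Rightarrow> (nat \<Rightarrow> real) set" where
  "prog_domain n =
     {v. strict_mono_on {1..n} v \<and> strict_mono_on {1..<n} (\<lambda>i. v (n + i))}"

definition prog_estimation :: "real \<Rightarrow> nat \<Rightarrow> (nat \<Rightarrow> real) \<Rightarrow> real" where
  "prog_estimation \<sigma> n v = estimation_part n v (weights_of \<sigma> (thr n v))"

definition prog_objective :: "real \<Rightarrow> real \<Rightarrow> nat \<Rightarrow> (nat \<Rightarrow> real) \<Rightarrow> real" where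
  "prog_objective \<sigma> k n v = objective \<sigma> k n v (weights_of \<sigma> (thr n v)) (thr n v)"

text \<open>The partial derivatives of the estimation part are one-dimensional Gaussian-mixture
  integrals involving the conditional mean \<open>E[Y | Y + N = z]\<close>.\<close>

definition post_mean :: "nat \<Rightarrow> (nat \<Rightarrow> real) \<Rightarrow> (nat \<Rightarrow> real) \<Rightarrow> real \<Rightarrow> real" where
  "post_mean n y w z = mix_num n y w z / mix_dens n y w z"

definition estimation_grad_level :: "real \<Rightarrow> nat \<Rightarrow> (nat \<Rightarrow> real) \<Rightarrow> nat \<Rightarrow> real" where
  "estimation_grad_level \<sigma> n v i =
     (let w = weights_of \<sigma> (thr n v); h = post_mean n v w
      in w i * (\<integral>z. std_normal_density (z - v i) *
                   (2 * (v i - h z) + (z - v i) * (v i - h z)\<^sup>2) \<partial>lborel))"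

definition estimation_grad_threshold :: "real \<Rightarrow> nat \<Rightarrow> (nat \<Rightarrow> real) \<Rightarrow> nat \<Rightarrow> real" where
  "estimation_grad_threshold \<sigma> n v j =
     (let h = post_mean n v (weights_of \<sigma> (thr n v))
      in normal_density 0 \<sigma> (v (n + j)) *
         (\<integral>z. std_normal_density (z - v j) * (v j - h z)\<^sup>2
              - std_normal_density (z - v (j + 1)) * (v (j + 1) - h z)\<^sup>2 \<partial>lborel))"

text \<open>\<open>C\<^sup>m\<close> in the coordinates from a finite set \<open>I\<close>: all iterated partial derivatives of order at
  most \<open>m\<close> exist and are continuous (product topology). Intended for an open \<open>U\<close>, so that the
  values of the witness \<open>f'\<close> outside \<open>U\<close> are immaterial.\<close>

primrec C_on :: "nat \<Rightarrow> nat set \<Rightarrow> (nat \<Rightarrow> real) set \<Rightarrow> ((nat \<Rightarrow> real) \<Rightarrow> real) \<Rightarrow> bool" where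
  "C_on 0 I U f \<longleftrightarrow> continuous_on U f"
| "C_on (Suc m) I U f \<longleftrightarrow> continuous_on U f \<and>
     (\<forall>i\<in>I. \<exists>f'. (\<forall>x\<in>U. ((\<lambda>t. f (x(i := t))) has_real_derivative f' x) (at (x i)))
               \<and> C_on m I U f')"

definition smooth_coords_on ::
  "nat set \<Rightarrow> (nat \<Rightarrow> real) set \<Rightarrow> ((nat \<Rightarrow> real) \<Rightarrow> real) \<Rightarrow> bool" where
  "smooth_coords_on I U f \<longleftrightarrow> (\<forall>m. C_on m I U f)"

text \<open>The library's \<open>convex_on\<close> needs a real vector space instance, which function types lack.\<close>

definition convex_fun_on :: "(nat \<Rightarrow> real) set \<Rightarrow> ((nat \<Rightarrow> real) \<Rightarrow> real) \<Rightarrow> bool" where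
  "convex_fun_on D f \<longleftrightarrow> (\<forall>u\<in>D. \<forall>v\<in>D. \<forall>t\<in>{0..1}.
     f (\<lambda>i. (1 - t) * u i + t * v i) \<le> (1 - t) * f u + t * f v)"

definition is_minimum :: "'b::order \<Rightarrow> ('a \<Rightarrow> 'b) \<Rightarrow> 'a set \<Rightarrow> bool" where
  "is_minimum m f A \<longleftrightarrow> (\<exists>a\<in>A. f a = m) \<and> (\<forall>a\<in>A. m \<le> f a)"

end

theory Submission
  imports Defs "HOL-Real_Asymp.Real_Asymp"
begin

text \<open>For a finitely supported law the optimal coupling with the Gaussian is monotone, and the optimal
  estimator of \<open>Y\<close> from \<open>Y + N\<close> is the ratio of the two Gaussian mixtures; this gives both closed
  forms. Differentiating a Gaussian-mixture integral yields integrals of the same kind, hence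
  smoothness, and the gradient of the estimation part follows from the variational characterisation of
  the posterior mean. A minimising sequence of levels and thresholds is compact in the extended reals,
  and both parts of the objective are integrals of nonnegative functions, so Fatou's lemma gives a
  minimising law with at most \<open>n\<close> atoms. Such a law has exactly \<open>n\<close> atoms, since splitting an atom
  always decreases the transport part at first order without a first-order loss in the estimation part;
  so the minimum is attained in the open domain of strictly increasing levels and thresholds.\<close>

subsection \<open>The Gaussian distribution function on the extended line\<close>

text \<open>The program lives on an open set of strictly increasing levels and thresholds, while a
  limit of a minimising sequence may have empty cells, merged levels or levels at infinity. The
  auxiliary notions are therefore wider than the program: thresholds lie in the extended line and
  may coincide, weights may vanish, and derivatives are taken where two levels agree. The last point
  makes the return to the open set possible: a law with too few atoms is itself a configuration with
  one more cell and a repeated level, and there the partial derivatives of the objective in the two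
  copies cannot both vanish. The estimation part is used throughout as the least mean square error
  over bounded estimators. As an integral of nonnegative terms it passes to limits; tested with a
  constant it is bounded by a second moment, which controls degenerate weights; tested with an
  estimator frozen at a base point it yields the gradient without differentiating the posterior
  mean.\<close>

lemma prob_space_gauss: "\<sigma> > 0 \<Longrightarrow> prob_space (gauss \<sigma>)"
  unfolding gauss_def by (rule prob_space_normal_density)

lemma sets_gauss [measurable_cong, simp]: "sets (gauss \<sigma>) = sets borel"
  by (simp add: gauss_def)

lemma space_gauss [simp]: "space (gauss \<sigma>) = UNIV"
  by (simp add: gauss_def)

lemma integral_gauss:
  fixes f :: "real \<Rightarrow> real"
  assumes "f \<in> borel_measurable borel"
  shows "integral\<^sup>L (gauss \<sigma>) f = (\<integral>x. normal_density 0 \<sigma> x * f x \<partial>lborel)"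
  unfolding gauss_def using assms by (subst integral_density) auto

lemma integrable_gauss:
  fixes f :: "real \<Rightarrow> real"
  assumes "f \<in> borel_measurable borel"
  shows "integrable (gauss \<sigma>) f \<longleftrightarrow> integrable lborel (\<lambda>x. normal_density 0 \<sigma> x * f x)"
  unfolding gauss_def using assms by (subst integrable_density) auto

lemma integrable_gauss_id: "\<sigma> > 0 \<Longrightarrow> integrable (gauss \<sigma>) (\<lambda>x. x)"
  using integrable_normal_moment[of \<sigma> 0 1] by (simp add: integrable_gauss)

lemma integrable_gauss_sq: "\<sigma> > 0 \<Longrightarrow> integrable (gauss \<sigma>) (\<lambda>x. x\<^sup>2)"
  using integrable_normal_moment[of \<sigma> 0 2] by (simp add: integrable_gauss)

lemma integral_gauss_sq: "\<sigma> > 0 \<Longrightarrow> (\<integral>x. x\<^sup>2 \<partial>gauss \<sigma>) = \<sigma>\<^sup>2"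
  using integral_normal_moment_even[of \<sigma> 0 1] by (simp add: integral_gauss fact_numeral)

lemma gauss_singleton: "\<sigma> > 0 \<Longrightarrow> emeasure (gauss \<sigma>) {x} = 0"
  unfolding gauss_def
  by (subst emeasure_density) (auto simp: nn_integral_cmult_indicator
      simp flip: indicator_mult_ennreal intro!: nn_integral_0_iff_AE[THEN iffD2] AE_lborel_singleton[THEN AE_mp])

lemma real_distribution_gauss: "\<sigma> > 0 \<Longrightarrow> real_distribution (gauss \<sigma>)"
  using prob_space_gauss by (auto simp: real_distribution_def real_distribution_axioms_def)

text \<open>A positive density charges every interval. This makes the distribution function
  injective, which later identifies weights with thresholds.\<close>

lemma gauss_Ioc:
  assumes "\<sigma> > 0" "a < b"
  shows "measure (gauss \<sigma>) {a<..b} > 0"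
proof -
  interpret prob_space "gauss \<sigma>" by (rule prob_space_gauss) fact
  have "emeasure (gauss \<sigma>) {a<..b} \<noteq> 0"
  proof
    assume "emeasure (gauss \<sigma>) {a<..b} = 0"
    then have "(\<integral>\<^sup>+x. ennreal (normal_density 0 \<sigma> x) * indicator {a<..b} x \<partial>lborel) = 0"
      unfolding gauss_def by (subst (asm) emeasure_density) auto
    then have "AE x in lborel. x \<notin> {a<..b}"
      by (subst (asm) nn_integral_0_iff_AE)
         (auto simp: indicator_def normal_density_pos[OF assms(1), THEN less_imp_neq, symmetric]
            split: if_splits elim!: eventually_mono)
    then have "emeasure lborel {a<..b} = 0"
      by (subst (asm) AE_iff_measurable[of "{a<..b}"]) auto
    then show False using assms by simp
  qed
  then show ?thesis
    by (simp add: emeasure_eq_measure zero_less_measure_iff)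
qed

lemma cdf_gauss_less_iff:
  assumes "\<sigma> > 0"
  shows "cdf (gauss \<sigma>) a < cdf (gauss \<sigma>) b \<longleftrightarrow> a < b"
proof -
  interpret real_distribution "gauss \<sigma>" by (rule real_distribution_gauss) fact
  have "cdf (gauss \<sigma>) a < cdf (gauss \<sigma>) b" if "a < b" for a b
    using cdf_diff_eq[OF that] gauss_Ioc[OF assms that] by simp
  then show ?thesis
    using linorder_less_linear[of a b] by fastforce
qed

lemma has_real_derivative_cdf_gauss:
  assumes "\<sigma> > 0"
  shows "(cdf (gauss \<sigma>) has_real_derivative normal_density 0 \<sigma> x) (at x)"
proof -
  interpret real_distribution "gauss \<sigma>" by (rule real_distribution_gauss) fact
  have cont: "continuous_on S (normal_density 0 \<sigma>)" for S
    using assms unfolding normal_density_def by (intro continuous_intros) auto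
  \<comment> \<open>Only the increment from the local base point \<open>x - 1\<close> is written as
    an integral, so the fundamental theorem is applied on a compact interval and no improper
    integral occurs.\<close>
  have eq: "cdf (gauss \<sigma>) t = cdf (gauss \<sigma>) (x - 1) + integral {x-1..t} (normal_density 0 \<sigma>)"
    if "x - 1 < t" for t
  proof -
    have "measure (gauss \<sigma>) {x-1<..t} = (\<integral>u. normal_density 0 \<sigma> u * indicator {x-1<..t} u \<partial>lborel)"
      using integral_gauss[of "indicator {x-1<..t}" \<sigma>] by simp
    also have "\<dots> = (\<integral>u. indicator {x-1..t} u * normal_density 0 \<sigma> u \<partial>lborel)"
      by (intro integral_cong_AE) (auto simp: indicator_def intro: AE_mp[OF AE_lborel_singleton[of "x-1"]])
    also have "\<dots> = integral {x-1..t} (normal_density 0 \<sigma>)"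
      using set_borel_integral_eq_integral(2)[of "{x-1..t}" "normal_density 0 \<sigma>"]
        borel_integrable_atLeastAtMost'[OF cont]
      by (simp add: set_lebesgue_integral_def)
    finally show ?thesis using cdf_diff_eq[OF that] by simp
  qed
  have "((\<lambda>t. integral {x-1..t} (normal_density 0 \<sigma>)) has_real_derivative normal_density 0 \<sigma> x) (at x within {x-1..x+1})"
    by (rule integral_has_real_derivative) (auto intro: cont)
  then have "((\<lambda>t. cdf (gauss \<sigma>) (x - 1) + integral {x-1..t} (normal_density 0 \<sigma>)) has_real_derivative normal_density 0 \<sigma> x) (at x)"
    by (auto simp: at_within_Icc_at intro!: derivative_eq_intros)
  then show ?thesis
    by (rule has_field_derivative_transform_within_open[of _ _ _ "{x-1<..<x+1}"]) (use eq in auto)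
qed

lemma continuous_cdf_gauss: "\<sigma> > 0 \<Longrightarrow> continuous_on S (cdf (gauss \<sigma>))"
  by (meson DERIV_isCont continuous_at_imp_continuous_on has_real_derivative_cdf_gauss)

lemma cdf_ext_ereal [simp]: "cdf_ext \<sigma> (ereal x) = cdf (gauss \<sigma>) x"
  by (simp add: cdf_ext_def cdf_def atMost_def)

lemma cdf_ext_infty [simp]: "\<sigma> > 0 \<Longrightarrow> cdf_ext \<sigma> \<infinity> = 1"
  using prob_space.prob_space[OF prob_space_gauss] by (simp add: cdf_ext_def)

lemma cdf_ext_minus_infty [simp]: "cdf_ext \<sigma> (- \<infinity>) = 0"
  by (simp add: cdf_ext_def)

lemma cdf_gauss_bounds:
  assumes "\<sigma> > 0"
  shows "0 < cdf (gauss \<sigma>) x" "cdf (gauss \<sigma>) x < 1"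
proof -
  interpret real_distribution "gauss \<sigma>" by (rule real_distribution_gauss) fact
  show "0 < cdf (gauss \<sigma>) x"
    using cdf_gauss_less_iff[OF assms, of "x - 1" x] cdf_nonneg[of "x - 1"] by linarith
  show "cdf (gauss \<sigma>) x < 1"
    using cdf_gauss_less_iff[OF assms, of x "x + 1"] cdf_bounded_prob[of "x + 1"] by linarith
qed

lemma cdf_ext_strict_mono:
  assumes "\<sigma> > 0" "a < b"
  shows "cdf_ext \<sigma> a < cdf_ext \<sigma> b"
  using assms cdf_gauss_bounds[OF assms(1)] 
  by (cases a; cases b) (auto simp: cdf_gauss_less_iff)

lemma cdf_ext_mono: "\<sigma> > 0 \<Longrightarrow> a \<le> b \<Longrightarrow> cdf_ext \<sigma> a \<le> cdf_ext \<sigma> b"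
  using cdf_ext_strict_mono[of \<sigma> a b] by (cases "a = b") (auto simp: order_le_less)

lemma cdf_ext_less_iff: "\<sigma> > 0 \<Longrightarrow> cdf_ext \<sigma> a < cdf_ext \<sigma> b \<longleftrightarrow> a < b"
  using cdf_ext_strict_mono[of \<sigma> a b] cdf_ext_mono[of \<sigma> b a] by fastforce

lemma cdf_ext_le_iff: "\<sigma> > 0 \<Longrightarrow> cdf_ext \<sigma> a \<le> cdf_ext \<sigma> b \<longleftrightarrow> a \<le> b"
  using cdf_ext_less_iff[of \<sigma> b a] by (simp add: not_less[symmetric])

lemma cdf_ext_eq_iff: "\<sigma> > 0 \<Longrightarrow> cdf_ext \<sigma> a = cdf_ext \<sigma> b \<longleftrightarrow> a = b"
  by (metis cdf_ext_le_iff order_antisym order_refl)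

lemma cdf_ext_nonneg: "0 \<le> cdf_ext \<sigma> u"
  by (simp add: cdf_ext_def)

lemma cdf_ext_le_1: "\<sigma> > 0 \<Longrightarrow> cdf_ext \<sigma> u \<le> 1"
  using prob_space.prob_le_1[OF prob_space_gauss] by (simp add: cdf_ext_def)

text \<open>Interior values come from the intermediate value theorem; 0 and 1 are attained only at
  the infinite points, which is the reason for working on the extended line.\<close>

lemma cdf_ext_surj:
  assumes "\<sigma> > 0" "0 \<le> u" "u \<le> 1"
  obtains a where "cdf_ext \<sigma> a = u"
proof -
  interpret real_distribution "gauss \<sigma>" by (rule real_distribution_gauss) fact
  consider "u = 0" | "u = 1" | "0 < u" "u < 1" using assms by linarith
  then show ?thesis
  proof cases
    case 3
    have "\<forall>\<^sub>F x in at_bot. cdf (gauss \<sigma>) x < u"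
      using order_tendstoD(2)[OF cdf_lim_at_bot, OF 3(1)] .
    then obtain a where a: "cdf (gauss \<sigma>) a < u"
      using eventually_happens by fastforce
    have "\<forall>\<^sub>F x in at_top. u < cdf (gauss \<sigma>) x"
      using order_tendstoD(1)[OF cdf_lim_at_top_prob, OF 3(2)] .
    then obtain b where b: "u < cdf (gauss \<sigma>) b"
      using eventually_happens by fastforce
    have "a < b" using a b cdf_gauss_less_iff[OF assms(1), of a b] by linarith
    then obtain x where "cdf (gauss \<sigma>) x = u"
      using IVT'[of "cdf (gauss \<sigma>)" a u b] a b continuous_cdf_gauss[OF assms(1)] by fastforce
    then show ?thesis using that[of "ereal x"] by simp
  qed (use that[of "-\<infinity>"] that[of \<infinity>] assms in auto)
qed

text \<open>By strict monotonicity the quantile is the infimum of the reals at or above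
  \<open>a\<close>. It equals \<open>a\<close> at the infinite points too: the infimum over no reals
  is \<open>\<infinity>\<close>, over all reals \<open>- \<infinity>\<close>.\<close>

lemma quantile_cdf_ext:
  assumes "\<sigma> > 0"
  shows "quantile (gauss \<sigma>) (cdf_ext \<sigma> a) = a"
proof -
  have "quantile (gauss \<sigma>) (cdf_ext \<sigma> a) = (INF x\<in>{x. a \<le> ereal x}. ereal x)"
    unfolding quantile_def using cdf_ext_le_iff[OF assms, of a "ereal _"] by simp
  also have "\<dots> = a"
  proof (cases a)
    case (real r)
    then show ?thesis by (auto intro!: antisym INF_lower2[of r] INF_greatest)
  next
    case PInf
    then show ?thesis by (simp add: top_ereal_def)
  next
    case MInf
    have "(INF x\<in>UNIV. ereal x) = -\<infinity>"
      by (rule ereal_bot) (rule INF_lower, simp)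
    then show ?thesis using MInf by (simp del: range_ereal)
  qed
  finally show ?thesis .
qed

lemma cdf_ext_quantile:
  assumes "\<sigma> > 0" "0 \<le> u" "u \<le> 1"
  shows "cdf_ext \<sigma> (quantile (gauss \<sigma>) u) = u"
  using cdf_ext_surj[OF assms] quantile_cdf_ext[OF assms(1)] by metis

text \<open>An increasing map onto \<open>[0, 1]\<close> is continuous, because the set where it
  stays strictly above or below an attained value is an open ray. Bounds outside
  \<open>[0, 1]\<close> are not attained but hold everywhere.\<close>

lemma tendsto_cdf_ext:
  assumes "\<sigma> > 0"
  shows "(cdf_ext \<sigma> \<longlongrightarrow> cdf_ext \<sigma> a) (nhds a)"
proof (rule order_tendstoI)
  fix u assume u: "u < cdf_ext \<sigma> a"
  show "\<forall>\<^sub>F x in nhds a. u < cdf_ext \<sigma> x"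
  proof (cases "u < 0")
    case True
    then show ?thesis by (auto intro!: always_eventually less_le_trans[OF _ cdf_ext_nonneg])
  next
    case False
    then obtain b where b: "cdf_ext \<sigma> b = u"
      using cdf_ext_surj[OF assms, of u] u cdf_ext_le_1[OF assms, of a] by (metis dual_order.trans less_eq_real_def linorder_not_less)
    then have "b < a" using u cdf_ext_less_iff[OF assms] by blast
    then have "\<forall>\<^sub>F x in nhds a. b < x"
      using eventually_nhds_in_open[of "{b<..}" a] by simp
    then show ?thesis
      by eventually_elim (use b cdf_ext_less_iff[OF assms] in blast)
  qed
next
  fix u assume u: "cdf_ext \<sigma> a < u"
  show "\<forall>\<^sub>F x in nhds a. cdf_ext \<sigma> x < u"
  proof (cases "u > 1")
    case True
    then show ?thesis by (auto intro!: always_eventually le_less_trans[OF cdf_ext_le_1[OF assms]])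
  next
    case False
    then obtain b where b: "cdf_ext \<sigma> b = u"
      using cdf_ext_surj[OF assms, of u] u cdf_ext_nonneg[of \<sigma> a] by (metis dual_order.trans less_eq_real_def linorder_not_less)
    then have "a < b" using u cdf_ext_less_iff[OF assms] by blast
    then have "\<forall>\<^sub>F x in nhds a. x < b"
      using eventually_nhds_in_open[of "{..<b}" a] by simp
    then show ?thesis
      by eventually_elim (use b cdf_ext_less_iff[OF assms] in blast)
  qed
qed

subsection \<open>Thresholds, bins and controllers\<close>

text \<open>Weak monotonicity admits empty bins. They arise from zero weights and from limits of
  strictly increasing thresholds, and this class is closed under such limits.\<close>

definition thresholds_ok :: "nat \<Rightarrow> (nat \<Rightarrow> ereal) \<Rightarrow> bool" where
  "thresholds_ok n \<zeta> \<longleftrightarrow> \<zeta> 0 = - \<infinity> \<and> \<zeta> n = \<infinity> \<and> (\<forall>i j. i \<le> j \<longrightarrow> j \<le> n \<longrightarrow> \<zeta> i \<le> \<zeta> j)"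

lemma thresholds_ok_mono: "thresholds_ok n \<zeta> \<Longrightarrow> i \<le> j \<Longrightarrow> j \<le> n \<Longrightarrow> \<zeta> i \<le> \<zeta> j"
  by (simp add: thresholds_ok_def)

lemma thresholds_ok_pos: "thresholds_ok n \<zeta> \<Longrightarrow> 1 \<le> n"
  by (cases n) (auto simp: thresholds_ok_def)

lemma sets_bin [measurable]: "bin \<zeta> i \<in> sets borel"
  unfolding bin_def by measurable

text \<open>The bin of \<open>x\<close> has the least index whose threshold is at or above
  \<open>x\<close>; minimality gives the strict left inequality, and the index is not 0 since
  \<open>\<zeta> 0 = - \<infinity>\<close>.\<close>

lemma bin_exists:
  assumes "thresholds_ok n \<zeta>"
  obtains i where "i \<in> {1..n}" "x \<in> bin \<zeta> i"
proof -
  define i where "i = (LEAST i. ereal x \<le> \<zeta> i)"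
  have n: "ereal x \<le> \<zeta> n" using assms by (simp add: thresholds_ok_def)
  have i: "ereal x \<le> \<zeta> i" "i \<le> n"
    unfolding i_def using n by (rule LeastI, rule Least_le)
  have "i \<noteq> 0" using i assms by (metis MInfty_neq_ereal(1) ereal_infty_less_eq(2) thresholds_ok_def)
  then have "i - 1 < i" by simp
  then have "\<not> ereal x \<le> \<zeta> (i - 1)" unfolding i_def by (rule not_less_Least)
  then show ?thesis using that[of i] i \<open>i \<noteq> 0\<close> by (auto simp: bin_def)
qed

lemma bin_unique:
  assumes "thresholds_ok n \<zeta>" "i \<in> {1..n}" "j \<in> {1..n}" "x \<in> bin \<zeta> i" "x \<in> bin \<zeta> j"
  shows "i = j"
proof -
  have "\<not> i < j" if "i \<in> {1..n}" "j \<in> {1..n}" "x \<in> bin \<zeta> i" "x \<in> bin \<zeta> j" for i j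
  proof
    assume "i < j"
    then have "\<zeta> i \<le> \<zeta> (j - 1)" using that by (intro thresholds_ok_mono[OF assms(1)]) auto
    moreover have "\<zeta> (j - 1) < ereal x" "ereal x \<le> \<zeta> i" using that by (auto simp: bin_def)
    ultimately show False by order
  qed
  then show ?thesis using assms by (metis linorder_neqE_nat)
qed

lemma sum_indicator_bin:
  fixes c :: "nat \<Rightarrow> real"
  assumes "thresholds_ok n \<zeta>" "i \<in> {1..n}" "x \<in> bin \<zeta> i"
  shows "(\<Sum>j=1..n. c j * indicator (bin \<zeta> j) x) = c i"
proof -
  have "(\<Sum>j=1..n. c j * indicator (bin \<zeta> j) x) = (\<Sum>j=1..n. if j = i then c j else 0)"
  proof (rule sum.cong)
    fix j assume "j \<in> {1..n}"
    then show "c j * indicator (bin \<zeta> j) x = (if j = i then c j else 0)"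
      using bin_unique[OF assms(1) _ assms(2) _ assms(3), of j] assms(3) by (cases "j = i") (auto simp: indicator_def)
  qed simp
  then show ?thesis using assms(2) by simp
qed

lemma controller_eq:
  assumes "thresholds_ok n \<zeta>" "i \<in> {1..n}" "x \<in> bin \<zeta> i"
  shows "controller n y \<zeta> x = y i"
  unfolding controller_def by (rule sum_indicator_bin) fact+

lemma controller_vimage:
  assumes "thresholds_ok n \<zeta>" "y \<in> levels n" "i \<in> {1..n}"
  shows "controller n y \<zeta> -` {y i} = bin \<zeta> i"
proof -
  have "inj_on y {1..n}"
    using assms(2) unfolding levels_def by (auto intro: strict_mono_on_imp_inj_on)
  then have "x \<in> bin \<zeta> i" if "controller n y \<zeta> x = y i" for x
    using that assms(3) controller_eq[OF assms(1), of _ x y] bin_exists[OF assms(1), of x]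
    by (metis inj_onD)
  then show ?thesis using controller_eq[OF assms(1,3)] by blast
qed

lemma measurable_controller [measurable]: "controller n y \<zeta> \<in> borel_measurable borel"
  unfolding controller_def[abs_def] by measurable

text \<open>The controller is constant on each bin. The general integrand \<open>F\<close> serves
  three times: for the law of the controller, its second moment and its cross moment with
  \<open>x\<close>.\<close>

lemma integral_split_bins:
  fixes F :: "real \<Rightarrow> real \<Rightarrow> real"
  assumes "thresholds_ok n \<zeta>" 
    and "\<And>i. i \<in> {1..n} \<Longrightarrow> integrable (gauss \<sigma>) (\<lambda>x. F x (y i))"
  shows "integrable (gauss \<sigma>) (\<lambda>x. F x (controller n y \<zeta> x))"
    and "(\<integral>x. F x (controller n y \<zeta> x) \<partial>gauss \<sigma>) = (\<Sum>i=1..n. LINT x:bin \<zeta> i|gauss \<sigma>. F x (y i))"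
proof -
  have eq: "F x (controller n y \<zeta> x) = (\<Sum>i=1..n. indicator (bin \<zeta> i) x *\<^sub>R F x (y i))" for x
  proof -
    obtain i where i: "i \<in> {1..n}" "x \<in> bin \<zeta> i" using bin_exists[OF assms(1)] .
    show ?thesis
      using sum_indicator_bin[OF assms(1) i, of "\<lambda>i. F x (y i)"] controller_eq[OF assms(1) i, of y]
      by (simp add: mult.commute)
  qed
  have int: "integrable (gauss \<sigma>) (\<lambda>x. indicator (bin \<zeta> i) x *\<^sub>R F x (y i))" if "i \<in> {1..n}" for i
    by (rule integrable_mult_indicator) (use assms(2) that in auto)
  show "integrable (gauss \<sigma>) (\<lambda>x. F x (controller n y \<zeta> x))"
    unfolding eq using int by (rule Bochner_Integration.integrable_sum)
  show "(\<integral>x. F x (controller n y \<zeta> x) \<partial>gauss \<sigma>) = (\<Sum>i=1..n. LINT x:bin \<zeta> i|gauss \<sigma>. F x (y i))"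
    unfolding eq set_lebesgue_integral_def by (rule Bochner_Integration.integral_sum) (rule int)
qed

lemma weights_of_eq_measure:
  assumes "\<sigma> > 0" "\<zeta> (i - 1) \<le> \<zeta> i"
  shows "weights_of \<sigma> \<zeta> i = measure (gauss \<sigma>) (bin \<zeta> i)"
proof -
  interpret prob_space "gauss \<sigma>" by (rule prob_space_gauss) fact
  have "bin \<zeta> i = {x. ereal x \<le> \<zeta> i} - {x. ereal x \<le> \<zeta> (i - 1)}" by (auto simp: bin_def)
  moreover have "{x. ereal x \<le> \<zeta> (i - 1)} \<subseteq> {x. ereal x \<le> \<zeta> i}" using assms(2) by (auto intro: order_trans)
  ultimately show ?thesis
    unfolding weights_of_def cdf_ext_def by (simp add: finite_measure_Diff)
qed

lemma sum_weights_of: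
  assumes "\<zeta> 0 = - \<infinity>"
  shows "(\<Sum>j=1..i. weights_of \<sigma> \<zeta> j) = cdf_ext \<sigma> (\<zeta> i)"
  by (induction i) (auto simp: assms weights_of_def)

lemma weights_of_simplex:
  assumes "\<sigma> > 0" "thresholds_ok n \<zeta>"
  shows "weights_of \<sigma> \<zeta> \<in> weight_simplex n"
  using sum_weights_of[of \<zeta> \<sigma> n] assms thresholds_ok_mono[OF assms(2)]
  by (auto simp: weight_simplex_def thresholds_ok_def weights_of_eq_measure)

lemma weight_partial_sums:
  assumes "w \<in> weight_simplex n" "i \<le> j" "j \<le> n"
  shows "0 \<le> (\<Sum>l=1..i. w l)" "(\<Sum>l=1..i. w l) \<le> (\<Sum>l=1..j. w l)" "(\<Sum>l=1..j. w l) \<le> 1"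
proof -
  have nn: "0 \<le> w l" if "l \<in> {1..n}" for l using assms(1) that by (simp add: weight_simplex_def)
  show "0 \<le> (\<Sum>l=1..i. w l)" using assms nn by (intro sum_nonneg) auto
  show "(\<Sum>l=1..i. w l) \<le> (\<Sum>l=1..j. w l)" using assms nn by (intro sum_mono2) auto
  have "(\<Sum>l=1..j. w l) \<le> (\<Sum>l=1..n. w l)" using assms nn by (intro sum_mono2) auto
  then show "(\<Sum>l=1..j. w l) \<le> 1" using assms(1) by (simp add: weight_simplex_def)
qed

lemma cdf_ext_thresholds_of:
  assumes "\<sigma> > 0" "w \<in> weight_simplex n" "i \<le> n"
  shows "cdf_ext \<sigma> (thresholds_of \<sigma> w i) = (\<Sum>l=1..i. w l)"
  unfolding thresholds_of_def
  using weight_partial_sums[OF assms(2), of i i] assms by (intro cdf_ext_quantile) auto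

lemma thresholds_of_ok:
  assumes "\<sigma> > 0" "w \<in> weight_simplex n"
  shows "thresholds_ok n (thresholds_of \<sigma> w)"
proof -
  have "thresholds_of \<sigma> w 0 = - \<infinity>" "thresholds_of \<sigma> w n = \<infinity>"
    using quantile_cdf_ext[OF assms(1), of "-\<infinity>"] quantile_cdf_ext[OF assms(1), of \<infinity>] assms
    by (auto simp: thresholds_of_def weight_simplex_def)
  moreover have "thresholds_of \<sigma> w i \<le> thresholds_of \<sigma> w j" if "i \<le> j" "j \<le> n" for i j
  proof -
    have "cdf_ext \<sigma> (thresholds_of \<sigma> w i) \<le> cdf_ext \<sigma> (thresholds_of \<sigma> w j)"
      using weight_partial_sums(2)[OF assms(2) that] that
      by (simp only: cdf_ext_thresholds_of[OF assms] order_trans[OF that])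
    then show ?thesis by (simp only: cdf_ext_le_iff[OF assms(1)])
  qed
  ultimately show ?thesis by (simp add: thresholds_ok_def)
qed

lemma weights_of_thresholds_of:
  assumes "\<sigma> > 0" "w \<in> weight_simplex n" "i \<in> {1..n}"
  shows "weights_of \<sigma> (thresholds_of \<sigma> w) i = w i"
proof -
  have "(\<Sum>l=1..i. w l) = (\<Sum>l=1..i-1. w l) + w i"
    using assms(3) by (cases i) auto
  moreover have "i \<le> n" "i - 1 \<le> n" using assms(3) by auto
  ultimately show ?thesis
    by (simp only: weights_of_def cdf_ext_thresholds_of[OF assms(1,2)])
qed

lemma thresholds_of_weights_of:
  assumes "\<sigma> > 0" "\<zeta> 0 = - \<infinity>"
  shows "thresholds_of \<sigma> (weights_of \<sigma> \<zeta>) i = \<zeta> i"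
  unfolding thresholds_of_def by (simp only: sum_weights_of[of \<zeta>, OF assms(2)] quantile_cdf_ext[OF assms(1)])

section \<open>Discrete laws as push-forwards of the Gaussian under a controller\<close>

lemma sets_discrete_law [measurable_cong, simp]: "sets (discrete_law n y w) = sets borel"
  by (simp add: discrete_law_def)

lemma space_discrete_law [simp]: "space (discrete_law n y w) = UNIV"
  by (simp add: discrete_law_def)

lemma emeasure_discrete_law:
  assumes "A \<in> sets borel"
  shows "emeasure (discrete_law n y w) A = (\<Sum>i=1..n. ennreal (w i) * indicator A (y i))"
proof -
  have "emeasure (discrete_law n y w) A = (\<Sum>i\<in>y -` A \<inter> {1..n}. ennreal (w i))"
    unfolding discrete_law_def using assms
    by (subst emeasure_distr) (auto simp: space_point_measure emeasure_point_measure_finite)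
  also have "\<dots> = (\<Sum>i=1..n. ennreal (w i) * indicator A (y i))"
    by (intro sum.mono_neutral_cong_left) (auto simp: indicator_def)
  finally show ?thesis .
qed

lemma prob_space_discrete_law:
  assumes "w \<in> weight_simplex n"
  shows "prob_space (discrete_law n y w)"
proof (rule prob_spaceI)
  have "(\<Sum>i=1..n. ennreal (w i)) = ennreal (\<Sum>i=1..n. w i)"
    using assms by (intro sum_ennreal) (auto simp: weight_simplex_def)
  then show "emeasure (discrete_law n y w) (space (discrete_law n y w)) = 1"
    using assms by (simp add: emeasure_discrete_law weight_simplex_def del: One_nat_def)
qed

lemma nn_integral_discrete_law:
  assumes "f \<in> borel_measurable borel"
  shows "(\<integral>\<^sup>+x. f x \<partial>discrete_law n y w) = (\<Sum>i=1..n. ennreal (w i) * f (y i))"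
  unfolding discrete_law_def using assms
  by (subst nn_integral_distr) (auto simp: nn_integral_point_measure_finite mult.commute)

lemma integral_discrete_law:
  fixes f :: "real \<Rightarrow> real"
  assumes "f \<in> borel_measurable borel" "\<And>i. i \<in> {1..n} \<Longrightarrow> 0 \<le> w i"
  shows "(\<integral>x. f x \<partial>discrete_law n y w) = (\<Sum>i=1..n. w i * f (y i))"
    and "integrable (discrete_law n y w) f"
proof -
  have y: "y \<in> measurable (point_measure {1..n} (\<lambda>i. ennreal (w i))) borel"
    by simp
  show "(\<integral>x. f x \<partial>discrete_law n y w) = (\<Sum>i=1..n. w i * f (y i))"
    unfolding discrete_law_def
    using lebesgue_integral_point_measure_finite[of "{1..n}" w "\<lambda>i. f (y i)", OF _ assms(2)]
    by (subst integral_distr[OF y assms(1)]) simp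
  show "integrable (discrete_law n y w) f"
    unfolding discrete_law_def using assms
    by (subst integrable_distr_eq[OF y]) (auto intro!: integrable_point_measure_finite)
qed

lemma discrete_law_cong:
  assumes "\<And>i. i \<in> {1..n} \<Longrightarrow> w i = w' i"
  shows "discrete_law n y w = discrete_law n y w'"
  by (rule measure_eqI) (auto simp: emeasure_discrete_law assms)

lemma distr_controller:
  assumes "\<sigma> > 0" "thresholds_ok n \<zeta>"
  shows "distr (gauss \<sigma>) borel (controller n y \<zeta>) = discrete_law n y (weights_of \<sigma> \<zeta>)"
proof (rule measure_eqI)
  interpret prob_space "gauss \<sigma>" by (rule prob_space_gauss) fact
  fix A :: "real set" assume "A \<in> sets (distr (gauss \<sigma>) borel (controller n y \<zeta>))"
  then have A [measurable]: "A \<in> sets borel" by simp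
  have "measure (gauss \<sigma>) (controller n y \<zeta> -` A) = (\<integral>x. indicator A (controller n y \<zeta> x) \<partial>gauss \<sigma>)"
  proof -
    have "indicator A (controller n y \<zeta> x) = (indicator (controller n y \<zeta> -` A) x :: real)" for x
      by (simp add: indicator_def)
    then show ?thesis by simp
  qed
  also have "\<dots> = (\<Sum>i=1..n. LINT x:bin \<zeta> i|gauss \<sigma>. indicator A (y i))"
    by (rule integral_split_bins[OF assms(2)]) simp
  also have "\<dots> = (\<Sum>i=1..n. weights_of \<sigma> \<zeta> i * indicator A (y i))"
    using assms thresholds_ok_mono[OF assms(2)]
    by (intro sum.cong) (auto simp: weights_of_eq_measure set_lebesgue_integral_def)
  finally have *: "measure (gauss \<sigma>) (controller n y \<zeta> -` A) = (\<Sum>i=1..n. weights_of \<sigma> \<zeta> i * indicator A (y i))" .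
  have nn: "0 \<le> weights_of \<sigma> \<zeta> i" if "i \<in> {1..n}" for i
    using weights_of_simplex[OF assms] that by (simp add: weight_simplex_def)
  have "emeasure (discrete_law n y (weights_of \<sigma> \<zeta>)) A = (\<Sum>i=1..n. ennreal (weights_of \<sigma> \<zeta> i * indicator A (y i)))"
    unfolding emeasure_discrete_law[OF A]
    by (intro sum.cong refl) (auto simp: indicator_def)
  also have "\<dots> = ennreal (measure (gauss \<sigma>) (controller n y \<zeta> -` A))"
    unfolding * using nn by (subst sum_ennreal) auto
  finally show "emeasure (distr (gauss \<sigma>) borel (controller n y \<zeta>)) A = emeasure (discrete_law n y (weights_of \<sigma> \<zeta>)) A"
    by (subst emeasure_distr) (auto simp: emeasure_eq_measure)
qed simp

section \<open>First moments of the bins and the quadratic cost of a controller\<close>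

lemma normal_density_tendsto_0:
  assumes "\<sigma> > 0"
  shows "(normal_density 0 \<sigma> \<longlongrightarrow> 0) at_top" "(normal_density 0 \<sigma> \<longlongrightarrow> 0) at_bot"
proof -
  have "filterlim (\<lambda>x::real. x\<^sup>2) at_top at_top" "filterlim (\<lambda>x::real. x\<^sup>2) at_top at_bot"
    by real_asymp+
  then have "filterlim (\<lambda>x::real. (1 / (2 * \<sigma>\<^sup>2)) * x\<^sup>2) at_top F" if "F = at_top \<or> F = at_bot" for F
    using that assms by (intro filterlim_tendsto_pos_mult_at_top[OF tendsto_const]) auto
  then have "((\<lambda>x. exp (- (x\<^sup>2 / (2 * \<sigma>\<^sup>2)))) \<longlongrightarrow> 0) F" if "F = at_top \<or> F = at_bot" for F :: "real filter"
    using that by (intro filterlim_compose[OF exp_at_bot]) (auto simp: filterlim_uminus_at_bot)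
  then have "((\<lambda>x. 1 / sqrt (2 * pi * \<sigma>\<^sup>2) * exp (- (x\<^sup>2 / (2 * \<sigma>\<^sup>2)))) \<longlongrightarrow> 0) F" if "F = at_top \<or> F = at_bot" for F :: "real filter"
    using that by (intro tendsto_mult_right_zero) auto
  moreover have "normal_density 0 \<sigma> = (\<lambda>x. 1 / sqrt (2 * pi * \<sigma>\<^sup>2) * exp (- (x\<^sup>2 / (2 * \<sigma>\<^sup>2))))"
    by (simp add: fun_eq_iff normal_density_def)
  ultimately show "(normal_density 0 \<sigma> \<longlongrightarrow> 0) at_top" "(normal_density 0 \<sigma> \<longlongrightarrow> 0) at_bot"
    by simp_all
qed

lemma has_real_derivative_normal_density:
  assumes "\<sigma> > 0"
  shows "(normal_density \<mu> \<sigma> has_real_derivative - (x - \<mu>) / \<sigma>\<^sup>2 * normal_density \<mu> \<sigma> x) (at x)"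
proof -
  have "((\<lambda>x. - (x - \<mu>)\<^sup>2) has_real_derivative - (2 * (x - \<mu>))) (at x)"
    by (auto intro!: derivative_eq_intros)
  moreover have "- (2 * (x - \<mu>)) / (2 * \<sigma>\<^sup>2) = - (x - \<mu>) / \<sigma>\<^sup>2"
    by (metis minus_mult_right mult_divide_mult_cancel_left zero_neq_numeral)
  ultimately have "((\<lambda>x. - (x - \<mu>)\<^sup>2 / (2 * \<sigma>\<^sup>2)) has_real_derivative - (x - \<mu>) / \<sigma>\<^sup>2) (at x)"
    using DERIV_cdivide by metis
  from DERIV_chain2[OF DERIV_exp this]
  have "((\<lambda>x. exp (- (x - \<mu>)\<^sup>2 / (2 * \<sigma>\<^sup>2))) has_real_derivative
      exp (- (x - \<mu>)\<^sup>2 / (2 * \<sigma>\<^sup>2)) * (- (x - \<mu>) / \<sigma>\<^sup>2)) (at x)" .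
  from DERIV_cmult[OF this, of "1 / sqrt (2 * pi * \<sigma>\<^sup>2)"] show ?thesis
    unfolding normal_density_def[abs_def] by (rule DERIV_cong) (simp add: mult.commute)
qed

lemma bin_moment_eq:
  assumes "\<sigma> > 0" "\<zeta> (i - 1) \<le> \<zeta> i"
  shows "bin_moment \<sigma> \<zeta> i = \<sigma>\<^sup>2 * (dens_ext \<sigma> (\<zeta> (i - 1)) - dens_ext \<sigma> (\<zeta> i))"
proof (cases "\<zeta> (i - 1) = \<zeta> i")
  case True
  then have "bin \<zeta> i = {}" by (auto simp: bin_def)
  then show ?thesis using True by (simp add: bin_moment_def set_lebesgue_integral_def)
next
  case False
  define a b where "a = \<zeta> (i - 1)" and "b = \<zeta> i"
  have ab: "a < b" using False assms by (simp add: a_def b_def)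
  \<comment> \<open>The first-moment integrand has the explicit antiderivative \<open>?F\<close>,
    which vanishes at both infinities; this is why \<open>dens_ext\<close> is 0 there.\<close>
  let ?f = "\<lambda>x. normal_density 0 \<sigma> x * x" and ?F = "\<lambda>x. - \<sigma>\<^sup>2 * normal_density 0 \<sigma> x"
  have f: "integrable lborel ?f"
    using integrable_gauss_id[OF assms(1)] by (simp add: integrable_gauss)
  have d: "(?F has_real_derivative ?f x) (at x)" for x
    using DERIV_cmult[OF has_real_derivative_normal_density[OF assms(1), of 0 x], of "- \<sigma>\<^sup>2"] assms
    by (simp add: field_simps)
  have cont: "isCont ?F x" for x by (rule DERIV_isCont[OF d])
  have right: "((?F \<circ> real_of_ereal) \<longlongrightarrow> - \<sigma>\<^sup>2 * dens_ext \<sigma> a) (at_right a)"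
  proof (cases a)
    case (real r)
    then show ?thesis using cont[of r]
      by (auto simp: ereal_tendsto_simps isCont_def dens_ext_def filterlim_at_split)
  next
    case MInf
    then show ?thesis using tendsto_mult_right_zero[OF normal_density_tendsto_0(2)[OF assms(1)], of "- \<sigma>\<^sup>2"]
      by (auto simp: ereal_tendsto_simps dens_ext_def)
  qed (use ab in auto)
  have left: "((?F \<circ> real_of_ereal) \<longlongrightarrow> - \<sigma>\<^sup>2 * dens_ext \<sigma> b) (at_left b)"
  proof (cases b)
    case (real r)
    then show ?thesis using cont[of r]
      by (auto simp: ereal_tendsto_simps isCont_def dens_ext_def filterlim_at_split)
  next
    case PInf
    then show ?thesis using tendsto_mult_right_zero[OF normal_density_tendsto_0(1)[OF assms(1)], of "- \<sigma>\<^sup>2"]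
      by (auto simp: ereal_tendsto_simps dens_ext_def)
  qed (use ab in auto)
  have "bin_moment \<sigma> \<zeta> i = (\<integral>x. normal_density 0 \<sigma> x * (indicator (bin \<zeta> i) x * x) \<partial>lborel)"
    unfolding bin_moment_def set_lebesgue_integral_def by (subst integral_gauss) auto
  also have "\<dots> = (\<integral>x. indicator (einterval a b) x *\<^sub>R ?f x \<partial>lborel)"
  proof (rule integral_cong_AE)
    \<comment> \<open>The half-open bin and the open interval differ at most at a finite right
      endpoint. For infinite \<open>b\<close> the excluded point \<open>real_of_ereal b\<close> is
      the default value 0, again a null set.\<close>
    have "ereal x \<le> b \<longleftrightarrow> ereal x < b" if "x \<noteq> real_of_ereal b" for x
      using that by (cases b) auto
    then have "x \<in> bin \<zeta> i \<longleftrightarrow> x \<in> einterval a b" if "x \<noteq> real_of_ereal b" for x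
      using that by (simp add: bin_def einterval_def a_def b_def)
    then have "x \<noteq> real_of_ereal b \<Longrightarrow> normal_density 0 \<sigma> x * (indicator (bin \<zeta> i) x * x) = indicator (einterval a b) x *\<^sub>R ?f x" for x
      by (simp add: indicator_def)
    then show "AE x in lborel. normal_density 0 \<sigma> x * (indicator (bin \<zeta> i) x * x) = indicator (einterval a b) x *\<^sub>R ?f x"
      using AE_lborel_singleton[of "real_of_ereal b"] by (auto elim!: eventually_mono)
  qed auto
  also have "\<dots> = (LBINT x=a..b. ?f x)"
    using ab unfolding interval_lebesgue_integral_def set_lebesgue_integral_def by simp
  also have "\<dots> = - \<sigma>\<^sup>2 * dens_ext \<sigma> b - (- \<sigma>\<^sup>2 * dens_ext \<sigma> a)"
  proof (rule interval_integral_FTC_integrable[OF ab _ _ _ right left])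
    show "(?F has_vector_derivative ?f x) (at x)" for x
      using d by (simp add: has_real_derivative_iff_has_vector_derivative)
    show "isCont ?f x" for x
      using cont[of x] assms(1) unfolding normal_density_def by (intro continuous_intros) auto
    show "set_integrable lborel (einterval a b) ?f"
      unfolding set_integrable_def by (rule integrable_mult_indicator) (use f in auto)
  qed
  finally show ?thesis by (simp add: a_def b_def algebra_simps)
qed

text \<open>For an empty bin the barycenter is a division by zero with default value 0. The identity
  survives because a zero weight forces the two thresholds to coincide, so the moment is 0 as well.
  This realises the convention that terms of weight zero contribute nothing.\<close>

lemma weight_times_barycenter:
  assumes "\<sigma> > 0" "\<zeta> (i - 1) \<le> \<zeta> i" "w i = weights_of \<sigma> \<zeta> i"
  shows "w i * barycenter \<sigma> \<zeta> w i = bin_moment \<sigma> \<zeta> i"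
proof (cases "w i = 0")
  case True
  then have "\<zeta> (i - 1) = \<zeta> i"
    using assms cdf_ext_eq_iff[OF assms(1), of "\<zeta> i" "\<zeta> (i - 1)"] by (simp add: weights_of_def)
  then show ?thesis using True assms(1) by (simp add: bin_moment_eq)
qed (simp add: barycenter_def)

text \<open>The squared error with the square expanded. Unlike \<open>transport_part\<close> it
  contains no division by a weight, so it suits empty bins, differentiation and limits.\<close>

definition transport_cost :: "real \<Rightarrow> nat \<Rightarrow> (nat \<Rightarrow> real) \<Rightarrow> (nat \<Rightarrow> ereal) \<Rightarrow> real" where
  "transport_cost \<sigma> n y \<zeta> =
     \<sigma>\<^sup>2 - 2 * (\<Sum>i=1..n. y i * bin_moment \<sigma> \<zeta> i) + (\<Sum>i=1..n. weights_of \<sigma> \<zeta> i * (y i)\<^sup>2)"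

text \<open>The squared barycenters cancel between the two sums of \<open>transport_part\<close>;
  what is left contains barycenters only in products with their weights, which are bin
  moments.\<close>

lemma transport_part_eq:
  assumes "\<sigma> > 0" "thresholds_ok n \<zeta>" "\<And>i. i \<in> {1..n} \<Longrightarrow> w i = weights_of \<sigma> \<zeta> i"
  shows "transport_part \<sigma> n y w \<zeta> = transport_cost \<sigma> n y \<zeta>"
proof -
  let ?b = "barycenter \<sigma> \<zeta> w"
  have "(\<Sum>i=1..n. w i * (y i - ?b i)\<^sup>2) - (\<Sum>i=1..n. w i * (?b i)\<^sup>2)
     = (\<Sum>i=1..n. w i * (y i)\<^sup>2 - 2 * (y i * (w i * ?b i)))"
    unfolding sum_subtractf[symmetric] by (intro sum.cong) (auto simp: power2_eq_square algebra_simps)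
  also have "\<dots> = (\<Sum>i=1..n. weights_of \<sigma> \<zeta> i * (y i)\<^sup>2 - 2 * (y i * bin_moment \<sigma> \<zeta> i))"
    using weight_times_barycenter[OF assms(1)] thresholds_ok_mono[OF assms(2)] assms(3)
    by (intro sum.cong) auto
  finally show ?thesis
    by (simp add: transport_part_def transport_cost_def sum_subtractf sum_distrib_left)
qed

lemma transport_cost_integral:
  assumes "\<sigma> > 0" "thresholds_ok n \<zeta>"
  shows "transport_cost \<sigma> n y \<zeta> = (\<integral>x. (x - controller n y \<zeta> x)\<^sup>2 \<partial>gauss \<sigma>)"
    and "integrable (gauss \<sigma>) (\<lambda>x. (x - controller n y \<zeta> x)\<^sup>2)"
    and "(\<integral>x. x * controller n y \<zeta> x \<partial>gauss \<sigma>) = (\<Sum>i=1..n. y i * bin_moment \<sigma> \<zeta> i)"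
    and "integrable (gauss \<sigma>) (\<lambda>x. x * controller n y \<zeta> x)"
    and "(\<integral>x. (controller n y \<zeta> x)\<^sup>2 \<partial>gauss \<sigma>) = (\<Sum>i=1..n. weights_of \<sigma> \<zeta> i * (y i)\<^sup>2)"
    and "integrable (gauss \<sigma>) (\<lambda>x. (controller n y \<zeta> x)\<^sup>2)"
proof -
  interpret prob_space "gauss \<sigma>" by (rule prob_space_gauss) fact
  let ?f = "controller n y \<zeta>"
  note x = integrable_gauss_id[OF assms(1)] integrable_gauss_sq[OF assms(1)]
  show i1: "integrable (gauss \<sigma>) (\<lambda>x. x * ?f x)"
    using x by (intro integral_split_bins(1)[OF assms(2), of \<sigma> "\<lambda>x z. x * z"]) auto
  have "(\<integral>x. x * ?f x \<partial>gauss \<sigma>) = (\<Sum>i=1..n. LINT x:bin \<zeta> i|gauss \<sigma>. x * y i)"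
    using x by (intro integral_split_bins(2)[OF assms(2), of \<sigma> "\<lambda>x z. x * z"]) auto
  also have "\<dots> = (\<Sum>i=1..n. y i * bin_moment \<sigma> \<zeta> i)"
    by (simp add: bin_moment_def mult.commute)
  finally show e1: "(\<integral>x. x * ?f x \<partial>gauss \<sigma>) = (\<Sum>i=1..n. y i * bin_moment \<sigma> \<zeta> i)" .
  show i2: "integrable (gauss \<sigma>) (\<lambda>x. (?f x)\<^sup>2)"
    by (intro integral_split_bins(1)[OF assms(2), of \<sigma> "\<lambda>x z. z\<^sup>2"]) auto
  have "(\<integral>x. (?f x)\<^sup>2 \<partial>gauss \<sigma>) = (\<Sum>i=1..n. LINT x:bin \<zeta> i|gauss \<sigma>. (y i)\<^sup>2)"
    by (intro integral_split_bins(2)[OF assms(2), of \<sigma> "\<lambda>x z. z\<^sup>2"]) auto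
  also have "\<dots> = (\<Sum>i=1..n. weights_of \<sigma> \<zeta> i * (y i)\<^sup>2)"
    using thresholds_ok_mono[OF assms(2)]
    by (intro sum.cong) (auto simp: weights_of_eq_measure[OF assms(1)] set_lebesgue_integral_def)
  finally show e2: "(\<integral>x. (?f x)\<^sup>2 \<partial>gauss \<sigma>) = (\<Sum>i=1..n. weights_of \<sigma> \<zeta> i * (y i)\<^sup>2)" .
  have eq: "(x - ?f x)\<^sup>2 = x\<^sup>2 - 2 * (x * ?f x) + (?f x)\<^sup>2" for x
    by (simp add: power2_diff)
  show "integrable (gauss \<sigma>) (\<lambda>x. (x - ?f x)\<^sup>2)"
    unfolding eq using x i1 i2 by auto
  show "transport_cost \<sigma> n y \<zeta> = (\<integral>x. (x - ?f x)\<^sup>2 \<partial>gauss \<sigma>)"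
    unfolding eq transport_cost_def using x i1 i2 e1 e2 integral_gauss_sq[OF assms(1)] by simp
qed

subsection \<open>The transport part\<close>

lemma couplingsD:
  assumes "\<pi> \<in> couplings P Q" and "prob_space P" and "sets P = sets borel" "sets Q = sets borel"
  shows "prob_space \<pi>" "sets \<pi> = sets (borel \<Otimes>\<^sub>M borel)"
    and "\<And>h::real \<Rightarrow> real. h \<in> borel_measurable borel \<Longrightarrow> integrable \<pi> (\<lambda>z. h (fst z)) \<longleftrightarrow> integrable P h"
    and "\<And>h::real \<Rightarrow> real. h \<in> borel_measurable borel \<Longrightarrow> integrable \<pi> (\<lambda>z. h (snd z)) \<longleftrightarrow> integrable Q h"
    and "\<And>h::real \<Rightarrow> real. h \<in> borel_measurable borel \<Longrightarrow> (\<integral>z. h (fst z) \<partial>\<pi>) = (\<integral>x. h x \<partial>P)"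
    and "\<And>h::real \<Rightarrow> real. h \<in> borel_measurable borel \<Longrightarrow> (\<integral>z. h (snd z) \<partial>\<pi>) = (\<integral>x. h x \<partial>Q)"
proof -
  show s: "sets \<pi> = sets (borel \<Otimes>\<^sub>M borel)"
    using assms(1) by (simp add: couplings_def)
  have P: "P = distr \<pi> borel fst" and Q: "Q = distr \<pi> borel snd"
    using assms(1) by (auto simp: couplings_def)
  have f: "fst \<in> measurable \<pi> borel" and g: "snd \<in> measurable \<pi> borel"
    using measurable_fst[of borel borel] measurable_snd[of borel borel]
    by (simp_all add: measurable_cong_sets[OF s refl])
  show "prob_space \<pi>" using assms(2) f unfolding P by (rule prob_space_distrD[rotated])
  fix h :: "real \<Rightarrow> real" assume h: "h \<in> borel_measurable borel"
  show "integrable \<pi> (\<lambda>z. h (fst z)) \<longleftrightarrow> integrable P h"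
    unfolding P using h f by (simp add: integrable_distr_eq)
  show "integrable \<pi> (\<lambda>z. h (snd z)) \<longleftrightarrow> integrable Q h"
    unfolding Q using h g by (simp add: integrable_distr_eq)
  show "(\<integral>z. h (fst z) \<partial>\<pi>) = (\<integral>x. h x \<partial>P)"
    unfolding P using h f by (simp add: integral_distr)
  show "(\<integral>z. h (snd z) \<partial>\<pi>) = (\<integral>x. h x \<partial>Q)"
    unfolding Q using h g by (simp add: integral_distr)
qed

text \<open>The graph of the controller is an explicit coupling, with the levels in any order;
  optimality is the matter of ordered levels only.\<close>

lemma wasserstein2_sq_le_transport_cost:
  assumes "\<sigma> > 0" "thresholds_ok n \<zeta>"
  shows "wasserstein2_sq (gauss \<sigma>) (discrete_law n y (weights_of \<sigma> \<zeta>)) \<le> ereal (transport_cost \<sigma> n y \<zeta>)"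
proof -
  let ?f = "controller n y \<zeta>"
  let ?\<pi> = "distr (gauss \<sigma>) (borel \<Otimes>\<^sub>M borel) (\<lambda>x. (x, ?f x))"
  have "distr ?\<pi> borel fst = gauss \<sigma>"
    by (subst distr_distr) (auto simp: comp_def intro!: distr_id2)
  moreover have "distr ?\<pi> borel snd = discrete_law n y (weights_of \<sigma> \<zeta>)"
    by (subst distr_distr) (auto simp: comp_def distr_controller[OF assms])
  ultimately have "?\<pi> \<in> couplings (gauss \<sigma>) (discrete_law n y (weights_of \<sigma> \<zeta>))"
    by (simp add: couplings_def)
  then have "wasserstein2_sq (gauss \<sigma>) (discrete_law n y (weights_of \<sigma> \<zeta>))
      \<le> enn2ereal (\<integral>\<^sup>+ (x, y). ennreal ((x - y)\<^sup>2) \<partial>?\<pi>)"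
    unfolding wasserstein2_sq_def by (rule INF_lower)
  also have "(\<integral>\<^sup>+ (x, y). ennreal ((x - y)\<^sup>2) \<partial>?\<pi>) = (\<integral>\<^sup>+ x. ennreal ((x - ?f x)\<^sup>2) \<partial>gauss \<sigma>)"
    by (subst nn_integral_distr) auto
  also have "\<dots> = ennreal (transport_cost \<sigma> n y \<zeta>)"
    unfolding transport_cost_integral(1)[OF assms]
    by (rule nn_integral_eq_integral) (auto intro: transport_cost_integral(2)[OF assms])
  also have "enn2ereal \<dots> = ereal (transport_cost \<sigma> n y \<zeta>)"
    by (subst enn2ereal_ennreal) (auto simp: transport_cost_integral(1)[OF assms])
  finally show ?thesis .
qed

text \<open>The cross moment is bounded layer by layer: \<open>y = y\<^sub>1 + \<Sum>\<^sub>j (y\<^sub>j\<^sub>+\<^sub>1 - y\<^sub>j) 1[y > y\<^sub>j]\<close>, and among all events of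
  given probability the upper tail of \<open>x\<close> maximises the partial expectation of \<open>x\<close>. Weakly
  increasing levels are admitted because the splitting argument below needs a repeated level.\<close>

lemma layer_cake_levels:
  fixes y :: "nat \<Rightarrow> real"
  assumes "mono_on {1..n} y" "i \<in> {1..n}"
    and P: "\<And>j. j \<in> {1..<n} \<Longrightarrow> y j < y (Suc j) \<Longrightarrow> P j \<longleftrightarrow> j < i"
  shows "(\<Sum>j=1..<n. (y (Suc j) - y j) * (if P j then 1 else 0)) = y i - y 1"
proof -
  have "(\<Sum>j=1..<n. (y (Suc j) - y j) * (if P j then 1 else 0)) = (\<Sum>j=1..<i. y (Suc j) - y j)"
  proof (rule sum.mono_neutral_cong_right)
    show "\<forall>j\<in>{1..<n} - {1..<i}. (y (Suc j) - y j) * (if P j then 1 else 0) = 0"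
    proof
      fix j assume j: "j \<in> {1..<n} - {1..<i}"
      then have "y j \<le> y (Suc j)" by (intro mono_onD[OF assms(1)]) auto
      then show "(y (Suc j) - y j) * (if P j then 1 else 0) = 0"
        using P[of j] j by (cases "y j < y (Suc j)") auto
    qed
    show "(y (Suc j) - y j) * (if P j then 1 else 0) = y (Suc j) - y j" if j: "j \<in> {1..<i}" for j
    proof -
      have "y j \<le> y (Suc j)" "j \<in> {1..<n}" using j assms(2) by (auto intro!: mono_onD[OF assms(1)])
      then show ?thesis using P[of j] j
        by (cases "y j < y (Suc j)") auto
    qed
  qed (use assms(2) in auto)
  also have "\<dots> = y i - y 1"
    using sum_Suc_diff'[of 1 i y] assms(2) by simp
  finally show ?thesis .
qed

lemma coupling_tail_le:
  fixes c :: ereal and B :: "real set"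
  assumes "\<sigma> > 0" and \<pi>: "\<pi> \<in> couplings (gauss \<sigma>) Q" and Q: "sets Q = sets borel"
    and B: "B \<in> sets borel" and m: "measure Q B = 1 - cdf_ext \<sigma> c"
  shows "(\<integral>z. fst z * indicator B (snd z) \<partial>\<pi>) \<le> (\<integral>x. x * indicator {x. c < ereal x} x \<partial>gauss \<sigma>)"
proof -
  interpret P: prob_space "gauss \<sigma>" by (rule prob_space_gauss) fact
  note C = couplingsD[OF \<pi> prob_space_gauss[OF assms(1)] sets_gauss Q]
  interpret \<pi>: prob_space \<pi> by (rule C(1))
  have [measurable]: "fst \<in> borel_measurable \<pi>" "snd \<in> borel_measurable \<pi>"
    using measurable_fst[of borel borel] measurable_snd[of borel borel]
    by (simp_all add: measurable_cong_sets[OF C(2) refl])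
  note B [measurable]
  let ?A = "{x. c < ereal x}"
  have [measurable]: "?A \<in> sets borel" by measurable
  have idB: "integrable \<pi> (\<lambda>z. fst z)"
    by (rule C(3)[of "\<lambda>x. x", THEN iffD2, OF _ integrable_gauss_id[OF assms(1)]]) simp
  have i1: "integrable \<pi> (\<lambda>z. fst z * indicator B (snd z))"
    by (rule Bochner_Integration.integrable_bound[OF idB]) (auto simp: indicator_def)
  have i2: "integrable \<pi> (\<lambda>z. fst z * indicator ?A (fst z))"
    by (rule Bochner_Integration.integrable_bound[OF idB]) (auto simp: indicator_def)
  have i3: "integrable \<pi> (\<lambda>z. indicator B (snd z) :: real)"
    by (rule \<pi>.integrable_const_bound[of _ 1]) (auto simp: indicator_def)
  have i4: "integrable \<pi> (\<lambda>z. indicator ?A (fst z) :: real)"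
    by (rule \<pi>.integrable_const_bound[of _ 1]) (auto simp: indicator_def)
  have "P.prob (UNIV - {x. ereal x \<le> c}) = 1 - cdf_ext \<sigma> c"
    using P.prob_compl[of "{x. ereal x \<le> c}"] by (simp add: cdf_ext_def)
  moreover have "UNIV - {x. ereal x \<le> c} = ?A" by auto
  ultimately have A: "(\<integral>z. indicator ?A (fst z) \<partial>\<pi>) = 1 - cdf_ext \<sigma> c"
    using C(5)[of "indicator ?A"] by simp
  have Bm: "(\<integral>z. indicator B (snd z) \<partial>\<pi>) = 1 - cdf_ext \<sigma> c"
    using C(6)[of "indicator B"] m Q by simp
  have target: "(\<integral>x. x * indicator ?A x \<partial>gauss \<sigma>) = (\<integral>z. fst z * indicator ?A (fst z) \<partial>\<pi>)"
    using C(5)[of "\<lambda>x. x * indicator ?A x"] by simp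
  show ?thesis
  proof (cases c)
    case (real r)
    \<comment> \<open>Bathtub argument: \<open>fst z - r\<close> is positive exactly on the tail
      event, so replacing \<open>B\<close> by the tail can only raise the integrand up to a multiple
      of \<open>r\<close>. That multiple integrates to zero because both events have the same
      mass.\<close>
    have "(\<integral>z. fst z * indicator B (snd z) \<partial>\<pi>)
        \<le> (\<integral>z. fst z * indicator ?A (fst z) + r * (indicator B (snd z) - indicator ?A (fst z)) \<partial>\<pi>)"
      using i1 i2 i3 i4 by (intro integral_mono) (auto simp: real indicator_def)
    also have "\<dots> = (\<integral>z. fst z * indicator ?A (fst z) \<partial>\<pi>)"
      using i2 i3 i4 A Bm by simp
    finally show ?thesis using target by simp
  next
    case PInf
    \<comment> \<open>An infinite \<open>c\<close> offers no real multiplier \<open>r\<close>; here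
      the prescribed mass makes \<open>B\<close> a null event, and in the remaining case an almost
      sure one.\<close>
    have "AE z in \<pi>. indicator B (snd z) = (0::real)"
      using integral_nonneg_eq_0_iff_AE[OF i3] Bm PInf assms(1) by simp
    then have "(\<integral>z. fst z * indicator B (snd z) \<partial>\<pi>) = (\<integral>z. 0 \<partial>\<pi>)"
      by (intro integral_cong_AE) (auto elim!: eventually_mono)
    then show ?thesis using PInf by simp
  next
    case MInf
    have "AE z in \<pi>. 1 - indicator B (snd z) = (0::real)"
    proof (subst integral_nonneg_eq_0_iff_AE[symmetric])
      show "(\<integral>z. 1 - indicator B (snd z) \<partial>\<pi>) = (0::real)"
        using i3 Bm MInf \<pi>.prob_space by simp
    qed (use i3 in \<open>auto simp: indicator_def\<close>)
    then have "(\<integral>z. fst z * indicator B (snd z) \<partial>\<pi>) = (\<integral>z. fst z \<partial>\<pi>)"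
      by (intro integral_cong_AE) (auto elim!: eventually_mono)
    then show ?thesis using MInf target by simp
  qed
qed

lemma AE_discrete_law: "AE z in discrete_law n y w. z \<in> y ` {1..n}"
  unfolding discrete_law_def
  by (subst AE_distr_iff) (auto simp: space_point_measure finite_imp_closed intro!: AE_I2)

lemma AE_coupling_snd:
  assumes "\<pi> \<in> couplings P Q" "AE z in Q. z \<in> S" "S \<in> sets borel"
  shows "AE z in \<pi>. snd z \<in> S"
proof -
  have s: "sets \<pi> = sets (borel \<Otimes>\<^sub>M borel)" and Q: "Q = distr \<pi> borel snd"
    using assms(1) by (auto simp: couplings_def)
  have "snd \<in> measurable \<pi> borel"
    using measurable_snd[of borel borel] by (simp add: measurable_cong_sets[OF s refl])
  then show ?thesis using assms(2,3) unfolding Q by (subst (asm) AE_distr_iff) auto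
qed

text \<open>Both cross moments are expanded over the same layers: under the coupling the layer
  \<open>j\<close> is the event \<open>snd z > y j\<close>, under the Gaussian it is
  \<open>x > \<zeta> j\<close>. The comparison then holds layer by layer, since the factors
  \<open>y (Suc j) - y j\<close> are nonnegative.\<close>

lemma coupling_cross_moment_le:
  assumes "\<sigma> > 0" "thresholds_ok n \<zeta>" "mono_on {1..n} y"
    and \<pi>: "\<pi> \<in> couplings (gauss \<sigma>) (discrete_law n y (weights_of \<sigma> \<zeta>))"
  shows "(\<integral>z. fst z * snd z \<partial>\<pi>) \<le> (\<integral>x. x * controller n y \<zeta> x \<partial>gauss \<sigma>)"
proof -
  let ?Q = "discrete_law n y (weights_of \<sigma> \<zeta>)"
  interpret P: prob_space "gauss \<sigma>" by (rule prob_space_gauss) fact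
  note C = couplingsD[OF \<pi> prob_space_gauss[OF assms(1)] sets_gauss sets_discrete_law]
  interpret \<pi>: prob_space \<pi> by (rule C(1))
  have n: "1 \<le> n" by (rule thresholds_ok_pos) fact
  have [measurable]: "fst \<in> borel_measurable \<pi>" "snd \<in> borel_measurable \<pi>"
    using measurable_fst[of borel borel] measurable_snd[of borel borel]
    by (simp_all add: measurable_cong_sets[OF C(2) refl])
  let ?B = "\<lambda>j. {y j<..}" and ?A = "\<lambda>j. {x. \<zeta> j < ereal x}"
  have [measurable]: "?A j \<in> sets borel" for j by measurable
  let ?d = "\<lambda>j. y (Suc j) - y j"
  have idB: "integrable \<pi> (\<lambda>z. fst z)"
    by (rule C(3)[of "\<lambda>x. x", THEN iffD2, OF _ integrable_gauss_id[OF assms(1)]]) simp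
  have i1: "integrable \<pi> (\<lambda>z. fst z * indicator (?B j) (snd z))" for j
    by (rule Bochner_Integration.integrable_bound[OF idB]) (auto simp: indicator_def)
  have i2: "integrable (gauss \<sigma>) (\<lambda>x. x * indicator (?A j) x)" for j
    by (rule Bochner_Integration.integrable_bound[OF integrable_gauss_id[OF assms(1)]]) (auto simp: indicator_def)
  have "AE z in \<pi>. snd z \<in> y ` {1..n}"
    by (rule AE_coupling_snd[OF \<pi> AE_discrete_law]) (auto simp: finite_imp_closed)
  then have "AE z in \<pi>. fst z * snd z = y 1 * fst z + (\<Sum>j=1..<n. ?d j * (fst z * indicator (?B j) (snd z)))"
  proof eventually_elim
    case (elim z)
    then obtain i where i: "i \<in> {1..n}" "snd z = y i" by blast
    have "(\<Sum>j=1..<n. ?d j * (if y j < y i then 1 else 0)) = y i - y 1"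
    proof (rule layer_cake_levels[OF assms(3) i(1)])
      fix j assume j: "j \<in> {1..<n}" "y j < y (Suc j)"
      have "y i \<le> y j" if "\<not> j < i" using that j i by (intro mono_onD[OF assms(3)]) auto
      moreover have "y (Suc j) \<le> y i" if "j < i" using that j i by (intro mono_onD[OF assms(3)]) auto
      ultimately show "y j < y i \<longleftrightarrow> j < i" using j(2) by force
    qed
    then have "(\<Sum>j=1..<n. fst z * (?d j * (if y j < y i then 1 else 0))) = fst z * (y i - y 1)"
      by (subst sum_distrib_left[symmetric]) (simp only:)
    moreover have "(\<Sum>j=1..<n. ?d j * (fst z * indicator (?B j) (snd z))) = (\<Sum>j=1..<n. fst z * (?d j * (if y j < y i then 1 else 0)))"
      by (intro sum.cong) (auto simp: i(2))
    ultimately show ?case using i(2) by (simp only:) (simp add: algebra_simps)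
  qed
  then have "(\<integral>z. fst z * snd z \<partial>\<pi>) = (\<integral>z. y 1 * fst z + (\<Sum>j=1..<n. ?d j * (fst z * indicator (?B j) (snd z))) \<partial>\<pi>)"
    by (intro integral_cong_AE) auto
  also have "\<dots> = y 1 * (\<integral>z. fst z \<partial>\<pi>) + (\<Sum>j=1..<n. ?d j * (\<integral>z. fst z * indicator (?B j) (snd z) \<partial>\<pi>))"
    using idB i1 by simp
  also have "(\<integral>z. fst z \<partial>\<pi>) = (\<integral>x. x \<partial>gauss \<sigma>)"
    using C(5)[of "\<lambda>x. x"] by simp
  also have "(\<Sum>j=1..<n. ?d j * (\<integral>z. fst z * indicator (?B j) (snd z) \<partial>\<pi>))
      \<le> (\<Sum>j=1..<n. ?d j * (\<integral>x. x * indicator (?A j) x \<partial>gauss \<sigma>))"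
  proof (rule sum_mono)
    fix j assume j: "j \<in> {1..<n}"
    have le: "y j \<le> y (Suc j)" using j by (intro mono_onD[OF assms(3)]) auto
    show "?d j * (\<integral>z. fst z * indicator (?B j) (snd z) \<partial>\<pi>) \<le> ?d j * (\<integral>x. x * indicator (?A j) x \<partial>gauss \<sigma>)"
    \<comment> \<open>Only for a genuine jump does the event \<open>snd z > y j\<close> have the
      mass \<open>1 - cdf_ext \<sigma> (\<zeta> j)\<close>; at a repeated level the factor of the
      layer is zero.\<close>
    proof (cases "y j < y (Suc j)")
      case True
      have *: "y j < y i \<longleftrightarrow> j < i" if i: "i \<in> {1..n}" for i
      proof -
        have "y i \<le> y j" if "\<not> j < i" using that j i by (intro mono_onD[OF assms(3)]) auto
        moreover have "y (Suc j) \<le> y i" if "j < i" using that j i by (intro mono_onD[OF assms(3)]) auto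
        ultimately show ?thesis using True by force
      qed
      have "measure ?Q (?B j) = (\<integral>z. indicator (?B j) z \<partial>?Q)" by simp
      also have "\<dots> = (\<Sum>i=1..n. weights_of \<sigma> \<zeta> i * indicator (?B j) (y i))"
        using weights_of_simplex[OF assms(1,2)] by (intro integral_discrete_law) (auto simp: weight_simplex_def)
      also have "\<dots> = (\<Sum>i=1..n. weights_of \<sigma> \<zeta> i * (if j < i then 1 else 0))"
        using * by (intro sum.cong) (auto simp: indicator_def)
      also have "\<dots> = (\<Sum>i\<in>{1..n} - {1..j}. weights_of \<sigma> \<zeta> i)"
        by (intro sum.mono_neutral_cong_right) auto
      also have "\<dots> = (\<Sum>i=1..n. weights_of \<sigma> \<zeta> i) - (\<Sum>i=1..j. weights_of \<sigma> \<zeta> i)"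
        using j by (intro sum_diff) auto
      also have "\<dots> = 1 - cdf_ext \<sigma> (\<zeta> j)"
        using assms(1,2) by (simp only: sum_weights_of[of \<zeta>] thresholds_ok_def cdf_ext_infty)
      finally have "measure ?Q (?B j) = 1 - cdf_ext \<sigma> (\<zeta> j)" .
      then show ?thesis using le
        by (intro mult_left_mono coupling_tail_le[OF assms(1) \<pi>]) auto
    qed (use le in auto)
  qed
  also have "y 1 * (\<integral>x. x \<partial>gauss \<sigma>) + (\<Sum>j=1..<n. ?d j * (\<integral>x. x * indicator (?A j) x \<partial>gauss \<sigma>))
     = (\<integral>x. y 1 * x + (\<Sum>j=1..<n. ?d j * (x * indicator (?A j) x)) \<partial>gauss \<sigma>)"
    using i2 integrable_gauss_id[OF assms(1)] by simp
  also have "\<dots> = (\<integral>x. x * controller n y \<zeta> x \<partial>gauss \<sigma>)"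
  proof (rule Bochner_Integration.integral_cong)
    fix x
    obtain i where i: "i \<in> {1..n}" "x \<in> bin \<zeta> i" using bin_exists[OF assms(2), of x] .
    have "(\<Sum>j=1..<n. ?d j * (if x \<in> ?A j then 1 else 0)) = y i - y 1"
    proof (rule layer_cake_levels[OF assms(3) i(1)])
      fix j assume j: "j \<in> {1..<n}"
      have "\<zeta> i \<le> \<zeta> j" if "\<not> j < i" using that j i by (intro thresholds_ok_mono[OF assms(2)]) auto
      moreover have "\<zeta> j \<le> \<zeta> (i - 1)" if "j < i" using that j i by (intro thresholds_ok_mono[OF assms(2)]) auto
      ultimately show "x \<in> ?A j \<longleftrightarrow> j < i" using i(2) by (fastforce simp: bin_def)
    qed
    then have "(\<Sum>j=1..<n. x * (?d j * (if x \<in> ?A j then 1 else 0))) = x * (y i - y 1)"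
      by (subst sum_distrib_left[symmetric]) (simp only:)
    moreover have "(\<Sum>j=1..<n. ?d j * (x * indicator (?A j) x)) = (\<Sum>j=1..<n. x * (?d j * (if x \<in> ?A j then 1 else 0)))"
      by (intro sum.cong) auto
    ultimately show "y 1 * x + (\<Sum>j=1..<n. ?d j * (x * indicator (?A j) x)) = x * controller n y \<zeta> x"
      using controller_eq[OF assms(2) i, of y] by (simp only:) (simp add: algebra_simps)
  qed simp
  finally show ?thesis by simp
qed

text \<open>The marginals fix both second moments, so minimising the cost over couplings amounts to
  maximising the cross moment.\<close>

lemma wasserstein2_sq_eq:
  assumes "\<sigma> > 0" "thresholds_ok n \<zeta>" "mono_on {1..n} y"
  shows "wasserstein2_sq (gauss \<sigma>) (discrete_law n y (weights_of \<sigma> \<zeta>)) = ereal (transport_cost \<sigma> n y \<zeta>)"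
proof (rule antisym[OF wasserstein2_sq_le_transport_cost[OF assms(1,2)]])
  let ?Q = "discrete_law n y (weights_of \<sigma> \<zeta>)"
  show "ereal (transport_cost \<sigma> n y \<zeta>) \<le> wasserstein2_sq (gauss \<sigma>) ?Q"
    unfolding wasserstein2_sq_def
  proof (rule INF_greatest)
    fix \<pi> assume \<pi>: "\<pi> \<in> couplings (gauss \<sigma>) ?Q"
    note C = couplingsD[OF \<pi> prob_space_gauss[OF assms(1)] sets_gauss sets_discrete_law]
    have [measurable]: "fst \<in> borel_measurable \<pi>" "snd \<in> borel_measurable \<pi>"
      using measurable_fst[of borel borel] measurable_snd[of borel borel]
      by (simp_all add: measurable_cong_sets[OF C(2) refl])
    have nn: "0 \<le> weights_of \<sigma> \<zeta> i" if "i \<in> {1..n}" for i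
      using weights_of_simplex[OF assms(1,2)] that by (simp add: weight_simplex_def)
    have iQ: "integrable ?Q (\<lambda>x. x\<^sup>2)" "(\<integral>x. x\<^sup>2 \<partial>?Q) = (\<Sum>i=1..n. weights_of \<sigma> \<zeta> i * (y i)\<^sup>2)"
      by (rule integral_discrete_law; use nn in simp)+
    have sq: "(\<lambda>x::real. x\<^sup>2) \<in> borel_measurable borel" by simp
    have i1: "integrable \<pi> (\<lambda>z. (fst z)\<^sup>2)" "(\<integral>z. (fst z)\<^sup>2 \<partial>\<pi>) = \<sigma>\<^sup>2"
      using C(3)[OF sq] C(5)[OF sq] integrable_gauss_sq[OF assms(1)] integral_gauss_sq[OF assms(1)] by auto
    have i2: "integrable \<pi> (\<lambda>z. (snd z)\<^sup>2)" "(\<integral>z. (snd z)\<^sup>2 \<partial>\<pi>) = (\<Sum>i=1..n. weights_of \<sigma> \<zeta> i * (y i)\<^sup>2)"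
      using C(4)[OF sq] C(6)[OF sq] iQ by auto
    have "integrable \<pi> (\<lambda>z. (fst z)\<^sup>2 + (snd z)\<^sup>2)" using i1(1) i2(1) by (rule Bochner_Integration.integrable_add)
    then have i3: "integrable \<pi> (\<lambda>z. fst z * snd z)"
    proof (rule Bochner_Integration.integrable_bound)
      have "\<bar>a * b\<bar> \<le> a\<^sup>2 + b\<^sup>2" for a b :: real
        using sum_squares_bound[of "\<bar>a\<bar>" "\<bar>b\<bar>"] abs_ge_zero[of "a * b"] unfolding abs_mult power2_abs by linarith
      then show "AE z in \<pi>. norm (fst z * snd z) \<le> norm ((fst z)\<^sup>2 + (snd z)\<^sup>2)" by simp
    qed simp
    have eq: "(fst z - snd z)\<^sup>2 = (fst z)\<^sup>2 - 2 * (fst z * snd z) + (snd z)\<^sup>2" for z :: "real \<times> real"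
      by (simp add: power2_diff)
    have i4: "integrable \<pi> (\<lambda>z. (fst z - snd z)\<^sup>2)"
      unfolding eq using i1 i2 i3 by auto
    have "transport_cost \<sigma> n y \<zeta> \<le> (\<integral>z. (fst z - snd z)\<^sup>2 \<partial>\<pi>)"
      unfolding eq transport_cost_def
      using i1 i2 i3 coupling_cross_moment_le[OF assms \<pi>] transport_cost_integral(3)[OF assms(1,2), of y] by simp
    then have "ereal (transport_cost \<sigma> n y \<zeta>) \<le> enn2ereal (ennreal (\<integral>z. (fst z - snd z)\<^sup>2 \<partial>\<pi>))"
      by (subst enn2ereal_ennreal) auto
    also have "ennreal (\<integral>z. (fst z - snd z)\<^sup>2 \<partial>\<pi>) = (\<integral>\<^sup>+ z. ennreal ((fst z - snd z)\<^sup>2) \<partial>\<pi>)"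
      by (rule nn_integral_eq_integral[symmetric]) (use i4 in auto)
    finally show "ereal (transport_cost \<sigma> n y \<zeta>) \<le> enn2ereal (\<integral>\<^sup>+ (x, y). ennreal ((x - y)\<^sup>2) \<partial>\<pi>)"
      by (simp only: case_prod_beta')
  qed
qed

subsection \<open>The estimation part\<close>

abbreviation phi :: "real \<Rightarrow> real" where "phi \<equiv> std_normal_density"

lemma phi_shift: "phi (z - a) = normal_density a 1 z"
  by (simp add: normal_density_def)

lemma integrable_phi_shift [simp]: "integrable lborel (\<lambda>z. phi (z - a))"
  unfolding phi_shift by simp

lemma integral_phi_shift [simp]: "(\<integral>z. phi (z - a) \<partial>lborel) = 1"
  unfolding phi_shift by simp

lemma phi_pos [simp]: "0 < phi z"
  by (simp add: normal_density_pos)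

lemma phi_nonneg [simp]: "0 \<le> phi z"
  by simp

lemma phi_neq_0 [simp]: "phi z \<noteq> 0"
  using phi_pos[of z] by linarith

lemma integrable_phi_bounded:
  fixes k :: "real \<Rightarrow> real"
  assumes [measurable]: "k \<in> borel_measurable borel" and "\<And>z. \<bar>k z\<bar> \<le> B"
  shows "integrable lborel (\<lambda>z. phi (z - a) * k z)"
proof (rule Bochner_Integration.integrable_bound)
  show "integrable lborel (\<lambda>z. phi (z - a) * B)" by simp
  have "\<bar>k z\<bar> \<le> \<bar>B\<bar>" for z using assms(2)[of z] by linarith
  then show "AE z in lborel. norm (phi (z - a) * k z) \<le> norm (phi (z - a) * B)"
    by (simp add: abs_mult mult_left_mono)
qed simp

lemma mix_dens_pos:
  assumes "w \<in> weight_simplex n"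
  shows "0 < mix_dens n y w z"
proof -
  have "\<exists>i\<in>{1..n}. w i \<noteq> 0"
  proof (rule ccontr)
    assume "\<not> (\<exists>i\<in>{1..n}. w i \<noteq> 0)"
    then have "(\<Sum>i=1..n. w i) = 0" by (intro sum.neutral) blast
    then show False using assms by (simp add: weight_simplex_def)
  qed
  then obtain i where "i \<in> {1..n}" "w i \<noteq> 0" by blast
  then have "0 < w i * phi (z - y i)" using assms by (simp add: weight_simplex_def order_less_le)
  then show ?thesis
    unfolding mix_dens_def using assms \<open>i \<in> {1..n}\<close>
    by (intro sum_pos2[of _ i]) (auto simp: weight_simplex_def)
qed

lemma abs_mix_num_le:
  assumes "w \<in> weight_simplex n"
  shows "\<bar>mix_num n y w z\<bar> \<le> (\<Sum>i=1..n. \<bar>y i\<bar>) * mix_dens n y w z"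
proof -
  have "\<bar>mix_num n y w z\<bar> \<le> (\<Sum>i=1..n. \<bar>w i * y i * phi (z - y i)\<bar>)"
    unfolding mix_num_def by (rule sum_abs)
  also have "\<dots> \<le> (\<Sum>i=1..n. (\<Sum>j=1..n. \<bar>y j\<bar>) * (w i * phi (z - y i)))"
  proof (rule sum_mono)
    fix i assume i: "i \<in> {1..n}"
    have "\<bar>y i\<bar> \<le> (\<Sum>j=1..n. \<bar>y j\<bar>)" using i by (intro member_le_sum) auto
    moreover have "0 \<le> w i" using assms i by (simp add: weight_simplex_def)
    ultimately have "\<bar>y i\<bar> * (w i * phi (z - y i)) \<le> (\<Sum>j=1..n. \<bar>y j\<bar>) * (w i * phi (z - y i))"
      by (intro mult_right_mono) auto
    then show "\<bar>w i * y i * phi (z - y i)\<bar> \<le> (\<Sum>j=1..n. \<bar>y j\<bar>) * (w i * phi (z - y i))"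
      using \<open>0 \<le> w i\<close> by (simp add: abs_mult mult_ac)
  qed
  finally show ?thesis by (simp add: mix_dens_def sum_distrib_left)
qed

text \<open>The posterior mean is a convex combination of the levels. The crude bound by the sum of
  all absolute values is independent of \<open>z\<close>, which makes it an admissible bounded
  estimator.\<close>

lemma abs_post_mean_le:
  assumes "w \<in> weight_simplex n"
  shows "\<bar>post_mean n y w z\<bar> \<le> (\<Sum>i=1..n. \<bar>y i\<bar>)"
  using abs_mix_num_le[OF assms, of y z] mix_dens_pos[OF assms, of y z]
  by (simp add: post_mean_def abs_divide divide_le_eq)

lemma measurable_mix [measurable]:
  "mix_dens n y w \<in> borel_measurable borel" "mix_num n y w \<in> borel_measurable borel"
  "post_mean n y w \<in> borel_measurable borel"
  unfolding mix_dens_def[abs_def] mix_num_def[abs_def] post_mean_def[abs_def] by measurable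

text \<open>The mean square error of estimating \<open>Y\<close> by \<open>h (Y + N)\<close>,
  written atom by atom in the observation variable \<open>z\<close>.\<close>

definition estimator_cost :: "nat \<Rightarrow> (nat \<Rightarrow> real) \<Rightarrow> (nat \<Rightarrow> real) \<Rightarrow> (real \<Rightarrow> real) \<Rightarrow> real" where
  "estimator_cost n y w h = (\<Sum>i=1..n. w i * (\<integral>z. phi (z - y i) * (y i - h z)\<^sup>2 \<partial>lborel))"

lemma abs_sq_diff_le:
  fixes a b c :: real
  assumes "\<bar>a\<bar> \<le> b"
  shows "\<bar>(c - a)\<^sup>2\<bar> \<le> (\<bar>c\<bar> + b)\<^sup>2"
proof -
  have "\<bar>c - a\<bar> \<le> \<bar>\<bar>c\<bar> + b\<bar>" using assms by linarith
  then show ?thesis by (simp only: abs_le_square_iff abs_power2)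
qed

lemma estimator_cost_eq:
  assumes [measurable]: "h \<in> borel_measurable borel" and h: "\<And>z. \<bar>h z\<bar> \<le> B"
  shows "estimator_cost n y w h = (\<Sum>i=1..n. w i * (y i)\<^sup>2)
      - 2 * (\<integral>z. mix_num n y w z * h z \<partial>lborel) + (\<integral>z. mix_dens n y w z * (h z)\<^sup>2 \<partial>lborel)"
    and "integrable lborel (\<lambda>z. mix_num n y w z * h z)"
    and "integrable lborel (\<lambda>z. mix_dens n y w z * (h z)\<^sup>2)"
proof -
  have h2: "\<bar>(h z)\<^sup>2\<bar> \<le> B\<^sup>2" for z
    using abs_sq_diff_le[OF h, of 0 z] by simp
  have i1: "integrable lborel (\<lambda>z. phi (z - a) * h z)" for a
    by (rule integrable_phi_bounded[OF _ h]) simp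
  have i2: "integrable lborel (\<lambda>z. phi (z - a) * (h z)\<^sup>2)" for a
    by (rule integrable_phi_bounded[OF _ h2]) simp
  have e1: "mix_num n y w z * h z = (\<Sum>i=1..n. (w i * y i) * (phi (z - y i) * h z))" for z
    by (simp only: mix_num_def sum_distrib_right mult.assoc)
  have e2: "mix_dens n y w z * (h z)\<^sup>2 = (\<Sum>i=1..n. w i * (phi (z - y i) * (h z)\<^sup>2))" for z
    by (simp only: mix_dens_def sum_distrib_right mult.assoc)
  show "integrable lborel (\<lambda>z. mix_num n y w z * h z)"
    unfolding e1 using i1 by simp
  show "integrable lborel (\<lambda>z. mix_dens n y w z * (h z)\<^sup>2)"
    unfolding e2 using i2 by simp
  have e3: "(\<integral>z. phi (z - a) * (a - h z)\<^sup>2 \<partial>lborel)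
      = a\<^sup>2 - 2 * a * (\<integral>z. phi (z - a) * h z \<partial>lborel) + (\<integral>z. phi (z - a) * (h z)\<^sup>2 \<partial>lborel)" for a
  proof -
    have "(\<integral>z. phi (z - a) * (a - h z)\<^sup>2 \<partial>lborel)
        = (\<integral>z. a\<^sup>2 * phi (z - a) - 2 * a * (phi (z - a) * h z) + phi (z - a) * (h z)\<^sup>2 \<partial>lborel)"
      by (intro Bochner_Integration.integral_cong) (auto simp: power2_diff algebra_simps)
    also have "\<dots> = a\<^sup>2 * (\<integral>z. phi (z - a) \<partial>lborel) - 2 * a * (\<integral>z. phi (z - a) * h z \<partial>lborel) + (\<integral>z. phi (z - a) * (h z)\<^sup>2 \<partial>lborel)"
      using i1[of a] i2[of a] integrable_phi_shift[of a] 
      by (simp del: integral_phi_shift)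
    finally show ?thesis by simp
  qed
  show "estimator_cost n y w h = (\<Sum>i=1..n. w i * (y i)\<^sup>2)
      - 2 * (\<integral>z. mix_num n y w z * h z \<partial>lborel) + (\<integral>z. mix_dens n y w z * (h z)\<^sup>2 \<partial>lborel)"
  proof -
    have "(\<integral>z. mix_num n y w z * h z \<partial>lborel) = (\<Sum>i=1..n. (w i * y i) * (\<integral>z. phi (z - y i) * h z \<partial>lborel))"
      unfolding e1 using i1 by simp
    moreover have "(\<integral>z. mix_dens n y w z * (h z)\<^sup>2 \<partial>lborel) = (\<Sum>i=1..n. w i * (\<integral>z. phi (z - y i) * (h z)\<^sup>2 \<partial>lborel))"
      unfolding e2 using i2 by simp
    ultimately show ?thesis
      unfolding estimator_cost_def e3
      by (simp only: sum.distrib[symmetric] sum_subtractf[symmetric] sum_distrib_left) (simp add: algebra_simps)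
  qed
qed

lemma estimation_integrand_eq:
  assumes "w \<in> weight_simplex n"
  shows "(mix_num n y w z)\<^sup>2 / mix_dens n y w z = mix_num n y w z * post_mean n y w z"
    and "(mix_num n y w z)\<^sup>2 / mix_dens n y w z = mix_dens n y w z * (post_mean n y w z)\<^sup>2"
  using mix_dens_pos[OF assms, of y z]
  by (auto simp: post_mean_def power2_eq_square divide_simps)

lemma integrable_estimation:
  assumes "w \<in> weight_simplex n"
  shows "integrable lborel (\<lambda>z. (mix_num n y w z)\<^sup>2 / mix_dens n y w z)"
  unfolding estimation_integrand_eq(1)[OF assms]
  by (rule estimator_cost_eq(2)[OF _ abs_post_mean_le[OF assms]]) simp

text \<open>At the posterior mean the linear and the quadratic term of the expanded error involve
  the same integral of \<open>g^2 / p\<close>; the coefficients -2 and 1 leave one negative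
  copy.\<close>

lemma estimation_part_eq_estimator_cost:
  assumes "w \<in> weight_simplex n"
  shows "estimation_part n y w = estimator_cost n y w (post_mean n y w)"
proof -
  have "(\<integral>z. mix_num n y w z * post_mean n y w z \<partial>lborel) = (\<integral>z. mix_dens n y w z * (post_mean n y w z)\<^sup>2 \<partial>lborel)"
    using estimation_integrand_eq[OF assms] by (metis (no_types))
  then show ?thesis
    unfolding estimation_part_def estimation_integrand_eq(1)[OF assms]
    by (simp add: estimator_cost_eq(1)[OF measurable_mix(3) abs_post_mean_le[OF assms]])
qed

text \<open>Completing the square in \<open>h\<close>: the gap is the integral of
  \<open>(mix_num - mix_dens * h)^2 / mix_dens\<close>, which is nonnegative.\<close>

lemma estimation_part_le:
  assumes "w \<in> weight_simplex n" and [measurable]: "h \<in> borel_measurable borel" and h: "\<And>z. \<bar>h z\<bar> \<le> B"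
  shows "estimation_part n y w \<le> estimator_cost n y w h"
proof -
  note e = estimator_cost_eq[of h, OF _ h] 
  have "0 \<le> (\<integral>z. (mix_num n y w z)\<^sup>2 / mix_dens n y w z - 2 * (mix_num n y w z * h z) + mix_dens n y w z * (h z)\<^sup>2 \<partial>lborel)"
  proof (rule Bochner_Integration.integral_nonneg)
    fix z
    have "(mix_num n y w z)\<^sup>2 / mix_dens n y w z - 2 * (mix_num n y w z * h z) + mix_dens n y w z * (h z)\<^sup>2
       = (mix_num n y w z - mix_dens n y w z * h z)\<^sup>2 / mix_dens n y w z"
      using mix_dens_pos[OF assms(1), of y z] by (simp add: field_simps power2_eq_square)
    then show "0 \<le> (mix_num n y w z)\<^sup>2 / mix_dens n y w z - 2 * (mix_num n y w z * h z) + mix_dens n y w z * (h z)\<^sup>2"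
      using mix_dens_pos[OF assms(1), of y z] by simp
  qed
  also have "\<dots> = (\<integral>z. (mix_num n y w z)\<^sup>2 / mix_dens n y w z \<partial>lborel)
     - 2 * (\<integral>z. mix_num n y w z * h z \<partial>lborel) + (\<integral>z. mix_dens n y w z * (h z)\<^sup>2 \<partial>lborel)"
    using integrable_estimation[OF assms(1)] e(2,3) by simp
  finally show ?thesis
    unfolding estimation_part_def using e(1) by simp
qed

text \<open>The definition is a difference; here it becomes one integral of nonnegative summands,
  the form to which Fatou's lemma applies and in which summands may be dropped.\<close>

lemma estimation_part_integral:
  assumes "w \<in> weight_simplex n"
  shows "estimation_part n y w = (\<integral>z. (\<Sum>i=1..n. w i * (phi (z - y i) * (y i - post_mean n y w z)\<^sup>2)) \<partial>lborel)"
    and "integrable lborel (\<lambda>z. \<Sum>i=1..n. w i * (phi (z - y i) * (y i - post_mean n y w z)\<^sup>2))"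
proof -
  have i: "integrable lborel (\<lambda>z. phi (z - y i) * (y i - post_mean n y w z)\<^sup>2)" for i
    by (rule integrable_phi_bounded[OF _ abs_sq_diff_le[OF abs_post_mean_le[OF assms]]]) simp
  show "integrable lborel (\<lambda>z. \<Sum>i=1..n. w i * (phi (z - y i) * (y i - post_mean n y w z)\<^sup>2))"
    using i by simp
  show "estimation_part n y w = (\<integral>z. (\<Sum>i=1..n. w i * (phi (z - y i) * (y i - post_mean n y w z)\<^sup>2)) \<partial>lborel)"
    unfolding estimation_part_eq_estimator_cost[OF assms] estimator_cost_def using i by simp
qed

lemma estimation_part_nonneg:
  assumes "w \<in> weight_simplex n"
  shows "0 \<le> estimation_part n y w"
  unfolding estimation_part_integral(1)[OF assms] using assms
  by (intro Bochner_Integration.integral_nonneg sum_nonneg) (auto simp: weight_simplex_def)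

text \<open>A constant estimator ignores the observation and errs by the second moment about
  \<open>c\<close>. The bound shows that the estimation part vanishes when all mass concentrates on
  one level.\<close>

lemma estimation_part_le_var:
  assumes "w \<in> weight_simplex n"
  shows "estimation_part n y w \<le> (\<Sum>i=1..n. w i * (y i - c)\<^sup>2)"
  using estimation_part_le[OF assms, of "\<lambda>_. c" "\<bar>c\<bar>" y] by (simp add: estimator_cost_def)

text \<open>Fubini over state and noise, then for each atom the shift \<open>z = y i + t\<close>,
  which replaces the noise variable by the observation.\<close>

lemma integral_discrete_noise:
  fixes k :: "real \<times> real \<Rightarrow> real"
  assumes w: "w \<in> weight_simplex n" and k [measurable]: "k \<in> borel_measurable (borel \<Otimes>\<^sub>M borel)"
    and int: "\<And>i. i \<in> {1..n} \<Longrightarrow> integrable lborel (\<lambda>z. phi (z - y i) * k (y i, z))"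
  shows "integrable (discrete_law n y w \<Otimes>\<^sub>M std_normal_distribution) (\<lambda>\<omega>. k (fst \<omega>, fst \<omega> + snd \<omega>))"
    and "(\<integral>\<omega>. k (fst \<omega>, fst \<omega> + snd \<omega>) \<partial>(discrete_law n y w \<Otimes>\<^sub>M std_normal_distribution))
       = (\<Sum>i=1..n. w i * (\<integral>z. phi (z - y i) * k (y i, z) \<partial>lborel))"
proof -
  let ?Q = "discrete_law n y w" and ?N = "std_normal_distribution"
  interpret Q: prob_space ?Q by (rule prob_space_discrete_law[OF w])
  interpret N: prob_space ?N by (rule prob_space_normal_density) simp
  interpret QN: pair_prob_space ?Q ?N ..
  have nn: "0 \<le> w i" if "i \<in> {1..n}" for i using w that by (simp add: weight_simplex_def)
  have iN: "integrable ?N (\<lambda>t. k (y i, y i + t))" 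
    and eN: "(\<integral>t. k (y i, y i + t) \<partial>?N) = (\<integral>z. phi (z - y i) * k (y i, z) \<partial>lborel)"
    if "i \<in> {1..n}" for i
  proof -
    have "integrable lborel (\<lambda>t. (\<lambda>z. phi (z - y i) * k (y i, z)) (y i + 1 * t))"
      using int[OF that] by (rule lborel_integrable_real_affine) simp
    then show "integrable ?N (\<lambda>t. k (y i, y i + t))"
      by (subst integrable_density) auto
    have "(\<integral>z. phi (z - y i) * k (y i, z) \<partial>lborel) = \<bar>1\<bar> *\<^sub>R (\<integral>t. (\<lambda>z. phi (z - y i) * k (y i, z)) (y i + 1 * t) \<partial>lborel)"
      by (rule lborel_integral_real_affine) simp
    then show "(\<integral>t. k (y i, y i + t) \<partial>?N) = (\<integral>z. phi (z - y i) * k (y i, z) \<partial>lborel)"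
      by (subst integral_density) auto
  qed
  have meas [measurable]: "(\<lambda>\<omega>. k (fst \<omega>, fst \<omega> + snd \<omega>)) \<in> borel_measurable (?Q \<Otimes>\<^sub>M ?N)"
    by measurable
  show i: "integrable (?Q \<Otimes>\<^sub>M ?N) (\<lambda>\<omega>. k (fst \<omega>, fst \<omega> + snd \<omega>))"
  proof (rule integrableI_bounded[OF meas])
    have "(\<integral>\<^sup>+\<omega>. ennreal (norm (k (fst \<omega>, fst \<omega> + snd \<omega>))) \<partial>(?Q \<Otimes>\<^sub>M ?N))
        = (\<integral>\<^sup>+x. \<integral>\<^sup>+t. ennreal (norm (k (x, x + t))) \<partial>?N \<partial>?Q)"
      by (subst N.nn_integral_fst[symmetric]) auto
    also have "\<dots> = (\<Sum>i=1..n. ennreal (w i) * (\<integral>\<^sup>+t. ennreal (norm (k (y i, y i + t))) \<partial>?N))"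
      by (rule nn_integral_discrete_law) (measurable; simp)
    also have "\<dots> < \<infinity>"
      using iN by (auto simp: integrable_iff_bounded ennreal_mult_less_top)
    finally show "(\<integral>\<^sup>+\<omega>. ennreal (norm (k (fst \<omega>, fst \<omega> + snd \<omega>))) \<partial>(?Q \<Otimes>\<^sub>M ?N)) < \<infinity>" .
  qed
  have "(\<integral>\<omega>. k (fst \<omega>, fst \<omega> + snd \<omega>) \<partial>(?Q \<Otimes>\<^sub>M ?N)) = (\<integral>x. (\<integral>t. k (x, x + t) \<partial>?N) \<partial>?Q)"
    using QN.integral_fst'[OF i] by simp
  also have "\<dots> = (\<Sum>i=1..n. w i * (\<integral>t. k (y i, y i + t) \<partial>?N))"
    by (rule integral_discrete_law(1)[OF _ nn]) (measurable; simp)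
  finally show "(\<integral>\<omega>. k (fst \<omega>, fst \<omega> + snd \<omega>) \<partial>(?Q \<Otimes>\<^sub>M ?N))
       = (\<Sum>i=1..n. w i * (\<integral>z. phi (z - y i) * k (y i, z) \<partial>lborel))"
    using eN by simp
qed

text \<open>The ratio of the mixtures, evaluated at the observation, is the conditional expectation
  of the state. The outer conditional expectation in \<open>cond_var\<close> disappears on
  integration, leaving the mean square error of that estimator.\<close>

lemma mmse_discrete_law:
  assumes w: "w \<in> weight_simplex n"
  shows "mmse (discrete_law n y w) = estimation_part n y w"
proof -
  let ?Q = "discrete_law n y w" and ?N = "std_normal_distribution"
  define M where "M = ?Q \<Otimes>\<^sub>M ?N"
  define F where "F = vimage_algebra (space M) (\<lambda>\<omega>. fst \<omega> + snd \<omega> :: real) borel"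
  let ?h = "post_mean n y w"
  interpret Q: prob_space ?Q by (rule prob_space_discrete_law[OF w])
  interpret N: prob_space ?N by (rule prob_space_normal_density) simp
  interpret QN: pair_prob_space ?Q ?N ..
  interpret M: prob_space M unfolding M_def by (rule QN.prob_space_axioms)
  have spM: "space M = UNIV" by (simp add: M_def space_pair_measure)
  have Z [measurable]: "(\<lambda>\<omega>. fst \<omega> + snd \<omega>) \<in> borel_measurable M"
    and Y [measurable]: "fst \<in> borel_measurable M"
    unfolding M_def by measurable
  have sub: "subalgebra M F"
    unfolding subalgebra_def F_def using sets_vimage_algebra2[of "\<lambda>\<omega>. fst \<omega> + snd \<omega>" "space M" borel] Z
    by (auto simp: measurable_sets)
  interpret F: finite_measure_subalgebra M F
    by unfold_locales (rule sub)
  have hF: "(\<lambda>\<omega>. ?h (fst \<omega> + snd \<omega>)) \<in> borel_measurable F"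
    by (rule measurable_compose[OF _ measurable_mix(3)])
       (simp add: F_def spM measurable_vimage_algebra1)
  note key = integral_discrete_noise[OF w, of _ y, folded M_def]
  let ?B = "(\<Sum>i=1..n. \<bar>y i\<bar>)"
  have hb: "\<bar>?h z\<bar> \<le> ?B" for z by (rule abs_post_mean_le[OF w])
  have iY: "integrable M fst"
    using key(1)[of "\<lambda>p. fst p"] by simp
  have ih: "integrable M (\<lambda>\<omega>. ?h (fst \<omega> + snd \<omega>))"
    using key(1)[of "\<lambda>p. ?h (snd p)"] integrable_phi_bounded[OF measurable_mix(3) hb] by simp
  \<comment> \<open>Every event of the generated sigma-algebra has the form \<open>Z \<in> B\<close>
    with \<open>Z\<close> the observation; on it the averaging property reduces, pointwise in
    \<open>z\<close>, to \<open>mix_num = mix_dens * post_mean\<close>.\<close>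
  have ce: "AE \<omega> in M. real_cond_exp M F fst \<omega> = ?h (fst \<omega> + snd \<omega>)"
  proof (rule F.real_cond_exp_charact[OF _ iY ih hF])
    fix A assume "A \<in> sets F"
    then obtain B where [measurable]: "B \<in> sets borel" and A: "A = (\<lambda>\<omega>. fst \<omega> + snd \<omega>) -` B"
      unfolding F_def by (subst (asm) sets_vimage_algebra2) (auto simp: spM)
    have ind: "indicator A \<omega> = (indicator B (fst \<omega> + snd \<omega>) :: real)" for \<omega>
      by (simp add: A indicator_def)
    have i1: "integrable lborel (\<lambda>z. phi (z - a) * (indicator B z * c))" for a c
      by (rule integrable_phi_bounded[of _ "\<bar>c\<bar>"]) (auto simp: indicator_def)
    have i2: "integrable lborel (\<lambda>z. phi (z - a) * (indicator B z * ?h z))" for a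
      by (rule integrable_phi_bounded[of _ ?B]) (use hb order_trans[OF abs_ge_zero hb] in \<open>auto simp: indicator_def\<close>)
    have "(\<integral>\<omega>\<in>A. fst \<omega> \<partial>M) = (\<Sum>i=1..n. w i * (\<integral>z. phi (z - y i) * (indicator B z * y i) \<partial>lborel))"
      using key(2)[of "\<lambda>p. indicator B (snd p) * fst p"] i1
      by (simp add: set_lebesgue_integral_def ind)
    also have "\<dots> = (\<integral>z. (\<Sum>i=1..n. w i * (phi (z - y i) * (indicator B z * y i))) \<partial>lborel)"
      using i1 by simp
    also have "\<dots> = (\<integral>z. (\<Sum>i=1..n. w i * (phi (z - y i) * (indicator B z * ?h z))) \<partial>lborel)"
    proof (rule Bochner_Integration.integral_cong)
      fix z
      have "(\<Sum>i=1..n. w i * (phi (z - y i) * (indicator B z * y i))) = indicator B z * mix_num n y w z"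
        by (simp add: mix_num_def sum_distrib_left mult_ac)
      also have "\<dots> = indicator B z * (mix_dens n y w z * ?h z)"
        using mix_dens_pos[OF w, of y z] by (simp add: post_mean_def)
      also have "\<dots> = (\<Sum>i=1..n. w i * (phi (z - y i) * (indicator B z * ?h z)))"
        by (simp add: mix_dens_def sum_distrib_left sum_distrib_right mult_ac)
      finally show "(\<Sum>i=1..n. w i * (phi (z - y i) * (indicator B z * y i))) = (\<Sum>i=1..n. w i * (phi (z - y i) * (indicator B z * ?h z)))" .
    qed simp
    also have "\<dots> = (\<Sum>i=1..n. w i * (\<integral>z. phi (z - y i) * (indicator B z * ?h z) \<partial>lborel))"
      using i2 by simp
    also have "\<dots> = (\<integral>\<omega>\<in>A. ?h (fst \<omega> + snd \<omega>) \<partial>M)"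
      using key(2)[of "\<lambda>p. indicator B (snd p) * ?h (snd p)"] i2
      by (simp add: set_lebesgue_integral_def ind)
    finally show "(\<integral>\<omega>\<in>A. fst \<omega> \<partial>M) = (\<integral>\<omega>\<in>A. ?h (fst \<omega> + snd \<omega>) \<partial>M)" .
  qed
  have i3: "integrable lborel (\<lambda>z. phi (z - a) * (a - ?h z)\<^sup>2)" for a
    by (rule integrable_phi_bounded[OF _ abs_sq_diff_le[OF hb]]) simp
  have iV: "integrable M (\<lambda>\<omega>. (fst \<omega> - ?h (fst \<omega> + snd \<omega>))\<^sup>2)"
    using key(1)[of "\<lambda>p. (fst p - ?h (snd p))\<^sup>2"] i3 by simp
  have eq: "AE \<omega> in M. (fst \<omega> - real_cond_exp M F fst \<omega>)\<^sup>2 = (fst \<omega> - ?h (fst \<omega> + snd \<omega>))\<^sup>2"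
    using ce by eventually_elim simp
  have m: "(\<lambda>\<omega>. (fst \<omega> - real_cond_exp M F fst \<omega>)\<^sup>2) \<in> borel_measurable M"
    using iY by (auto intro!: borel_measurable_power borel_measurable_diff)
  have "integrable M (\<lambda>\<omega>. (fst \<omega> - real_cond_exp M F fst \<omega>)\<^sup>2)"
    using integrable_cong_AE[OF m _ eq] iV by auto
  from F.real_cond_exp_int(2)[OF this]
  have "(\<integral>\<omega>. cond_var M F fst \<omega> \<partial>M) = (\<integral>\<omega>. (fst \<omega> - real_cond_exp M F fst \<omega>)\<^sup>2 \<partial>M)"
    unfolding cond_var_def .
  also have "\<dots> = (\<integral>\<omega>. (fst \<omega> - ?h (fst \<omega> + snd \<omega>))\<^sup>2 \<partial>M)"
    using m iV eq by (intro integral_cong_AE) auto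
  also have "\<dots> = estimator_cost n y w ?h"
    unfolding estimator_cost_def using key(2)[of "\<lambda>p. (fst p - ?h (snd p))\<^sup>2"] i3 by simp
  also have "\<dots> = estimation_part n y w"
    by (rule estimation_part_eq_estimator_cost[OF w, symmetric])
  finally show ?thesis
    unfolding mmse_def Let_def M_def F_def by simp
qed

subsection \<open>Gaussian-mixture integrals and their derivatives\<close>

text \<open>Differentiation under the integral along arbitrary sequences: the mean value inequality
  transfers the bound \<open>B\<close> from the derivative to the difference quotients, and
  dominated convergence applies.\<close>

lemma has_real_derivative_integral:
  fixes F F' :: "real \<Rightarrow> real \<Rightarrow> real"
  assumes d: "0 < d"
    and der: "\<And>t z. \<bar>t - t0\<bar> < d \<Longrightarrow> ((\<lambda>t. F t z) has_real_derivative F' t z) (at t)"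
    and le: "\<And>t z. \<bar>t - t0\<bar> < d \<Longrightarrow> \<bar>F' t z\<bar> \<le> B z"
    and B: "integrable M B"
    and F: "\<And>t. \<bar>t - t0\<bar> < d \<Longrightarrow> integrable M (F t)"
    and F': "F' t0 \<in> borel_measurable M"
  shows "((\<lambda>t. \<integral>z. F t z \<partial>M) has_real_derivative (\<integral>z. F' t0 z \<partial>M)) (at t0)"
proof -
  let ?S = "{t0 - d<..<t0 + d}"
  have S: "t \<in> ?S \<longleftrightarrow> \<bar>t - t0\<bar> < d" for t by auto
  have t0: "t0 \<in> ?S" using d by simp
  have at: "at t0 = at t0 within ?S" using t0 by (intro at_within_open[symmetric]) auto
  have "((\<lambda>t. ((\<integral>z. F t z \<partial>M) - (\<integral>z. F t0 z \<partial>M)) / (t - t0)) \<longlongrightarrow> (\<integral>z. F' t0 z \<partial>M)) (at t0 within ?S)"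
    unfolding tendsto_at_iff_sequentially
  proof (intro allI impI)
    fix X assume X: "\<forall>i. X i \<in> ?S - {t0}" and lim: "X \<longlonglongrightarrow> t0"
    have iX: "integrable M (F (X i))" for i using X F S by blast
    have i0: "integrable M (F t0)" using F d by simp
    have "(\<lambda>i. \<integral>z. (F (X i) z - F t0 z) / (X i - t0) \<partial>M) \<longlonglongrightarrow> (\<integral>z. F' t0 z \<partial>M)"
    proof (rule integral_dominated_convergence[OF F' _ B])
      show "(\<lambda>z. (F (X i) z - F t0 z) / (X i - t0)) \<in> borel_measurable M" for i
        using iX[of i] i0 by auto
      show "AE z in M. (\<lambda>i. (F (X i) z - F t0 z) / (X i - t0)) \<longlonglongrightarrow> F' t0 z"
      proof (rule AE_I2)
        fix z
        have "((\<lambda>t. (F t z - F t0 z) / (t - t0)) \<longlongrightarrow> F' t0 z) (at t0)"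
          using der[of t0 z] d by (simp add: has_field_derivative_iff)
        then show "(\<lambda>i. (F (X i) z - F t0 z) / (X i - t0)) \<longlonglongrightarrow> F' t0 z"
          using X lim unfolding tendsto_at_iff_sequentially comp_def by blast
      qed
      show "AE z in M. norm ((F (X i) z - F t0 z) / (X i - t0)) \<le> B z" for i
      proof (rule AE_I2)
        fix z
        have "norm (F (X i) z - F t0 z) \<le> B z * norm (X i - t0)"
        proof (rule field_differentiable_bound[of ?S "\<lambda>t. F t z" "\<lambda>t. F' t z"])
          show "((\<lambda>t. F t z) has_real_derivative F' t z) (at t within ?S)" if "t \<in> ?S" for t
            using der that S has_field_derivative_at_within by blast
        qed (use le S X t0 in auto)
        moreover have "X i \<noteq> t0" using X by auto
        ultimately show "norm ((F (X i) z - F t0 z) / (X i - t0)) \<le> B z"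
          by (simp add: norm_divide divide_le_eq)
      qed
    qed
    then show "((\<lambda>t. ((\<integral>z. F t z \<partial>M) - (\<integral>z. F t0 z \<partial>M)) / (t - t0)) \<circ> X) \<longlonglongrightarrow> (\<integral>z. F' t0 z \<partial>M)"
      using iX i0 by (simp add: comp_def)
  qed
  then show ?thesis by (simp add: has_field_derivative_iff flip: at)
qed

text \<open>A multiple of the centred Gaussian density of variance 2. It dominates all unit
  Gaussians with centre \<open>y\<close> in \<open>[- R, R]\<close>, since
  \<open>(z - y)^2 / 2 \<ge> z^2 / 4 - y^2 / 2\<close>; the factor \<open>sqrt 2\<close> adjusts the
  normalisation.\<close>

definition gauss_envelope :: "real \<Rightarrow> real \<Rightarrow> real" where
  "gauss_envelope R z = exp (R\<^sup>2 / 2) * sqrt 2 * normal_density 0 (sqrt 2) z"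

lemma gauss_envelope_nonneg [simp]: "0 \<le> gauss_envelope R z"
  by (simp add: gauss_envelope_def)

lemma phi_le_envelope:
  assumes "\<bar>y\<bar> \<le> R"
  shows "phi (z - y) \<le> gauss_envelope R z"
proof -
  have "(z - y)\<^sup>2 / 2 - z\<^sup>2 / 4 + y\<^sup>2 / 2 = (z - 2 * y)\<^sup>2 / 4"
    by (simp add: power2_eq_square field_simps)
  moreover have "0 \<le> (z - 2 * y)\<^sup>2 / 4" by simp
  ultimately have "0 \<le> (z - y)\<^sup>2 / 2 - z\<^sup>2 / 4 + y\<^sup>2 / 2" by (simp only:)
  moreover have "y\<^sup>2 \<le> R\<^sup>2" using assms power_mono[OF assms abs_ge_zero, of 2] by simp
  ultimately have "- (z - y)\<^sup>2 / 2 \<le> R\<^sup>2 / 2 + - z\<^sup>2 / 4" by linarith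
  then have "exp (- (z - y)\<^sup>2 / 2) \<le> exp (R\<^sup>2 / 2 + - z\<^sup>2 / 4)" by (simp only: exp_le_cancel_iff)
  also have "\<dots> = exp (R\<^sup>2 / 2) * exp (- z\<^sup>2 / 4)" by (rule exp_add)
  finally have "exp (- (z - y)\<^sup>2 / 2) / sqrt (2 * pi) \<le> exp (R\<^sup>2 / 2) * exp (- z\<^sup>2 / 4) / sqrt (2 * pi)"
    by (rule divide_right_mono) simp
  also have "exp (R\<^sup>2 / 2) * exp (- z\<^sup>2 / 4) / sqrt (2 * pi) = gauss_envelope R z"
  proof -
    have "sqrt (2 * pi * (sqrt 2)\<^sup>2) = sqrt 2 * sqrt (2 * pi)"
      by (simp add: real_sqrt_mult)
    then show ?thesis by (simp add: gauss_envelope_def normal_density_def)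
  qed
  finally show ?thesis by (simp add: std_normal_density_def)
qed

lemma integrable_power_envelope: "integrable lborel (\<lambda>z. \<bar>z\<bar> ^ m * gauss_envelope R z)"
proof -
  have "integrable lborel (\<lambda>z. exp (R\<^sup>2 / 2) * sqrt 2 * (normal_density 0 (sqrt 2) z * \<bar>z - 0\<bar> ^ m))"
    by (intro integrable_mult_right integrable_normal_moment_abs) simp
  then show ?thesis by (simp add: gauss_envelope_def mult_ac)
qed

text \<open>The mixture density enters only through the ratios \<open>phi (z - y i) / mix_dens n y w z\<close>, which are
  bounded by \<open>1 / w i\<close>; hence Gaussian domination is uniform as long as the weights stay away from 0.\<close>

definition mix_kernel ::
  "nat \<Rightarrow> (nat \<Rightarrow> real) \<Rightarrow> (nat \<Rightarrow> real) \<Rightarrow> nat \<Rightarrow> nat \<Rightarrow> (nat \<Rightarrow> nat) \<Rightarrow> real \<Rightarrow> real" where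
  "mix_kernel n y w m l e z = z ^ m * phi (z - y l) * (\<Prod>i=1..n. (phi (z - y i) / mix_dens n y w z) ^ e i)"

lemma measurable_mix_kernel [measurable]: "mix_kernel n y w m l e \<in> borel_measurable borel"
  unfolding mix_kernel_def[abs_def] by measurable

lemma mix_kernel_Suc: "z * mix_kernel n y w m l e z = mix_kernel n y w (Suc m) l e z"
  by (simp add: mix_kernel_def)

lemma mix_kernel_upd:
  assumes "i \<in> {1..n}"
  shows "mix_kernel n y w m l e z * (phi (z - y i) / mix_dens n y w z)
     = mix_kernel n y w m l (e(i := Suc (e i))) z"
proof -
  let ?q = "\<lambda>i. phi (z - y i) / mix_dens n y w z"
  have "(\<Prod>j=1..n. ?q j ^ (e(i := Suc (e i))) j) = ?q i ^ Suc (e i) * (\<Prod>j\<in>{1..n}-{i}. ?q j ^ e j)"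
    using assms by (subst prod.remove[of _ i]) auto
  moreover have "(\<Prod>j=1..n. ?q j ^ e j) = ?q i ^ e i * (\<Prod>j\<in>{1..n}-{i}. ?q j ^ e j)"
    using assms by (subst prod.remove[of _ i]) auto
  ultimately show ?thesis unfolding mix_kernel_def by (simp only: power_Suc mult_ac)
qed

lemma abs_mix_kernel_le:
  assumes w: "w \<in> weight_simplex n" and l: "l \<in> {1..n}"
    and R: "\<And>i. i \<in> {1..n} \<Longrightarrow> \<bar>y i\<bar> \<le> R"
    and C: "\<And>i. i \<in> {1..n} \<Longrightarrow> 0 < w i \<and> 1 / w i \<le> C"
  shows "\<bar>mix_kernel n y w m l e z\<bar> \<le> C ^ (\<Sum>i=1..n. e i) * (\<bar>z\<bar> ^ m * gauss_envelope R z)"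
    and "i \<in> {1..n} \<Longrightarrow> \<bar>phi (z - y i) / mix_dens n y w z\<bar> \<le> C"
proof -
  have p: "0 < mix_dens n y w z" by (rule mix_dens_pos[OF w])
  show q: "\<bar>phi (z - y i) / mix_dens n y w z\<bar> \<le> C" if i: "i \<in> {1..n}" for i
  proof -
    have "w i * phi (z - y i) \<le> mix_dens n y w z"
      unfolding mix_dens_def using i w by (intro member_le_sum) (auto simp: weight_simplex_def)
    then have "phi (z - y i) / mix_dens n y w z \<le> 1 / w i"
      using C[OF i] p by (simp add: field_simps)
    then show ?thesis using C[OF i] p by simp
  qed
  have "\<bar>\<Prod>i=1..n. (phi (z - y i) / mix_dens n y w z) ^ e i\<bar> \<le> (\<Prod>i=1..n. C ^ e i)"
    unfolding abs_prod power_abs using q by (intro prod_mono conjI power_mono) auto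
  also have "\<dots> = C ^ (\<Sum>i=1..n. e i)" by (simp add: power_sum)
  finally have "\<bar>\<Prod>i=1..n. (phi (z - y i) / mix_dens n y w z) ^ e i\<bar> \<le> C ^ (\<Sum>i=1..n. e i)" .
  moreover have "\<bar>z ^ m * phi (z - y l)\<bar> \<le> \<bar>z\<bar> ^ m * gauss_envelope R z"
    using phi_le_envelope[OF R[OF l], of z] by (simp add: abs_mult power_abs mult_left_mono)
  ultimately have "\<bar>z ^ m * phi (z - y l)\<bar> * \<bar>\<Prod>i=1..n. (phi (z - y i) / mix_dens n y w z) ^ e i\<bar>
      \<le> (\<bar>z\<bar> ^ m * gauss_envelope R z) * C ^ (\<Sum>i=1..n. e i)"
    by (intro mult_mono) auto
  then show "\<bar>mix_kernel n y w m l e z\<bar> \<le> C ^ (\<Sum>i=1..n. e i) * (\<bar>z\<bar> ^ m * gauss_envelope R z)"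
    unfolding mix_kernel_def abs_mult[of "z ^ m * phi (z - y l)"] by (simp only: mult_ac)
qed

lemma integrable_mix_kernel:
  assumes w: "w \<in> weight_simplex n" and l: "l \<in> {1..n}" and pos: "\<And>i. i \<in> {1..n} \<Longrightarrow> 0 < w i"
  shows "integrable lborel (mix_kernel n y w m l e)"
proof -
  define R where "R = (\<Sum>i=1..n. \<bar>y i\<bar>)"
  define C where "C = (\<Sum>i=1..n. 1 / w i)"
  have R: "\<bar>y i\<bar> \<le> R" if "i \<in> {1..n}" for i
    unfolding R_def using that by (intro member_le_sum) auto
  have C: "0 < w i \<and> 1 / w i \<le> C" if "i \<in> {1..n}" for i
    unfolding C_def using that pos by (intro conjI member_le_sum) (auto simp: order_less_imp_le)
  show ?thesis
  proof (rule Bochner_Integration.integrable_bound)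
    show "integrable lborel (\<lambda>z. C ^ (\<Sum>i=1..n. e i) * (\<bar>z\<bar> ^ m * gauss_envelope R z))"
      by (intro integrable_mult_right integrable_power_envelope)
    have "0 \<le> C" unfolding C_def using pos by (intro sum_nonneg) (auto simp: order_less_imp_le)
    then show "AE z in lborel. norm (mix_kernel n y w m l e z) \<le> norm (C ^ (\<Sum>i=1..n. e i) * (\<bar>z\<bar> ^ m * gauss_envelope R z))"
      using abs_mix_kernel_le(1)[OF w l R C] by (intro AE_I2) (auto simp: abs_mult)
  qed simp
qed

text \<open>Derivatives are kept in the logarithmic form \<open>f * a\<close>, so that products and
  powers merely add up the factors \<open>a\<close>, with no quotient and no product over the
  remaining indices.\<close>

lemma DERIV_prod_log:
  fixes f :: "'a \<Rightarrow> real \<Rightarrow> real"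
  assumes "finite I" "\<And>i. i \<in> I \<Longrightarrow> (f i has_real_derivative f i x * a i) (at x)"
  shows "((\<lambda>x. \<Prod>i\<in>I. f i x) has_real_derivative (\<Prod>i\<in>I. f i x) * (\<Sum>i\<in>I. a i)) (at x)"
  using assms
proof (induction I rule: finite_induct)
  case (insert j I)
  have "((\<lambda>x. f j x * (\<Prod>i\<in>I. f i x)) has_real_derivative
      (f j x * a j) * (\<Prod>i\<in>I. f i x) + ((\<Prod>i\<in>I. f i x) * (\<Sum>i\<in>I. a i)) * f j x) (at x)"
    by (rule DERIV_mult) (use insert in auto)
  then show ?case using insert.hyps by (simp add: algebra_simps)
qed simp

lemma DERIV_power_log:
  fixes f :: "real \<Rightarrow> real"
  assumes "(f has_real_derivative f x * a) (at x)"
  shows "((\<lambda>x. f x ^ k) has_real_derivative f x ^ k * (real k * a)) (at x)"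
proof (cases k)
  case (Suc j)
  show ?thesis
    by (rule DERIV_cong[OF DERIV_power[OF assms, of k]]) (simp add: Suc algebra_simps)
qed simp

lemma DERIV_phi_log:
  assumes "(f has_real_derivative f') (at x)"
  shows "((\<lambda>x. phi (z - f x)) has_real_derivative phi (z - f x) * (f' * (z - f x))) (at x)"
proof -
  have "((\<lambda>x. z - f x) has_real_derivative - f') (at x)"
    by (rule DERIV_cong[OF DERIV_diff[OF DERIV_const assms]]) simp
  from DERIV_chain2[OF has_real_derivative_normal_density[of 1 0, OF zero_less_one] this]
  have "((\<lambda>x. phi (z - f x)) has_real_derivative - (z - f x - 0) / 1\<^sup>2 * phi (z - f x) * - f') (at x)" .
  moreover have "- (a - 0) / 1\<^sup>2 * b * - c = b * (c * a)" for a b c :: real by simp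
  ultimately show ?thesis by (simp only:)
qed

text \<open>Here \<open>y'\<close> and \<open>w'\<close> are the derivatives of levels and weights
  along a curve. The derivative is spelled out as a combination of kernels with at most one more
  power of \<open>z\<close> and one more ratio; this keeps the class of kernel integrals closed
  under differentiation.\<close>

definition mix_kernel_deriv where
  "mix_kernel_deriv n y y' w w' m l e z =
     y' l * (mix_kernel n y w (Suc m) l e z - y l * mix_kernel n y w m l e z)
     + (\<Sum>i=1..n. real (e i) * y' i * (mix_kernel n y w (Suc m) l e z - y i * mix_kernel n y w m l e z))
     - real (\<Sum>i=1..n. e i) * (\<Sum>i=1..n. w' i * mix_kernel n y w m l (e(i := Suc (e i))) z
         + w i * y' i * (mix_kernel n y w (Suc m) l (e(i := Suc (e i))) z
             - y i * mix_kernel n y w m l (e(i := Suc (e i))) z))"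

text \<open>The factorised form, kernel times logarithmic derivative, is the one in which the
  derivative is computed and estimated.\<close>

lemma mix_kernel_deriv_eq:
  "mix_kernel_deriv n y y' w w' m l e z = mix_kernel n y w m l e z *
     (y' l * (z - y l) + (\<Sum>i=1..n. real (e i) * (y' i * (z - y i)))
       - real (\<Sum>i=1..n. e i) * (\<Sum>i=1..n. (w' i + w i * (y' i * (z - y i))) * (phi (z - y i) / mix_dens n y w z)))"
proof -
  let ?k = "mix_kernel n y w m l e z" and ?q = "\<lambda>i. phi (z - y i) / mix_dens n y w z"
  have 1: "(\<Sum>i=1..n. real (e i) * y' i * (mix_kernel n y w (Suc m) l e z - y i * ?k))
      = ?k * (\<Sum>i=1..n. real (e i) * (y' i * (z - y i)))"
    unfolding sum_distrib_left mix_kernel_Suc[symmetric] by (intro sum.cong) (auto simp: algebra_simps)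
  have 2: "(\<Sum>i=1..n. w' i * mix_kernel n y w m l (e(i := Suc (e i))) z
         + w i * y' i * (mix_kernel n y w (Suc m) l (e(i := Suc (e i))) z
             - y i * mix_kernel n y w m l (e(i := Suc (e i))) z))
      = ?k * (\<Sum>i=1..n. (w' i + w i * (y' i * (z - y i))) * ?q i)"
    unfolding sum_distrib_left
  proof (rule sum.cong)
    fix i assume i: "i \<in> {1..n}"
    have "mix_kernel n y w m l (e(i := Suc (e i))) z = ?k * ?q i"
      by (rule mix_kernel_upd[OF i, symmetric])
    then show "w' i * mix_kernel n y w m l (e(i := Suc (e i))) z
         + w i * y' i * (mix_kernel n y w (Suc m) l (e(i := Suc (e i))) z
             - y i * mix_kernel n y w m l (e(i := Suc (e i))) z)
      = ?k * ((w' i + w i * (y' i * (z - y i))) * ?q i)"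
      by (simp only: mix_kernel_Suc[symmetric] algebra_simps)
  qed simp
  show ?thesis
    unfolding mix_kernel_deriv_def 1 2 by (simp only: mix_kernel_Suc[symmetric] algebra_simps)
qed

lemma DERIV_mix_kernel:
  assumes w: "w t0 \<in> weight_simplex n" and l: "l \<in> {1..n}"
    and y: "\<And>i. i \<in> {1..n} \<Longrightarrow> ((\<lambda>t. y t i) has_real_derivative y' i) (at t0)"
    and w': "\<And>i. i \<in> {1..n} \<Longrightarrow> ((\<lambda>t. w t i) has_real_derivative w' i) (at t0)"
  shows "((\<lambda>t. mix_kernel n (y t) (w t) m l e z) has_real_derivative
      mix_kernel_deriv n (y t0) y' (w t0) w' m l e z) (at t0)"
proof -
  let ?p = "\<lambda>t. mix_dens n (y t) (w t) z"
  have p: "?p t0 \<noteq> 0" using mix_dens_pos[OF w, of "y t0" z] by simp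
  let ?a = "\<lambda>i. y' i * (z - y t0 i)"
  let ?P = "\<Sum>i=1..n. (w' i + w t0 i * ?a i) * phi (z - y t0 i)"
  have dphi: "((\<lambda>t. phi (z - y t i)) has_real_derivative phi (z - y t0 i) * ?a i) (at t0)" if "i \<in> {1..n}" for i
    by (rule DERIV_phi_log[OF y[OF that]])
  have "(?p has_real_derivative (\<Sum>i=1..n. w' i * phi (z - y t0 i) + phi (z - y t0 i) * ?a i * w t0 i)) (at t0)"
    unfolding mix_dens_def by (intro DERIV_sum DERIV_mult w' dphi)
  also have "(\<Sum>i=1..n. w' i * phi (z - y t0 i) + phi (z - y t0 i) * ?a i * w t0 i) = ?P"
    by (intro sum.cong) (auto simp: algebra_simps)
  finally have dp: "(?p has_real_derivative ?P) (at t0)" .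
  have dq: "((\<lambda>t. phi (z - y t i) / ?p t) has_real_derivative
      (phi (z - y t0 i) / ?p t0) * (?a i - ?P / ?p t0)) (at t0)" if "i \<in> {1..n}" for i
    by (rule DERIV_cong[OF DERIV_divide[OF dphi[OF that] dp p]]) (use p in \<open>simp add: field_simps\<close>)
  have dprod: "((\<lambda>t. \<Prod>i=1..n. (phi (z - y t i) / ?p t) ^ e i) has_real_derivative
      (\<Prod>i=1..n. (phi (z - y t0 i) / ?p t0) ^ e i) * (\<Sum>i=1..n. real (e i) * (?a i - ?P / ?p t0))) (at t0)"
    by (intro DERIV_prod_log DERIV_power_log dq) auto
  have "((\<lambda>t. phi (z - y t l) * (\<Prod>i=1..n. (phi (z - y t i) / ?p t) ^ e i)) has_real_derivative
      (phi (z - y t0 l) * ?a l) * (\<Prod>i=1..n. (phi (z - y t0 i) / ?p t0) ^ e i)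
      + ((\<Prod>i=1..n. (phi (z - y t0 i) / ?p t0) ^ e i) * (\<Sum>i=1..n. real (e i) * (?a i - ?P / ?p t0))) * phi (z - y t0 l)) (at t0)"
    by (intro DERIV_mult dphi l dprod)
  from DERIV_cmult[OF this, of "z ^ m"]
  have "((\<lambda>t. mix_kernel n (y t) (w t) m l e z) has_real_derivative
      mix_kernel n (y t0) (w t0) m l e z * (?a l + (\<Sum>i=1..n. real (e i) * (?a i - ?P / ?p t0)))) (at t0)"
    unfolding mix_kernel_def by (simp only: mult.assoc) (rule DERIV_cong, assumption, simp add: algebra_simps)
  \<comment> \<open>The logarithmic derivative of the mixture density enters once for every ratio,
    hence with the total exponent, and is itself a combination of the same ratios.\<close>
  moreover have "(\<Sum>i=1..n. real (e i) * (?a i - ?P / ?p t0))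
     = (\<Sum>i=1..n. real (e i) * ?a i) - real (\<Sum>i=1..n. e i) * (\<Sum>i=1..n. (w' i + w t0 i * ?a i) * (phi (z - y t0 i) / ?p t0))"
    by (simp add: right_diff_distrib sum_subtractf sum_distrib_right[symmetric] sum_divide_distrib)
  ultimately show ?thesis
    unfolding mix_kernel_deriv_eq by (simp only: add_diff_eq)
qed

subsection \<open>Smoothness\<close>

text \<open>Unlike \<^const>\<open>prog_domain\<close>, this open set leaves the levels unrestricted, so that derivatives are
  also available where two levels coincide.\<close>

definition threshold_domain :: "nat \<Rightarrow> (nat \<Rightarrow> real) set" where
  "threshold_domain n = {v. strict_mono_on {1..<n} (\<lambda>i. v (n + i))}"

lemma prog_domain_subset: "prog_domain n \<subseteq> threshold_domain n"
  by (auto simp: prog_domain_def threshold_domain_def)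

lemma continuous_on_fun_upd: "continuous_on S (\<lambda>t::real. v(j := t))"
proof (rule continuous_on_coordinatewise_then_product)
  show "continuous_on S (\<lambda>t. (v(j := t)) i)" for i
    by (cases "i = j") (auto intro: continuous_intros)
qed

lemma open_threshold_domain: "open (threshold_domain n)"
proof -
  have "threshold_domain n = (\<Inter>i\<in>{1..<n}. \<Inter>j\<in>{i<..<n}. {v. v (n + i) < v (n + j)})"
    by (auto simp: threshold_domain_def strict_mono_on_def)
  moreover have "open {v. v (n + i) < (v (n + j) :: real)}" for i j :: nat
    by (intro open_Collect_less continuous_on_product_coordinates)
  ultimately show ?thesis by (auto intro!: open_INT)
qed

lemma eventually_threshold_domain:
  assumes "v \<in> threshold_domain n"
  shows "\<forall>\<^sub>F t in nhds (v j). v(j := t) \<in> threshold_domain n"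
proof -
  have "open ((\<lambda>t. v(j := t)) -` threshold_domain n)"
    by (intro open_vimage open_threshold_domain continuous_on_fun_upd)
  then show ?thesis using assms by (simp add: eventually_nhds) (metis fun_upd_triv vimageI2 vimageD)
qed

lemma thr_strict_mono:
  assumes "v \<in> threshold_domain n" "i < j" "j \<le> n"
  shows "thr n v i < thr n v j"
proof -
  have "v (n + i) < v (n + j)" if "0 < i" "j < n"
    using assms that by (auto simp: threshold_domain_def dest: strict_mono_onD[of _ _ i j])
  then show ?thesis using assms by (auto simp: thr_def)
qed

lemma thr_ok:
  assumes "1 \<le> n" "v \<in> threshold_domain n"
  shows "thresholds_ok n (thr n v)"
proof -
  have "thr n v i \<le> thr n v j" if "i \<le> j" "j \<le> n" for i j
    using thr_strict_mono[OF assms(2), of i j] that by (cases "i = j") (auto simp: order_le_less)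
  then show ?thesis using assms(1) by (auto simp: thresholds_ok_def thr_def)
qed

lemma weights_of_thr_pos:
  assumes "\<sigma> > 0" "v \<in> threshold_domain n" "i \<in> {1..n}"
  shows "0 < weights_of \<sigma> (thr n v) i"
  unfolding weights_of_def
  using cdf_ext_strict_mono[OF assms(1) thr_strict_mono[OF assms(2), of "i - 1" i]] assms(3) by simp

lemma cdf_ext_thr:
  assumes "\<sigma> > 0"
  shows "cdf_ext \<sigma> (thr n v i) = (if i = 0 then 0 else if n \<le> i then 1 else cdf (gauss \<sigma>) (v (n + i)))"
  using assms by (simp add: thr_def)

definition cdf_thr_deriv :: "real \<Rightarrow> nat \<Rightarrow> nat \<Rightarrow> nat \<Rightarrow> (nat \<Rightarrow> real) \<Rightarrow> real" where
  "cdf_thr_deriv \<sigma> n j i v = (if 0 < i \<and> i < n \<and> j = n + i then normal_density 0 \<sigma> (v j) else 0)"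

text \<open>A threshold coordinate moves mass between the two cells that it separates; a level
  coordinate moves none.\<close>

definition weight_deriv :: "real \<Rightarrow> nat \<Rightarrow> nat \<Rightarrow> nat \<Rightarrow> (nat \<Rightarrow> real) \<Rightarrow> real" where
  "weight_deriv \<sigma> n j i v = cdf_thr_deriv \<sigma> n j i v - cdf_thr_deriv \<sigma> n j (i - 1) v"

lemma DERIV_cdf_thr:
  assumes "\<sigma> > 0"
  shows "((\<lambda>t. cdf_ext \<sigma> (thr n (v(j := t)) i)) has_real_derivative cdf_thr_deriv \<sigma> n j i v) (at (v j))"
proof (cases "0 < i \<and> i < n \<and> j = n + i")
  case True
  then show ?thesis
    using has_real_derivative_cdf_gauss[OF assms, of "v j"] by (simp add: cdf_ext_thr[OF assms] cdf_thr_deriv_def)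
next
  case False
  then have "cdf_ext \<sigma> (thr n (v(j := t)) i) = cdf_ext \<sigma> (thr n v i)" for t
    by (auto simp: thr_def)
  then show ?thesis using False by (auto simp: cdf_thr_deriv_def)
qed

lemma DERIV_weight:
  assumes "\<sigma> > 0"
  shows "((\<lambda>t. weights_of \<sigma> (thr n (v(j := t))) i) has_real_derivative weight_deriv \<sigma> n j i v) (at (v j))"
  unfolding weights_of_def weight_deriv_def by (intro DERIV_diff DERIV_cdf_thr assms)

lemma normal_density_le_0: "normal_density 0 \<sigma> x \<le> normal_density 0 \<sigma> 0"
  by (simp add: normal_density_def divide_right_mono)

lemma abs_weight_deriv_le: "\<bar>weight_deriv \<sigma> n j i v\<bar> \<le> 2 * normal_density 0 \<sigma> 0"
proof -
  have "0 \<le> cdf_thr_deriv \<sigma> n j i v" "cdf_thr_deriv \<sigma> n j i v \<le> normal_density 0 \<sigma> 0" for i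
    by (auto simp: cdf_thr_deriv_def normal_density_le_0)
  from this[of i] this[of "i - 1"] show ?thesis unfolding weight_deriv_def by linarith
qed

definition kernel_integral ::
  "real \<Rightarrow> nat \<Rightarrow> nat \<Rightarrow> nat \<Rightarrow> (nat \<Rightarrow> nat) \<Rightarrow> (nat \<Rightarrow> real) \<Rightarrow> real" where
  "kernel_integral \<sigma> n m l e v = (\<integral>z. mix_kernel n v (weights_of \<sigma> (thr n v)) m l e z \<partial>lborel)"

lemma continuous_on_weight:
  assumes "\<sigma> > 0"
  shows "continuous_on S (\<lambda>v. weights_of \<sigma> (thr n v) i)"
proof -
  have "continuous_on S (\<lambda>v. cdf (gauss \<sigma>) (v i))" for i :: nat
    by (rule continuous_on_compose2[OF continuous_cdf_gauss[OF assms, of UNIV]])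
       (auto intro: continuous_on_subset[OF continuous_on_product_coordinates])
  then have *: "continuous_on S (\<lambda>v. cdf_ext \<sigma> (thr n v i))" for i
    unfolding cdf_ext_thr[OF assms] by (cases "i = 0"; cases "n \<le> i") auto
  show ?thesis unfolding weights_of_def by (intro continuous_on_diff *)
qed

lemma finite_family_bound:
  fixes X :: "'a \<Rightarrow> 'b \<Rightarrow> real"
  assumes "finite I" "\<And>i. i \<in> I \<Longrightarrow> \<exists>K. \<forall>k. \<bar>X i k\<bar> \<le> K"
  obtains K where "\<And>i k. i \<in> I \<Longrightarrow> \<bar>X i k\<bar> \<le> K"
proof -
  obtain K where K: "\<forall>i\<in>I. \<forall>k. \<bar>X i k\<bar> \<le> K i" using bchoice[of I "\<lambda>i K. \<forall>k. \<bar>X i k\<bar> \<le> K"] assms(2) by auto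
  have "\<bar>X i k\<bar> \<le> (\<Sum>i\<in>I. \<bar>K i\<bar>)" if "i \<in> I" for i k
  proof -
    have "\<bar>X i k\<bar> \<le> \<bar>K i\<bar>" using K that by (meson abs_ge_self order_trans)
    also have "\<dots> \<le> (\<Sum>i\<in>I. \<bar>K i\<bar>)" using that assms(1) by (intro member_le_sum) auto
    finally show ?thesis .
  qed
  then show ?thesis using that by blast
qed

text \<open>Along a convergent sequence the levels stay bounded, and so do the inverse weights
  because the limiting weights are positive. Hence one envelope dominates all kernels of the
  sequence.\<close>

lemma continuous_on_kernel_integral:
  assumes "\<sigma> > 0" "l \<in> {1..n}"
  shows "continuous_on (threshold_domain n) (kernel_integral \<sigma> n m l e)"
  unfolding continuous_on_sequentially comp_def
proof (intro allI ballI impI, elim conjE)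
  fix X :: "nat \<Rightarrow> nat \<Rightarrow> real" and v
  assume v: "v \<in> threshold_domain n" and X: "\<forall>k. X k \<in> threshold_domain n" and lim: "X \<longlonglongrightarrow> v"
  let ?W = "\<lambda>v. weights_of \<sigma> (thr n v)"
  have n: "1 \<le> n" using assms(2) by simp
  have W: "?W u \<in> weight_simplex n" if "u \<in> threshold_domain n" for u
    by (rule weights_of_simplex[OF assms(1) thr_ok[OF n that]])
  have limX: "(\<lambda>k. X k i) \<longlonglongrightarrow> v i" for i
    using continuous_on_tendsto_compose[OF continuous_on_product_coordinates[of i] lim] by simp
  have limW: "(\<lambda>k. ?W (X k) i) \<longlonglongrightarrow> ?W v i" for i
    using continuous_on_tendsto_compose[OF continuous_on_weight[OF assms(1), of UNIV n i] lim] by simp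
  have "\<exists>K. \<forall>k. \<bar>X k i\<bar> \<le> K" for i
    using convergent_imp_Bseq[OF convergentI[OF limX[of i]]] by (auto simp: Bseq_def)
  then obtain R where R: "\<And>i k. i \<in> {1..n} \<Longrightarrow> \<bar>X k i\<bar> \<le> R"
    using finite_family_bound[of "{1..n}" "\<lambda>i k. X k i"] by auto
  have "\<exists>K. \<forall>k. \<bar>1 / ?W (X k) i\<bar> \<le> K" if "i \<in> {1..n}" for i
  proof -
    have "(\<lambda>k. 1 / ?W (X k) i) \<longlonglongrightarrow> 1 / ?W v i"
      using weights_of_thr_pos[OF assms(1) v that] by (intro tendsto_intros limW) auto
    from convergent_imp_Bseq[OF convergentI[OF this]] show ?thesis
      unfolding Bseq_def real_norm_def by blast
  qed
  then obtain C where C: "\<And>i k. i \<in> {1..n} \<Longrightarrow> \<bar>1 / ?W (X k) i\<bar> \<le> C"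
    using finite_family_bound[of "{1..n}" "\<lambda>i k. 1 / ?W (X k) i"] by auto
  have C': "0 < ?W (X k) i \<and> 1 / ?W (X k) i \<le> C" if "i \<in> {1..n}" for i k
    using C[OF that, of k] weights_of_thr_pos[OF assms(1) X[rule_format] that, of k] by auto
  show "(\<lambda>k. kernel_integral \<sigma> n m l e (X k)) \<longlonglongrightarrow> kernel_integral \<sigma> n m l e v"
    unfolding kernel_integral_def
  proof (rule integral_dominated_convergence)
    show "integrable lborel (\<lambda>z. C ^ (\<Sum>i=1..n. e i) * (\<bar>z\<bar> ^ m * gauss_envelope R z))"
      by (intro integrable_mult_right integrable_power_envelope)
    show "AE z in lborel. norm (mix_kernel n (X k) (?W (X k)) m l e z) \<le> C ^ (\<Sum>i=1..n. e i) * (\<bar>z\<bar> ^ m * gauss_envelope R z)" for k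
      using abs_mix_kernel_le(1)[OF W[OF X[rule_format]] assms(2) R C'] by simp
    show "AE z in lborel. (\<lambda>k. mix_kernel n (X k) (?W (X k)) m l e z) \<longlonglongrightarrow> mix_kernel n v (?W v) m l e z"
    proof (rule AE_I2)
      fix z
      have phi: "(\<lambda>k. phi (z - X k i)) \<longlonglongrightarrow> phi (z - v i)" for i
      proof (rule isCont_tendsto_compose[of _ phi])
        show "isCont phi (z - v i)" by (rule DERIV_isCont[OF has_real_derivative_normal_density]) simp
        show "(\<lambda>k. z - X k i) \<longlonglongrightarrow> z - v i" by (intro tendsto_intros limX)
      qed
      have "(\<lambda>k. mix_dens n (X k) (?W (X k)) z) \<longlonglongrightarrow> mix_dens n v (?W v) z"
        unfolding mix_dens_def by (intro tendsto_intros phi limW)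
      moreover have "mix_dens n v (?W v) z \<noteq> 0" using mix_dens_pos[OF W[OF v], of v z] by simp
      ultimately show "(\<lambda>k. mix_kernel n (X k) (?W (X k)) m l e z) \<longlonglongrightarrow> mix_kernel n v (?W v) m l e z"
        unfolding mix_kernel_def by (intro tendsto_intros phi tendsto_power tendsto_prod tendsto_divide)
    qed
  qed simp_all
qed

definition kernel_integral_deriv ::
  "real \<Rightarrow> nat \<Rightarrow> nat \<Rightarrow> nat \<Rightarrow> nat \<Rightarrow> (nat \<Rightarrow> nat) \<Rightarrow> (nat \<Rightarrow> real) \<Rightarrow> real" where
  "kernel_integral_deriv \<sigma> n j m l e v =
     (let y' = (\<lambda>i. if i = j then 1 else 0); K = (\<lambda>m e. kernel_integral \<sigma> n m l e v) in
     y' l * (K (Suc m) e - v l * K m e)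
     + (\<Sum>i=1..n. real (e i) * y' i * (K (Suc m) e - v i * K m e))
     - real (\<Sum>i=1..n. e i) * (\<Sum>i=1..n. weight_deriv \<sigma> n j i v * K m (e(i := Suc (e i)))
         + weights_of \<sigma> (thr n v) i * y' i * (K (Suc m) (e(i := Suc (e i))) - v i * K m (e(i := Suc (e i))))))"

lemma DERIV_kernel_integral:
  assumes "\<sigma> > 0" "l \<in> {1..n}" and v: "v \<in> threshold_domain n"
  shows "((\<lambda>t. kernel_integral \<sigma> n m l e (v(j := t))) has_real_derivative kernel_integral_deriv \<sigma> n j m l e v) (at (v j))"
proof -
  let ?W = "\<lambda>v. weights_of \<sigma> (thr n v)" and ?c = "\<lambda>t. v(j := t)"
  let ?y' = "\<lambda>i. if i = j then 1 else 0 :: real" and ?E = "\<Sum>i=1..n. e i"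
  have n: "1 \<le> n" using assms(2) by simp
  have W: "?W u \<in> weight_simplex n" if "u \<in> threshold_domain n" for u
    by (rule weights_of_simplex[OF assms(1) thr_ok[OF n that]])
  have "\<forall>\<^sub>F t in nhds (v j). ?W v i / 2 < ?W (?c t) i" if "i \<in> {1..n}" for i
  proof -
    have "isCont (\<lambda>t. ?W (?c t) i) (v j)"
      by (rule DERIV_isCont[OF DERIV_weight[OF assms(1)]])
    then have "((\<lambda>t. ?W (?c t) i) \<longlongrightarrow> ?W v i) (nhds (v j))"
      by (simp add: isCont_def tendsto_nhds_iff)
    then show ?thesis
      using weights_of_thr_pos[OF assms(1) v that] by (intro order_tendstoD(1)) auto
  qed
  then have "\<forall>\<^sub>F t in nhds (v j). ?c t \<in> threshold_domain n \<and> (\<forall>i\<in>{1..n}. ?W v i / 2 < ?W (?c t) i)"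
    by (intro eventually_conj eventually_threshold_domain[OF v] eventually_ball_finite) auto
  then obtain d0 where d0: "0 < d0" and d0': "\<And>t. dist t (v j) < d0 \<Longrightarrow>
      ?c t \<in> threshold_domain n \<and> (\<forall>i\<in>{1..n}. ?W v i / 2 < ?W (?c t) i)"
    unfolding eventually_nhds_metric by blast
  \<comment> \<open>Near the base point each weight keeps at least half its value, which gives the
    bound \<open>C\<close> on the inverse weights; \<open>d \<le> 1\<close> keeps the moved
    coordinate below \<open>R\<close>; \<open>2 * D\<close> bounds the derivatives of the weights.
    The constant \<open>A\<close> collects these so that the logarithmic derivative is at most
    \<open>A * (1 + \<bar>z\<bar>)\<close>.\<close>
  define d where "d = min d0 1"
  define R where "R = 1 + (\<Sum>i=1..n. \<bar>v i\<bar>)"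
  define C where "C = (\<Sum>i=1..n. 2 / ?W v i)"
  define D where "D = normal_density 0 \<sigma> 0"
  define A where "A = (1 + real ?E) * (1 + R) + real ?E * (real n * ((2 * D + 1 + R) * C))"
  have d: "0 < d" using d0 by (simp add: d_def)
  have dom: "?c t \<in> threshold_domain n" and half: "i \<in> {1..n} \<Longrightarrow> ?W v i / 2 < ?W (?c t) i"
    if "\<bar>t - v j\<bar> < d" for t i
    using d0'[of t] that by (auto simp: d_def dist_real_def)
  have Rb: "\<bar>?c t i\<bar> \<le> R" if "\<bar>t - v j\<bar> < d" "i \<in> {1..n}" for t i
  proof -
    have "\<bar>v i\<bar> \<le> (\<Sum>i=1..n. \<bar>v i\<bar>)" using that(2) by (intro member_le_sum) auto
    then show ?thesis using that by (auto simp: R_def d_def)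
  qed
  have Cb: "0 < ?W (?c t) i \<and> 1 / ?W (?c t) i \<le> C" if "\<bar>t - v j\<bar> < d" "i \<in> {1..n}" for t i
  proof -
    have p: "0 < ?W v i" by (rule weights_of_thr_pos[OF assms(1) v that(2)])
    have "1 / ?W (?c t) i \<le> 1 / (?W v i / 2)" using half[OF that] p by (intro divide_left_mono) auto
    also have "\<dots> \<le> C" unfolding C_def using that(2) weights_of_thr_pos[OF assms(1) v]
      by (subst divide_divide_eq_right, intro order_trans[OF _ member_le_sum[of i]]) (auto simp: order_less_imp_le)
    finally show ?thesis using half[OF that] p by linarith
  qed
  have C0: "0 \<le> C" unfolding C_def using weights_of_thr_pos[OF assms(1) v]
    by (intro sum_nonneg) (auto simp: order_less_imp_le)
  have R0: "0 \<le> R" unfolding R_def by (simp add: sum_nonneg add_nonneg_nonneg)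
  have D0: "0 \<le> D" by (simp add: D_def)
  let ?F' = "\<lambda>t z. mix_kernel_deriv n (?c t) ?y' (?W (?c t)) (\<lambda>i. weight_deriv \<sigma> n j i (?c t)) m l e z"
  have "((\<lambda>t. \<integral>z. mix_kernel n (?c t) (?W (?c t)) m l e z \<partial>lborel) has_real_derivative (\<integral>z. ?F' (v j) z \<partial>lborel)) (at (v j))"
  proof (rule has_real_derivative_integral[OF d])
    fix t z assume t: "\<bar>t - v j\<bar> < d"
    show "((\<lambda>t. mix_kernel n (?c t) (?W (?c t)) m l e z) has_real_derivative ?F' t z) (at t)"
    proof (rule DERIV_mix_kernel[where w = "\<lambda>t. ?W (?c t)" and y = ?c, OF W[OF dom[OF t]] assms(2)])
      show "((\<lambda>t. ?W (?c t) i) has_real_derivative weight_deriv \<sigma> n j i (?c t)) (at t)" for i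
        using DERIV_weight[OF assms(1), of n "?c t" j i] by simp
      show "((\<lambda>t. ?c t i) has_real_derivative ?y' i) (at t)" for i
        by (auto intro!: derivative_eq_intros)
    qed
    let ?a = "\<lambda>i. ?y' i * (z - ?c t i)" and ?q = "\<lambda>i. phi (z - ?c t i) / mix_dens n (?c t) (?W (?c t)) z"
    have a: "\<bar>?a i\<bar> \<le> \<bar>z\<bar> + R" if "i \<in> {1..n}" for i
      using Rb[OF t that] R0 by auto
    have q: "\<bar>?q i\<bar> \<le> C" if "i \<in> {1..n}" for i
      using abs_mix_kernel_le(2)[where y = "?c t" and w = "?W (?c t)" and R = R and C = C, OF W[OF dom[OF t]] assms(2) _ _ that]
        Rb[OF t] Cb[OF t] by blast
    have w1: "\<bar>?W (?c t) i\<bar> \<le> 1" if "i \<in> {1..n}" for i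
    proof -
      have nn: "0 \<le> ?W (?c t) i" if "i \<in> {1..n}" for i using W[OF dom[OF t]] that by (simp add: weight_simplex_def)
      then have "?W (?c t) i \<le> (\<Sum>i=1..n. ?W (?c t) i)" using that by (intro member_le_sum) auto
      then show ?thesis using nn[OF that] W[OF dom[OF t]] by (simp add: weight_simplex_def)
    qed
    have "\<bar>\<Sum>i=1..n. real (e i) * ?a i\<bar> \<le> (\<Sum>i=1..n. real (e i) * (\<bar>z\<bar> + R))"
      using a by (intro order_trans[OF sum_abs] sum_mono) (simp only: abs_mult abs_of_nat mult_left_mono of_nat_0_le_iff)
    then have b1: "\<bar>\<Sum>i=1..n. real (e i) * ?a i\<bar> \<le> real ?E * (\<bar>z\<bar> + R)"
      by (simp add: sum_distrib_right)
    have "\<bar>\<Sum>i=1..n. (weight_deriv \<sigma> n j i (?c t) + ?W (?c t) i * ?a i) * ?q i\<bar> \<le> (\<Sum>i=1..n. (2 * D + (\<bar>z\<bar> + R)) * C)"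
    proof (intro order_trans[OF sum_abs] sum_mono)
      fix i assume i: "i \<in> {1..n}"
      have "\<bar>?W (?c t) i * ?a i\<bar> \<le> 1 * (\<bar>z\<bar> + R)"
        unfolding abs_mult[of "?W (?c t) i"] using w1[OF i] a[OF i] R0 by (intro mult_mono) auto
      then have "\<bar>weight_deriv \<sigma> n j i (?c t) + ?W (?c t) i * ?a i\<bar> \<le> 2 * D + (\<bar>z\<bar> + R)"
        unfolding D_def mult_1 by (rule order_trans[OF abs_triangle_ineq add_mono[OF abs_weight_deriv_le]])
      then show "\<bar>(weight_deriv \<sigma> n j i (?c t) + ?W (?c t) i * ?a i) * ?q i\<bar> \<le> (2 * D + (\<bar>z\<bar> + R)) * C"
        unfolding abs_mult[of _ "?q i"] using q[OF i] R0 D0 by (intro mult_mono) auto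
    qed
    then have "\<bar>\<Sum>i=1..n. (weight_deriv \<sigma> n j i (?c t) + ?W (?c t) i * ?a i) * ?q i\<bar> \<le> real n * ((2 * D + (\<bar>z\<bar> + R)) * C)"
      by simp
    then have b2: "\<bar>real ?E * (\<Sum>i=1..n. (weight_deriv \<sigma> n j i (?c t) + ?W (?c t) i * ?a i) * ?q i)\<bar>
        \<le> real ?E * (real n * ((2 * D + (\<bar>z\<bar> + R)) * C))"
      by (simp only: abs_mult[of "real ?E"] abs_of_nat mult_left_mono of_nat_0_le_iff)
    have "\<bar>?a l + (\<Sum>i=1..n. real (e i) * ?a i)
        - real ?E * (\<Sum>i=1..n. (weight_deriv \<sigma> n j i (?c t) + ?W (?c t) i * ?a i) * ?q i)\<bar>
        \<le> (\<bar>z\<bar> + R) + real ?E * (\<bar>z\<bar> + R) + real ?E * (real n * ((2 * D + (\<bar>z\<bar> + R)) * C))"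
      using a[OF assms(2)] b1 b2 by linarith
    also have "\<dots> \<le> A * (1 + \<bar>z\<bar>)"
    proof -
      have 1: "\<bar>z\<bar> + R \<le> (1 + R) * (1 + \<bar>z\<bar>)" using R0 by (simp add: algebra_simps)
      have 2: "2 * D + (\<bar>z\<bar> + R) \<le> (2 * D + 1 + R) * (1 + \<bar>z\<bar>)" using R0 D0 by (simp add: algebra_simps)
      have 3: "real ?E * (\<bar>z\<bar> + R) \<le> real ?E * ((1 + R) * (1 + \<bar>z\<bar>))"
        by (rule mult_left_mono[OF 1 of_nat_0_le_iff])
      have "real ?E * (real n * ((2 * D + (\<bar>z\<bar> + R)) * C)) \<le> real ?E * (real n * (((2 * D + 1 + R) * (1 + \<bar>z\<bar>)) * C))"
        by (intro mult_left_mono mult_right_mono of_nat_0_le_iff 2 C0)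
      then show ?thesis using 1 3 unfolding A_def by (simp only: algebra_simps)
    qed
    finally have *: "\<bar>?a l + (\<Sum>i=1..n. real (e i) * ?a i)
        - real ?E * (\<Sum>i=1..n. (weight_deriv \<sigma> n j i (?c t) + ?W (?c t) i * ?a i) * ?q i)\<bar> \<le> A * (1 + \<bar>z\<bar>)" .
    have k: "\<bar>mix_kernel n (?c t) (?W (?c t)) m l e z\<bar> \<le> C ^ ?E * (\<bar>z\<bar> ^ m * gauss_envelope R z)"
      by (rule abs_mix_kernel_le(1)[OF W[OF dom[OF t]] assms(2) Rb[OF t] Cb[OF t]])
    have "\<bar>?F' t z\<bar> \<le> (C ^ ?E * (\<bar>z\<bar> ^ m * gauss_envelope R z)) * (A * (1 + \<bar>z\<bar>))"
      unfolding mix_kernel_deriv_eq abs_mult[of "mix_kernel n (?c t) (?W (?c t)) m l e z"]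
      using C0 by (intro mult_mono[OF k *]) auto
    also have "\<dots> = (A * C ^ ?E) * (\<bar>z\<bar> ^ m * gauss_envelope R z + \<bar>z\<bar> ^ Suc m * gauss_envelope R z)"
      by (simp only: power_Suc algebra_simps)
    finally show "\<bar>?F' t z\<bar> \<le> (A * C ^ ?E) * (\<bar>z\<bar> ^ m * gauss_envelope R z + \<bar>z\<bar> ^ Suc m * gauss_envelope R z)" .
  next
    show "integrable lborel (\<lambda>z. (A * C ^ ?E) * (\<bar>z\<bar> ^ m * gauss_envelope R z + \<bar>z\<bar> ^ Suc m * gauss_envelope R z))"
      by (intro integrable_mult_right Bochner_Integration.integrable_add integrable_power_envelope)
    show "integrable lborel (mix_kernel n (?c t) (?W (?c t)) m l e)" if "\<bar>t - v j\<bar> < d" for t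
      using integrable_mix_kernel[OF W[OF dom[OF that]] assms(2)] Cb[OF that] by blast
    show "?F' (v j) \<in> borel_measurable lborel"
      unfolding mix_kernel_deriv_def[abs_def] by measurable
  qed
  moreover have "(\<integral>z. ?F' (v j) z \<partial>lborel) = kernel_integral_deriv \<sigma> n j m l e v"
  proof -
    have i: "integrable lborel (\<lambda>z. mix_kernel n v (?W v) m l e z)" for m e
      using integrable_mix_kernel[OF W[OF v] assms(2)] weights_of_thr_pos[OF assms(1) v] by blast
    show ?thesis
      unfolding mix_kernel_deriv_def kernel_integral_deriv_def kernel_integral_def Let_def fun_upd_triv
      using i by simp
  qed
  ultimately show ?thesis unfolding kernel_integral_def by simp
qed

text \<open>This algebra of functions is closed under all partial derivatives, so that a single
  differentiation step already yields smoothness.\<close>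

inductive calc :: "real \<Rightarrow> nat \<Rightarrow> ((nat \<Rightarrow> real) \<Rightarrow> real) \<Rightarrow> bool" for \<sigma> n where
  const: "calc \<sigma> n (\<lambda>v. c)"
| coord: "calc \<sigma> n (\<lambda>v. v i)"
| dens: "calc \<sigma> n (\<lambda>v. normal_density 0 \<sigma> (v i))"
| cdf: "calc \<sigma> n (\<lambda>v. cdf (gauss \<sigma>) (v i))"
| kernel: "l \<in> {1..n} \<Longrightarrow> calc \<sigma> n (kernel_integral \<sigma> n m l e)"
| add: "calc \<sigma> n f \<Longrightarrow> calc \<sigma> n g \<Longrightarrow> calc \<sigma> n (\<lambda>v. f v + g v)"
| mult: "calc \<sigma> n f \<Longrightarrow> calc \<sigma> n g \<Longrightarrow> calc \<sigma> n (\<lambda>v. f v * g v)"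
| cong: "calc \<sigma> n f \<Longrightarrow> (\<And>v. v \<in> threshold_domain n \<Longrightarrow> g v = f v) \<Longrightarrow> calc \<sigma> n g"

lemma calc_diff: "calc \<sigma> n f \<Longrightarrow> calc \<sigma> n g \<Longrightarrow> calc \<sigma> n (\<lambda>v. f v - g v)"
  using calc.add[OF _ calc.mult[OF calc.const[of _ _ "-1"]], of \<sigma> n f g] by simp

lemma calc_sum:
  assumes "finite I" "\<And>i. i \<in> I \<Longrightarrow> calc \<sigma> n (f i)"
  shows "calc \<sigma> n (\<lambda>v. \<Sum>i\<in>I. f i v)"
  using assms by (induction I rule: finite_induct) (auto intro: calc.const calc.add)

lemma calc_weights_of:
  assumes "\<sigma> > 0"
  shows "calc \<sigma> n (\<lambda>v. weights_of \<sigma> (thr n v) i)"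
proof -
  have *: "calc \<sigma> n (\<lambda>v. cdf_ext \<sigma> (thr n v i))" for i
    unfolding cdf_ext_thr[OF assms] by (cases "i = 0"; cases "n \<le> i") (auto intro: calc.const calc.cdf)
  show ?thesis unfolding weights_of_def by (intro calc_diff *)
qed

lemma calc_weight_deriv: "calc \<sigma> n (weight_deriv \<sigma> n j i)"
proof -
  have *: "calc \<sigma> n (cdf_thr_deriv \<sigma> n j i)" for i
    unfolding cdf_thr_deriv_def[abs_def]
    by (cases "0 < i \<and> i < n \<and> j = n + i") (auto intro: calc.const calc.dens)
  show ?thesis unfolding weight_deriv_def[abs_def] by (intro calc_diff *)
qed

lemma calc_kernel_integral_deriv:
  assumes "\<sigma> > 0" "l \<in> {1..n}"
  shows "calc \<sigma> n (kernel_integral_deriv \<sigma> n j m l e)"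
  unfolding kernel_integral_deriv_def[abs_def] Let_def
  by (intro calc_diff calc.add calc.mult calc_sum calc.const calc.coord calc.kernel calc_weights_of
      calc_weight_deriv assms) auto

text \<open>Induction over the generators, each of which has partial derivatives again in the class.
  For \<open>cong\<close> the openness of \<open>threshold_domain\<close> matters: the two functions
  agree near the point along each coordinate line, hence have the same derivative.\<close>

lemma calc_deriv:
  assumes "calc \<sigma> n f" "\<sigma> > 0"
  shows "continuous_on (threshold_domain n) f \<and>
    (\<forall>j. \<exists>f'. calc \<sigma> n f' \<and>
       (\<forall>v\<in>threshold_domain n. ((\<lambda>t. f (v(j := t))) has_real_derivative f' v) (at (v j))))"
  using assms(1)
proof (induction rule: calc.induct)
  case (const c)
  then show ?case by (auto intro!: continuous_intros exI[of _ "\<lambda>_. 0"] calc.const)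
next
  case (coord i)
  have "\<exists>f'. calc \<sigma> n f' \<and> (\<forall>v\<in>threshold_domain n. ((\<lambda>t. (v(j := t)) i) has_real_derivative f' v) (at (v j)))" for j
    by (rule exI[of _ "\<lambda>_. if i = j then 1 else 0"]) (auto intro: calc.const intro!: derivative_eq_intros)
  then show ?case by (auto intro: continuous_on_subset[OF continuous_on_product_coordinates])
next
  case (dens i)
  have d: "(normal_density 0 \<sigma> has_real_derivative - (x - 0) / \<sigma>\<^sup>2 * normal_density 0 \<sigma> x) (at x)" for x
    by (rule has_real_derivative_normal_density[OF assms(2)])
  have "\<exists>f'. calc \<sigma> n f' \<and> (\<forall>v\<in>threshold_domain n. ((\<lambda>t. normal_density 0 \<sigma> ((v(j := t)) i)) has_real_derivative f' v) (at (v j)))" for j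
  proof (cases "i = j")
    case True
    have "calc \<sigma> n (\<lambda>v. (- 1 / \<sigma>\<^sup>2) * v j * normal_density 0 \<sigma> (v j))"
      by (intro calc.intros)
    then show ?thesis using True d by (intro exI[of _ "\<lambda>v. (- 1 / \<sigma>\<^sup>2) * v j * normal_density 0 \<sigma> (v j)"]) simp
  qed (auto intro!: exI[of _ "\<lambda>_. 0"] calc.const)
  moreover have "continuous_on (threshold_domain n) (\<lambda>v. normal_density 0 \<sigma> (v i))"
  proof (rule continuous_on_compose2[of UNIV "normal_density 0 \<sigma>"])
    show "continuous_on UNIV (normal_density 0 \<sigma>)"
      by (intro continuous_at_imp_continuous_on ballI DERIV_isCont[OF d])
  qed (auto intro: continuous_on_subset[OF continuous_on_product_coordinates])
  ultimately show ?case by blast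
next
  case (cdf i)
  have "\<exists>f'. calc \<sigma> n f' \<and> (\<forall>v\<in>threshold_domain n. ((\<lambda>t. cdf (gauss \<sigma>) ((v(j := t)) i)) has_real_derivative f' v) (at (v j)))" for j
  proof (cases "i = j")
    case True
    then show ?thesis using has_real_derivative_cdf_gauss[OF assms(2)]
      by (intro exI[of _ "\<lambda>v. normal_density 0 \<sigma> (v j)"]) (simp add: calc.dens)
  qed (auto intro!: exI[of _ "\<lambda>_. 0"] calc.const)
  moreover have "continuous_on (threshold_domain n) (\<lambda>v. cdf (gauss \<sigma>) (v i))"
    by (rule continuous_on_compose2[OF continuous_cdf_gauss[OF assms(2), of UNIV]])
       (auto intro: continuous_on_subset[OF continuous_on_product_coordinates])
  ultimately show ?case by blast
next
  case (kernel l m e)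
  then show ?case
    using continuous_on_kernel_integral[OF assms(2) kernel] DERIV_kernel_integral[OF assms(2) kernel]
      calc_kernel_integral_deriv[OF assms(2) kernel] by blast
next
  case (add f g)
  have "\<exists>h'. calc \<sigma> n h' \<and> (\<forall>v\<in>threshold_domain n. ((\<lambda>t. f (v(j := t)) + g (v(j := t))) has_real_derivative h' v) (at (v j)))" for j
  proof -
    obtain f' where f': "calc \<sigma> n f'" "\<And>v. v \<in> threshold_domain n \<Longrightarrow> ((\<lambda>t. f (v(j := t))) has_real_derivative f' v) (at (v j))"
      using add.IH(1) by blast
    obtain g' where g': "calc \<sigma> n g'" "\<And>v. v \<in> threshold_domain n \<Longrightarrow> ((\<lambda>t. g (v(j := t))) has_real_derivative g' v) (at (v j))"
      using add.IH(2) by blast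
    show ?thesis
      by (rule exI[of _ "\<lambda>v. f' v + g' v"]) (auto intro: calc.add f' g' DERIV_add)
  qed
  moreover have "continuous_on (threshold_domain n) (\<lambda>v. f v + g v)"
    using add.IH by (intro continuous_on_add) blast+
  ultimately show ?case by blast
next
  case (mult f g)
  have "\<exists>h'. calc \<sigma> n h' \<and> (\<forall>v\<in>threshold_domain n. ((\<lambda>t. f (v(j := t)) * g (v(j := t))) has_real_derivative h' v) (at (v j)))" for j
  proof -
    obtain f' where f': "calc \<sigma> n f'" "\<And>v. v \<in> threshold_domain n \<Longrightarrow> ((\<lambda>t. f (v(j := t))) has_real_derivative f' v) (at (v j))"
      using mult.IH(1) by blast
    obtain g' where g': "calc \<sigma> n g'" "\<And>v. v \<in> threshold_domain n \<Longrightarrow> ((\<lambda>t. g (v(j := t))) has_real_derivative g' v) (at (v j))"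
      using mult.IH(2) by blast
    have "((\<lambda>t. f (v(j := t)) * g (v(j := t))) has_real_derivative f' v * g v + g' v * f v) (at (v j))"
      if "v \<in> threshold_domain n" for v
      using DERIV_mult[OF f'(2)[OF that] g'(2)[OF that]] by simp
    moreover have "calc \<sigma> n (\<lambda>v. f' v * g v + g' v * f v)"
      by (intro calc.add calc.mult f' g' mult.hyps)
    ultimately show ?thesis by blast
  qed
  moreover have "continuous_on (threshold_domain n) (\<lambda>v. f v * g v)"
    using mult.IH by (intro continuous_on_mult) blast+
  ultimately show ?case by blast
next
  case (cong f g)
  have "\<exists>h'. calc \<sigma> n h' \<and> (\<forall>v\<in>threshold_domain n. ((\<lambda>t. g (v(j := t))) has_real_derivative h' v) (at (v j)))" for j
  proof -
    obtain f' where f': "calc \<sigma> n f'" "\<And>v. v \<in> threshold_domain n \<Longrightarrow> ((\<lambda>t. f (v(j := t))) has_real_derivative f' v) (at (v j))"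
      using cong.IH by blast
    have "((\<lambda>t. g (v(j := t))) has_real_derivative f' v) (at (v j))" if v: "v \<in> threshold_domain n" for v
    proof -
      have "\<forall>\<^sub>F t in nhds (v j). g (v(j := t)) = f (v(j := t))"
        using eventually_threshold_domain[OF v, of j] by eventually_elim (rule cong.hyps)
      then show ?thesis using f'(2)[OF v] by (subst DERIV_cong_ev[OF refl _ refl])
    qed
    then show ?thesis using f'(1) by blast
  qed
  moreover have "continuous_on (threshold_domain n) g"
    using cong by (subst continuous_on_cong[OF refl cong.hyps(2)]) auto
  ultimately show ?case by blast
qed

lemma calc_C_on:
  assumes "calc \<sigma> n f" "\<sigma> > 0"
  shows "C_on m I (threshold_domain n) f"
  using assms(1)
proof (induction m arbitrary: f)
  case 0
  then show ?case using calc_deriv[OF _ assms(2)] by auto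
next
  case (Suc m)
  then show ?case using calc_deriv[OF Suc.prems assms(2)] unfolding C_on.simps by blast
qed

lemma C_on_subset: "C_on m I U f \<Longrightarrow> V \<subseteq> U \<Longrightarrow> C_on m I V f"
  by (induction m arbitrary: f) (auto intro: continuous_on_subset, meson subsetD)

lemma calc_smooth:
  assumes "calc \<sigma> n f" "\<sigma> > 0"
  shows "smooth_coords_on I (prog_domain n) f"
  unfolding smooth_coords_on_def
  using C_on_subset[OF calc_C_on[OF assms] prog_domain_subset] by blast

text \<open>Expanding the square of \<open>mix_num\<close> turns the integrand into a combination of
  kernels \<open>phi (z - v i) * (phi (z - v j) / p)\<close>; the exponent vector
  \<open>?e j\<close> selects the single ratio with index \<open>j\<close>.\<close>

lemma calc_prog_estimation:
  assumes "\<sigma> > 0" "1 \<le> n"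
  shows "calc \<sigma> n (prog_estimation \<sigma> n)"
proof (rule calc.cong)
  let ?W = "\<lambda>v. weights_of \<sigma> (thr n v)"
  let ?e = "\<lambda>j. (\<lambda>_. 0)(j := Suc 0)"
  show "calc \<sigma> n (\<lambda>v. (\<Sum>i=1..n. ?W v i * (v i * v i))
     - (\<Sum>i=1..n. \<Sum>j=1..n. ?W v i * v i * (?W v j * v j) * kernel_integral \<sigma> n 0 i (?e j) v))"
    by (intro calc_diff calc.add calc.mult calc_sum calc.coord calc.kernel calc_weights_of assms) auto
  fix v assume v: "v \<in> threshold_domain n"
  have W: "?W v \<in> weight_simplex n" by (rule weights_of_simplex[OF assms(1) thr_ok[OF assms(2) v]])
  have i: "integrable lborel (mix_kernel n v (?W v) 0 i (?e j))" if "i \<in> {1..n}" for i j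
    by (rule integrable_mix_kernel[OF W that weights_of_thr_pos[OF assms(1) v]])
  have k: "mix_kernel n v (?W v) 0 i (?e j) z = phi (z - v i) * (phi (z - v j) / mix_dens n v (?W v) z)"
    if "j \<in> {1..n}" for i j z
    using mix_kernel_upd[OF that, of v "?W v" 0 i "\<lambda>_. 0" z] by (simp add: mix_kernel_def)
  have "(mix_num n v (?W v) z)\<^sup>2 / mix_dens n v (?W v) z
     = (\<Sum>i=1..n. \<Sum>j=1..n. ?W v i * v i * (?W v j * v j) * mix_kernel n v (?W v) 0 i (?e j) z)" for z
  proof -
    have "(mix_num n v (?W v) z)\<^sup>2 / mix_dens n v (?W v) z
      = (\<Sum>i=1..n. \<Sum>j=1..n. (?W v i * v i * phi (z - v i)) * (?W v j * v j * phi (z - v j)) / mix_dens n v (?W v) z)"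
      unfolding mix_num_def power2_eq_square sum_product sum_divide_distrib ..
    also have "\<dots> = (\<Sum>i=1..n. \<Sum>j=1..n. ?W v i * v i * (?W v j * v j) * mix_kernel n v (?W v) 0 i (?e j) z)"
      by (intro sum.cong refl) (simp only: k, simp)
    finally show ?thesis .
  qed
  then have "(\<integral>z. (mix_num n v (?W v) z)\<^sup>2 / mix_dens n v (?W v) z \<partial>lborel)
     = (\<Sum>i=1..n. \<Sum>j=1..n. ?W v i * v i * (?W v j * v j) * kernel_integral \<sigma> n 0 i (?e j) v)"
    unfolding kernel_integral_def using i by simp
  then show "prog_estimation \<sigma> n v = (\<Sum>i=1..n. ?W v i * (v i * v i))
     - (\<Sum>i=1..n. \<Sum>j=1..n. ?W v i * v i * (?W v j * v j) * kernel_integral \<sigma> n 0 i (?e j) v)"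
    unfolding prog_estimation_def estimation_part_def by (simp only: power2_eq_square)
qed

lemma prog_objective_eq:
  assumes "\<sigma> > 0" "1 \<le> n" "v \<in> threshold_domain n"
  shows "prog_objective \<sigma> k n v = k\<^sup>2 * transport_cost \<sigma> n v (thr n v) + prog_estimation \<sigma> n v"
  unfolding prog_objective_def objective_def prog_estimation_def
  using transport_part_eq[OF assms(1) thr_ok[OF assms(2,3)]] by simp

text \<open>The transport part enters the class through the closed form of the bin moments, with
  density 0 at the two infinite thresholds.\<close>

lemma calc_prog_objective:
  assumes "\<sigma> > 0" "1 \<le> n"
  shows "calc \<sigma> n (prog_objective \<sigma> k n)"
proof (rule calc.cong)
  let ?d = "\<lambda>v i. if i = 0 \<or> n \<le> i then 0 else normal_density 0 \<sigma> (v (n + i))"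
  let ?f = "\<lambda>v. k\<^sup>2 * (\<sigma>\<^sup>2 - 2 * (\<Sum>i=1..n. v i * (\<sigma>\<^sup>2 * (?d v (i - 1) - ?d v i)))
      + (\<Sum>i=1..n. weights_of \<sigma> (thr n v) i * (v i * v i))) + prog_estimation \<sigma> n v"
  have *: "calc \<sigma> n (\<lambda>v. ?d v i)" for i by (cases "i = 0 \<or> n \<le> i") (auto intro: calc.const calc.dens)
  show "calc \<sigma> n ?f"
    by (intro calc_diff calc.add calc.mult calc_sum calc.coord calc.const calc_weights_of calc_prog_estimation assms *) auto
  fix v assume v: "v \<in> threshold_domain n"
  have d: "dens_ext \<sigma> (thr n v i) = ?d v i" for i by (simp add: dens_ext_def thr_def)
  have "bin_moment \<sigma> (thr n v) i = \<sigma>\<^sup>2 * (?d v (i - 1) - ?d v i)" if "i \<in> {1..n}" for i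
    unfolding d[symmetric] using thresholds_ok_mono[OF thr_ok[OF assms(2) v]] that
    by (intro bin_moment_eq[OF assms(1)]) auto
  then show "prog_objective \<sigma> k n v = ?f v"
    unfolding prog_objective_eq[OF assms v] transport_cost_def by (simp add: power2_eq_square)
qed

section \<open>The gradient of the estimation part\<close>

lemma DERIV_estimator_loss:
  assumes [measurable]: "h \<in> borel_measurable borel" and h: "\<And>z. \<bar>h z\<bar> \<le> B"
  shows "((\<lambda>t. \<integral>z. phi (z - t) * (t - h z)\<^sup>2 \<partial>lborel) has_real_derivative
      (\<integral>z. phi (z - a) * (2 * (a - h z) + (z - a) * (a - h z)\<^sup>2) \<partial>lborel)) (at a)"
proof (rule has_real_derivative_integral[of 1])
  define R where "R = \<bar>a\<bar> + 1"
  let ?B = "\<lambda>z. (2 * (R + B) + R * (R + B)\<^sup>2) * (\<bar>z\<bar> ^ 0 * gauss_envelope R z) + (R + B)\<^sup>2 * (\<bar>z\<bar> ^ 1 * gauss_envelope R z)"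
  show "integrable lborel ?B"
    by (intro Bochner_Integration.integrable_add integrable_mult_right integrable_power_envelope)
  fix t z assume t: "\<bar>t - a\<bar> < 1"
  have tR: "\<bar>t\<bar> \<le> R" using t by (simp add: R_def)
  have "((\<lambda>t. phi (z - t)) has_real_derivative phi (z - t) * (1 * (z - t))) (at t)"
    by (rule DERIV_phi_log) simp
  moreover have "((\<lambda>t. (t - h z)\<^sup>2) has_real_derivative 2 * (t - h z)) (at t)"
    by (auto intro!: derivative_eq_intros)
  ultimately have "((\<lambda>t. phi (z - t) * (t - h z)\<^sup>2) has_real_derivative
      phi (z - t) * (1 * (z - t)) * (t - h z)\<^sup>2 + 2 * (t - h z) * phi (z - t)) (at t)"
    by (rule DERIV_mult)
  then show "((\<lambda>t. phi (z - t) * (t - h z)\<^sup>2) has_real_derivative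
      phi (z - t) * (2 * (t - h z) + (z - t) * (t - h z)\<^sup>2)) (at t)"
    by (rule DERIV_cong) (simp add: algebra_simps)
  have th: "\<bar>t - h z\<bar> \<le> R + B" using tR h[of z] by linarith
  have sq: "(t - h z)\<^sup>2 \<le> (R + B)\<^sup>2" using power_mono[OF th abs_ge_zero, of 2] by simp
  have "\<bar>(z - t) * (t - h z)\<^sup>2\<bar> \<le> (\<bar>z\<bar> + R) * (R + B)\<^sup>2"
    unfolding abs_mult using tR sq by (intro mult_mono) auto
  moreover have "\<bar>2 * (t - h z)\<bar> \<le> 2 * (R + B)" using th by (simp add: abs_mult)
  ultimately have "\<bar>2 * (t - h z) + (z - t) * (t - h z)\<^sup>2\<bar> \<le> 2 * (R + B) + (\<bar>z\<bar> + R) * (R + B)\<^sup>2"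
    by (intro order_trans[OF abs_triangle_ineq] add_mono)
  then have "phi (z - t) * \<bar>2 * (t - h z) + (z - t) * (t - h z)\<^sup>2\<bar> \<le> gauss_envelope R z * (2 * (R + B) + (\<bar>z\<bar> + R) * (R + B)\<^sup>2)"
    using phi_le_envelope[OF tR, of z] by (intro mult_mono) auto
  also have "\<dots> = ?B z" by (simp add: algebra_simps)
  finally show "\<bar>phi (z - t) * (2 * (t - h z) + (z - t) * (t - h z)\<^sup>2)\<bar> \<le> ?B z"
    by (simp only: abs_mult abs_of_nonneg[OF phi_nonneg])
next
  show "integrable lborel (\<lambda>z. phi (z - t) * (t - h z)\<^sup>2)" for t
    by (rule integrable_phi_bounded[OF _ abs_sq_diff_le[OF h]]) simp
qed simp_all

text \<open>Envelope argument: with the estimator frozen at the posterior mean of the base point, the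
  estimator cost majorises the estimation part and touches it at the base point, so both have the
  same derivative there.\<close>

lemma DERIV_prog_estimation:
  assumes "\<sigma> > 0" "1 \<le> n" and v: "v \<in> threshold_domain n"
  defines "h \<equiv> post_mean n v (weights_of \<sigma> (thr n v))"
  shows "((\<lambda>t. prog_estimation \<sigma> n (v(j := t))) has_real_derivative
     (\<Sum>i=1..n. weight_deriv \<sigma> n j i v * (\<integral>z. phi (z - v i) * (v i - h z)\<^sup>2 \<partial>lborel)
        + (if i = j then 1 else 0) * (weights_of \<sigma> (thr n v) i *
            (\<integral>z. phi (z - v i) * (2 * (v i - h z) + (z - v i) * (v i - h z)\<^sup>2) \<partial>lborel)))) (at (v j))"
    (is "(_ has_real_derivative ?D) _")
proof -
  let ?W = "\<lambda>v. weights_of \<sigma> (thr n v)" and ?c = "\<lambda>t. v(j := t)"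
  have W: "?W u \<in> weight_simplex n" if "u \<in> threshold_domain n" for u
    by (rule weights_of_simplex[OF assms(1) thr_ok[OF assms(2) that]])
  have h [measurable]: "h \<in> borel_measurable borel" unfolding h_def by simp
  have hb: "\<bar>h z\<bar> \<le> (\<Sum>i=1..n. \<bar>v i\<bar>)" for z unfolding h_def by (rule abs_post_mean_le[OF W[OF v]])
  let ?S = "\<lambda>t. estimator_cost n (?c t) (?W (?c t)) h"
  let ?G = "\<lambda>a. \<integral>z. phi (z - a) * (a - h z)\<^sup>2 \<partial>lborel"
  have dG: "((\<lambda>t. ?G (?c t i)) has_real_derivative
      (if i = j then 1 else 0) * (\<integral>z. phi (z - v i) * (2 * (v i - h z) + (z - v i) * (v i - h z)\<^sup>2) \<partial>lborel)) (at (v j))" for i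
    using DERIV_estimator_loss[OF h hb, of "v j"] by (cases "i = j") auto
  have "(?S has_real_derivative (\<Sum>i=1..n. weight_deriv \<sigma> n j i v * ?G (?c (v j) i)
      + ((if i = j then 1 else 0) * (\<integral>z. phi (z - v i) * (2 * (v i - h z) + (z - v i) * (v i - h z)\<^sup>2) \<partial>lborel)) * ?W (?c (v j)) i)) (at (v j))"
    unfolding estimator_cost_def by (intro DERIV_sum DERIV_mult DERIV_weight[OF assms(1)] dG)
  also have "(\<Sum>i=1..n. weight_deriv \<sigma> n j i v * ?G (?c (v j) i)
      + ((if i = j then 1 else 0) * (\<integral>z. phi (z - v i) * (2 * (v i - h z) + (z - v i) * (v i - h z)\<^sup>2) \<partial>lborel)) * ?W (?c (v j)) i) = ?D"
    by (intro sum.cong refl) (simp only: fun_upd_triv mult_ac)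
  finally have dS: "(?S has_real_derivative ?D) (at (v j))" .
  \<comment> \<open>Differentiability of the estimation part is already known; only the value of the
    derivative is open. It is forced by the vanishing derivative of the gap to the majorant at a
    local minimum.\<close>
  obtain D' where dE: "((\<lambda>t. prog_estimation \<sigma> n (?c t)) has_real_derivative D') (at (v j))"
    using calc_deriv[OF calc_prog_estimation[OF assms(1,2)] assms(1)] v by blast
  obtain d where d: "0 < d" "\<And>t. dist t (v j) < d \<Longrightarrow> ?c t \<in> threshold_domain n"
    using eventually_threshold_domain[OF v, of j] unfolding eventually_nhds_metric by blast
  have diff: "((\<lambda>t. ?S t - prog_estimation \<sigma> n (?c t)) has_real_derivative ?D - D') (at (v j))"
    by (rule DERIV_diff[OF dS dE])
  have "?D - D' = 0"
  proof (rule DERIV_local_min[OF diff d(1)], intro allI impI)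
    fix t assume "\<bar>v j - t\<bar> < d"
    then have t: "?c t \<in> threshold_domain n" using d(2)[of t] by (simp add: dist_real_def abs_minus_commute)
    have "prog_estimation \<sigma> n (?c t) \<le> ?S t"
      unfolding prog_estimation_def by (rule estimation_part_le[OF W[OF t] h hb])
    moreover have "prog_estimation \<sigma> n v = estimator_cost n v (?W v) h"
      unfolding prog_estimation_def h_def by (rule estimation_part_eq_estimator_cost[OF W[OF v]])
    ultimately show "?S (v j) - prog_estimation \<sigma> n (?c (v j)) \<le> ?S t - prog_estimation \<sigma> n (?c t)"
      by simp
  qed
  then show ?thesis using dE by simp
qed

lemma DERIV_estimation_level:
  assumes "\<sigma> > 0" "1 \<le> n" "v \<in> threshold_domain n" "j \<in> {1..n}"
  shows "((\<lambda>t. prog_estimation \<sigma> n (v(j := t))) has_real_derivative estimation_grad_level \<sigma> n v j) (at (v j))"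
proof (rule DERIV_cong[OF DERIV_prog_estimation[OF assms(1-3)]])
  have z: "weight_deriv \<sigma> n j i v = 0" for i
    using assms(4) by (auto simp: weight_deriv_def cdf_thr_deriv_def)
  show "(\<Sum>i=1..n. weight_deriv \<sigma> n j i v * (\<integral>z. phi (z - v i) * (v i - post_mean n v (weights_of \<sigma> (thr n v)) z)\<^sup>2 \<partial>lborel)
        + (if i = j then 1 else 0) * (weights_of \<sigma> (thr n v) i *
            (\<integral>z. phi (z - v i) * (2 * (v i - post_mean n v (weights_of \<sigma> (thr n v)) z) + (z - v i) * (v i - post_mean n v (weights_of \<sigma> (thr n v)) z)\<^sup>2) \<partial>lborel)))
     = estimation_grad_level \<sigma> n v j"
    unfolding z estimation_grad_level_def Let_def mult_zero_left add_0_left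
    using assms(4) by (simp add: if_distrib[of "\<lambda>x. x * _"] cong: if_cong)
qed

lemma DERIV_estimation_threshold:
  assumes "\<sigma> > 0" "1 \<le> n" "v \<in> threshold_domain n" "j \<in> {1..<n}"
  shows "((\<lambda>t. prog_estimation \<sigma> n (v(n + j := t))) has_real_derivative estimation_grad_threshold \<sigma> n v j) (at (v (n + j)))"
proof (rule DERIV_cong[OF DERIV_prog_estimation[OF assms(1-3)]])
  let ?h = "post_mean n v (weights_of \<sigma> (thr n v))" and ?\<rho> = "normal_density 0 \<sigma> (v (n + j))"
  let ?G = "\<lambda>i. \<integral>z. phi (z - v i) * (v i - ?h z)\<^sup>2 \<partial>lborel"
  have W: "weights_of \<sigma> (thr n v) \<in> weight_simplex n"
    by (rule weights_of_simplex[OF assms(1) thr_ok[OF assms(2,3)]])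
  have i: "integrable lborel (\<lambda>z. phi (z - v i) * (v i - ?h z)\<^sup>2)" for i
    by (rule integrable_phi_bounded[OF _ abs_sq_diff_le[OF abs_post_mean_le[OF W]]]) simp
  have wd: "weight_deriv \<sigma> n (n + j) i v = (if i = j then ?\<rho> else 0) - (if i = Suc j then ?\<rho> else 0)"
    if "i \<in> {1..n}" for i
  proof -
    have "cdf_thr_deriv \<sigma> n (n + j) i v = (if i = j then ?\<rho> else 0)" for i
      using assms(4) by (cases "i = j") (simp_all add: cdf_thr_deriv_def)
    moreover have "i - 1 = j \<longleftrightarrow> i = Suc j" using that by auto
    ultimately show ?thesis unfolding weight_deriv_def by presburger
  qed
  have "(\<Sum>i=1..n. weight_deriv \<sigma> n (n + j) i v * ?G i
        + (if i = n + j then 1 else 0) * (weights_of \<sigma> (thr n v) i *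
            (\<integral>z. phi (z - v i) * (2 * (v i - ?h z) + (z - v i) * (v i - ?h z)\<^sup>2) \<partial>lborel)))
     = (\<Sum>i=1..n. (if i = j then ?\<rho> * ?G i else 0) - (if i = Suc j then ?\<rho> * ?G i else 0))"
    using assms(4) by (intro sum.cong refl) (simp add: wd)
  also have "\<dots> = ?\<rho> * (?G j - ?G (Suc j))"
    using assms(4) by (simp add: sum_subtractf right_diff_distrib)
  also have "\<dots> = estimation_grad_threshold \<sigma> n v j"
    unfolding estimation_grad_threshold_def Let_def using i[of j] i[of "Suc j"] by simp
  finally show "(\<Sum>i=1..n. weight_deriv \<sigma> n (n + j) i v * ?G i
        + (if i = n + j then 1 else 0) * (weights_of \<sigma> (thr n v) i *
            (\<integral>z. phi (z - v i) * (2 * (v i - ?h z) + (z - v i) * (v i - ?h z)\<^sup>2) \<partial>lborel)))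
     = estimation_grad_threshold \<sigma> n v j" .
qed

section \<open>The functional on laws with at most \<open>n\<close> points\<close>

lemma J_discrete_law:
  assumes "\<sigma> > 0" "thresholds_ok n \<zeta>" "mono_on {1..n} y"
  shows "J \<sigma> k (discrete_law n y (weights_of \<sigma> \<zeta>))
     = ereal (k\<^sup>2 * transport_cost \<sigma> n y \<zeta> + estimation_part n y (weights_of \<sigma> \<zeta>))"
  unfolding J_def wasserstein2_sq_eq[OF assms] mmse_discrete_law[OF weights_of_simplex[OF assms(1,2)]] by simp

lemma J_discrete_law_le:
  assumes "\<sigma> > 0" "thresholds_ok n \<zeta>"
  shows "J \<sigma> k (discrete_law n y (weights_of \<sigma> \<zeta>))
     \<le> ereal (k\<^sup>2 * transport_cost \<sigma> n y \<zeta> + estimation_part n y (weights_of \<sigma> \<zeta>))"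
proof -
  have "ereal (k\<^sup>2) * wasserstein2_sq (gauss \<sigma>) (discrete_law n y (weights_of \<sigma> \<zeta>))
     \<le> ereal (k\<^sup>2) * ereal (transport_cost \<sigma> n y \<zeta>)"
    by (intro ereal_mult_left_mono wasserstein2_sq_le_transport_cost assms) simp
  then show ?thesis
    unfolding J_def mmse_discrete_law[OF weights_of_simplex[OF assms]]
    by (simp flip: plus_ereal.simps(1) times_ereal.simps(1) add: add_right_mono)
qed

lemma discrete_law_at_most_points:
  assumes "w \<in> weight_simplex m" "m \<le> n"
  shows "discrete_law m y w \<in> at_most_points n"
proof -
  have "emeasure (discrete_law m y w) (- y ` {1..m}) = 0"
    by (subst emeasure_discrete_law) (auto simp: finite_imp_closed)
  moreover have "card (y ` {1..m}) \<le> n" using card_image_le[of "{1..m}" y] assms(2) by simp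
  ultimately show ?thesis
    using prob_space_discrete_law[OF assms(1)] by (auto simp: at_most_points_def intro!: exI[of _ "y ` {1..m}"])
qed

lemma discrete_law_of_finite_support:
  assumes "prob_space Q" "sets Q = sets borel" "finite S" "emeasure Q (- S) = 0"
  obtains y w where "y \<in> levels (card S)" "w \<in> weight_simplex (card S)" "Q = discrete_law (card S) y w"
    "y ` {1..card S} = S" "\<And>i. w i = measure Q {y i}"
proof -
  interpret prob_space Q by fact
  define m where "m = card S"
  \<comment> \<open>Levels are numbered from 1, list positions from 0.\<close>
  define y :: "nat \<Rightarrow> real" where "y i = sorted_list_of_set S ! (i - 1)" for i
  define w where "w i = measure Q {y i}" for i
  have len: "length (sorted_list_of_set S) = m" by (simp add: m_def)
  have y: "strict_mono_on {1..m} y"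
  proof (rule strict_mono_onI)
    fix i j assume "i \<in> {1..m}" "j \<in> {1..m}" "i < j"
    then show "y i < y j"
      unfolding y_def using strict_sorted_list_of_set[of S] len by (intro sorted_wrt_nth_less[of "(<)"]) auto
  qed
  then have inj: "inj_on y {1..m}" by (rule strict_mono_on_imp_inj_on)
  have im: "y ` {1..m} = S"
  proof -
    have "y ` {1..m} = (\<lambda>i. sorted_list_of_set S ! i) ` {..<m}"
      by (force simp: y_def image_iff intro: bexI[of _ "Suc _"])
    also have "\<dots> = set (sorted_list_of_set S)"
      using len by (auto simp: set_conv_nth)
    finally show ?thesis using assms(3) by simp
  qed
  have [measurable]: "B \<in> sets Q" if "finite B" for B
    using that assms(2) by (simp add: finite_imp_closed)
  have meas: "emeasure Q A = (\<Sum>i=1..m. ennreal (w i) * indicator A (y i))" if A: "A \<in> sets borel" for A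
  proof -
    have "emeasure Q A = emeasure Q (A \<inter> S)"
    proof (rule emeasure_eq_AE)
      have "AE x in Q. x \<notin> - S"
        using assms by (intro AE_not_in null_setsI) (auto simp: finite_imp_closed)
      then show "AE x in Q. x \<in> A \<longleftrightarrow> x \<in> A \<inter> S" by eventually_elim auto
    qed (use A assms in \<open>auto simp: finite_imp_closed\<close>)
    also have "\<dots> = (\<Sum>s\<in>A \<inter> S. emeasure Q {s})"
      using assms by (intro emeasure_eq_sum_singleton) auto
    also have "\<dots> = (\<Sum>s\<in>S. emeasure Q {s} * indicator A s)"
      using assms(3) by (intro sum.mono_neutral_cong_left) (auto simp: indicator_def)
    also have "\<dots> = (\<Sum>i=1..m. ennreal (w i) * indicator A (y i))"
      unfolding im[symmetric] by (subst sum.reindex[OF inj]) (simp add: w_def emeasure_eq_measure)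
    finally show ?thesis .
  qed
  have "(\<Sum>i=1..m. ennreal (w i)) = 1"
    using meas[of UNIV] emeasure_space_1 sets_eq_imp_space_eq[OF assms(2)] by simp
  moreover have "(\<Sum>i=1..m. ennreal (w i)) = ennreal (\<Sum>i=1..m. w i)"
    by (rule sum_ennreal) (simp add: w_def)
  ultimately have "(\<Sum>i=1..m. w i) = 1" by simp
  then have "w \<in> weight_simplex m" by (simp add: weight_simplex_def w_def)
  moreover have "Q = discrete_law m y w"
    using assms(2) by (intro measure_eqI) (auto simp: meas emeasure_discrete_law)
  ultimately show ?thesis using that[of y w] y im unfolding m_def by (auto simp: levels_def w_def)
qed

lemma levels_mono_on: "y \<in> levels n \<Longrightarrow> mono_on {1..n} y"
  unfolding levels_def by (auto intro: strict_mono_on_imp_mono_on)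

text \<open>The support is padded by arbitrary further reals to exactly \<open>n\<close> points.
  These receive weight zero, so every competitor is described by \<open>n\<close> levels and a point
  of the closed simplex.\<close>

lemma at_most_points_discrete_law:
  assumes "Q \<in> at_most_points n"
  obtains y w where "y \<in> levels n" "w \<in> weight_simplex n" "Q = discrete_law n y w"
proof -
  from assms obtain S where S: "prob_space Q" "sets Q = sets borel" "finite S" "card S \<le> n" "emeasure Q (- S) = 0"
    by (auto simp: at_most_points_def)
  have "infinite (- S)" using S(3) infinite_UNIV_char_0[where 'a = real] by (simp add: finite_compl)
  then obtain B where B: "finite B" "card B = n - card S" "B \<subseteq> - S"
    using infinite_arbitrarily_large by blast
  define T where "T = S \<union> B"
  have T: "S \<subseteq> T" "finite T" "card T = n"
    using B S(3,4) by (auto simp: T_def card_Un_disjoint disjoint_eq_subset_Compl inf_commute)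
  have "emeasure Q (- T) \<le> emeasure Q (- S)"
    using T(1) S(2,3) T(2) by (intro emeasure_mono) (auto simp: finite_imp_closed)
  then have "emeasure Q (- T) = 0" using S(5) by simp
  from discrete_law_of_finite_support[OF S(1,2) T(2) this] that T(3) show ?thesis by metis
qed

subsection \<open>Existence of a minimiser\<close>

text \<open>Subsequences are extracted one index at a time; in the compact extended line this works
  without any a priori bound on levels or thresholds.\<close>

lemma seq_compact_ereal_family:
  fixes X :: "nat \<Rightarrow> 'i \<Rightarrow> ereal"
  assumes "finite I"
  obtains r :: "nat \<Rightarrow> nat" where "strict_mono r" "\<And>i. i \<in> I \<Longrightarrow> \<exists>l. (\<lambda>k. X (r k) i) \<longlonglongrightarrow> l"
proof -
  have "\<exists>r::nat \<Rightarrow> nat. strict_mono r \<and> (\<forall>i\<in>I. \<exists>l. (\<lambda>k. X (r k) i) \<longlonglongrightarrow> l)"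
    using assms
  proof (induction I rule: finite_induct)
    case empty
    then show ?case by (auto intro: strict_mono_id)
  next
    case (insert j I)
    then obtain r :: "nat \<Rightarrow> nat" where r: "strict_mono r" "\<And>i. i \<in> I \<Longrightarrow> \<exists>l. (\<lambda>k. X (r k) i) \<longlonglongrightarrow> l"
      by blast
    obtain l s where s: "strict_mono s" "((\<lambda>k. X (r k) j) \<circ> s) \<longlonglongrightarrow> l"
      using compact_complete_linorder[of "\<lambda>k. X (r k) j"] by blast
    have "\<exists>l. (\<lambda>k. X ((r \<circ> s) k) i) \<longlonglongrightarrow> l" if "i \<in> insert j I" for i
    proof (cases "i = j")
      case True
      then show ?thesis using s(2) by (auto simp: comp_def)
    next
      case False
      then have "i \<in> I" using that by simp
      then obtain l' where "(\<lambda>k. X (r k) i) \<longlonglongrightarrow> l'" using r(2) by metis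
      from LIMSEQ_subseq_LIMSEQ[OF this s(1)] show ?thesis by (auto simp: comp_def)
    qed
    then show ?case using strict_mono_o[OF r(1) s(1)] by blast
  qed
  then show ?thesis using that by blast
qed

text \<open>Fatou's lemma with two sequences: pointwise convergence is known for the minorants
  \<open>u\<close>, convergence of integrals for the majorants \<open>g\<close>. The separation
  allows terms without a useful pointwise limit to be discarded first; \<open>t\<close> may be
  infinite.\<close>

lemma integral_le_of_liminf:
  fixes u :: "nat \<Rightarrow> 'a \<Rightarrow> real"
  assumes f: "integrable M f" "AE x in M. 0 \<le> f x"
    and u: "\<And>k. u k \<in> borel_measurable M" "\<And>k x. 0 \<le> u k x"
    and lim: "AE x in M. (\<lambda>k. u k x) \<longlonglongrightarrow> f x"
    and g: "\<And>k. integrable M (g k)" "\<And>k x. u k x \<le> g k x"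
    and t: "(\<lambda>k. ereal (\<integral>x. g k x \<partial>M)) \<longlonglongrightarrow> t"
  shows "ereal (\<integral>x. f x \<partial>M) \<le> t"
proof (rule ccontr)
  assume "\<not> ?thesis"
  \<comment> \<open>A real number strictly between the two sides keeps the whole chain of
    inequalities finite, even though \<open>t\<close> is extended.\<close>
  then obtain s where s: "t < ereal s" "ereal s < ereal (\<integral>x. f x \<partial>M)"
    using ereal_dense2[of t "ereal (\<integral>x. f x \<partial>M)"] unfolding not_le by blast
  have ev: "\<forall>\<^sub>F k in sequentially. (\<integral>x. g k x \<partial>M) < s"
    using order_tendstoD(2)[OF t s(1)] by simp
  have g0: "0 \<le> g k x" for k x using u(2) g(2) order_trans by blast
  have "ennreal (\<integral>x. f x \<partial>M) = (\<integral>\<^sup>+x. ennreal (f x) \<partial>M)"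
    by (rule nn_integral_eq_integral[symmetric]) (rule f)+
  also have "\<dots> = (\<integral>\<^sup>+x. liminf (\<lambda>k. ennreal (u k x)) \<partial>M)"
  proof (rule nn_integral_cong_AE)
    show "AE x in M. ennreal (f x) = liminf (\<lambda>k. ennreal (u k x))"
      using lim by eventually_elim (intro lim_imp_Liminf[symmetric] tendsto_ennrealI, auto)
  qed
  also have "\<dots> \<le> liminf (\<lambda>k. \<integral>\<^sup>+x. ennreal (u k x) \<partial>M)"
    using u(1) by (intro nn_integral_liminf) auto
  also have "\<dots> \<le> limsup (\<lambda>k. \<integral>\<^sup>+x. ennreal (u k x) \<partial>M)"
    by (rule Liminf_le_Limsup) simp
  also have "\<dots> \<le> ennreal s"
  proof (rule Limsup_bounded)
    show "\<forall>\<^sub>F k in sequentially. (\<integral>\<^sup>+x. ennreal (u k x) \<partial>M) \<le> ennreal s"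
      using ev
    proof eventually_elim
      case (elim k)
      have "(\<integral>\<^sup>+x. ennreal (u k x) \<partial>M) \<le> (\<integral>\<^sup>+x. ennreal (g k x) \<partial>M)"
        by (intro nn_integral_mono ennreal_leI g(2))
      also have "\<dots> = ennreal (\<integral>x. g k x \<partial>M)"
        using g(1) g0 by (intro nn_integral_eq_integral) auto
      also have "\<dots> \<le> ennreal s" using elim by (intro ennreal_leI) simp
      finally show ?case .
    qed
  qed
  finally have le: "ennreal (\<integral>x. f x \<partial>M) \<le> ennreal s" .
  obtain k where "(\<integral>x. g k x \<partial>M) < s" using eventually_happens[OF ev] by auto
  moreover have "0 \<le> (\<integral>x. g k x \<partial>M)" using g0 by simp
  ultimately have "0 \<le> s" by linarith
  then show False using le s(2) by (simp add: ennreal_le_iff)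
qed

lemma AE_gauss_neq: "\<sigma> > 0 \<Longrightarrow> AE x in gauss \<sigma>. x \<noteq> c"
  using AE_not_in[of "{c}" "gauss \<sigma>"] gauss_singleton[of \<sigma> c] by (auto simp: null_sets_def)

lemma thresholds_ok_tendsto:
  assumes "\<And>k. thresholds_ok n (\<zeta>s k)" "\<And>i. i \<le> n \<Longrightarrow> (\<lambda>k. \<zeta>s k i) \<longlonglongrightarrow> \<zeta> i"
  shows "thresholds_ok n \<zeta>"
proof -
  have "\<zeta> 0 = - \<infinity>" "\<zeta> n = \<infinity>"
    using assms(2)[of 0] assms(2)[of n] assms(1) by (simp_all add: thresholds_ok_def LIMSEQ_const_iff)
  moreover have "\<zeta> i \<le> \<zeta> j" if "i \<le> j" "j \<le> n" for i j
    using that by (intro LIMSEQ_le[OF assms(2) assms(2)]) (auto intro: thresholds_ok_mono[OF assms(1)])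
  ultimately show ?thesis by (simp add: thresholds_ok_def)
qed

lemma tendsto_weights_of:
  assumes "\<sigma> > 0" "\<And>i. i \<le> n \<Longrightarrow> (\<lambda>k. \<zeta>s k i) \<longlonglongrightarrow> \<zeta> i" "i \<le> n"
  shows "(\<lambda>k. weights_of \<sigma> (\<zeta>s k) i) \<longlonglongrightarrow> weights_of \<sigma> \<zeta> i"
proof -
  have "(\<lambda>k. cdf_ext \<sigma> (\<zeta>s k i)) \<longlonglongrightarrow> cdf_ext \<sigma> (\<zeta> i)" if "i \<le> n" for i
    by (rule filterlim_compose[OF tendsto_cdf_ext[OF assms(1)] assms(2)[OF that]])
  then show ?thesis unfolding weights_of_def using assms(3) by (intro tendsto_diff) auto
qed

text \<open>Coercivity: by \<open>c^2 \<le> 2 * x^2 + 2 * (x - c)^2\<close>, a bounded transport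
  cost bounds the second moment of the law.\<close>

lemma second_moment_le:
  assumes "\<sigma> > 0" "thresholds_ok n \<zeta>"
  shows "(\<Sum>i=1..n. weights_of \<sigma> \<zeta> i * (y i)\<^sup>2) \<le> 2 * \<sigma>\<^sup>2 + 2 * transport_cost \<sigma> n y \<zeta>"
proof -
  note T = transport_cost_integral[OF assms, of y]
  have "(\<integral>x. (controller n y \<zeta> x)\<^sup>2 \<partial>gauss \<sigma>) \<le> (\<integral>x. 2 * x\<^sup>2 + 2 * (x - controller n y \<zeta> x)\<^sup>2 \<partial>gauss \<sigma>)"
  proof (rule integral_mono)
    fix x
    have "0 \<le> (2 * x - controller n y \<zeta> x)\<^sup>2" by simp
    then show "(controller n y \<zeta> x)\<^sup>2 \<le> 2 * x\<^sup>2 + 2 * (x - controller n y \<zeta> x)\<^sup>2"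
      by (simp add: power2_eq_square algebra_simps)
  qed (use T integrable_gauss_sq[OF assms(1)] in auto)
  then show ?thesis
    using T integrable_gauss_sq[OF assms(1)] integral_gauss_sq[OF assms(1)] by simp
qed

text \<open>A level tending to infinity while its weight stays bounded below would make the second
  moment unbounded.\<close>

lemma weight_escaping_level:
  assumes "\<sigma> > 0" "\<And>k. thresholds_ok n (\<zeta>s k)" "\<And>i. i \<le> n \<Longrightarrow> (\<lambda>k. \<zeta>s k i) \<longlonglongrightarrow> \<zeta> i"
    and "\<And>k. transport_cost \<sigma> n (ys k) (\<zeta>s k) \<le> c"
    and i: "i \<in> {1..n}" "(\<lambda>k. ereal (ys k i)) \<longlonglongrightarrow> \<eta>" "\<bar>\<eta>\<bar> = \<infinity>"
  shows "weights_of \<sigma> \<zeta> i = 0"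
proof (rule ccontr)
  let ?W = "\<lambda>k. weights_of \<sigma> (\<zeta>s k)"
  assume "weights_of \<sigma> \<zeta> i \<noteq> 0"
  moreover have "thresholds_ok n \<zeta>" by (rule thresholds_ok_tendsto[OF assms(2,3)])
  then have "0 \<le> weights_of \<sigma> \<zeta> i"
    using weights_of_simplex[OF assms(1)] i(1) by (auto simp: weight_simplex_def)
  ultimately have pos: "0 < weights_of \<sigma> \<zeta> i" by simp
  define b where "b = weights_of \<sigma> \<zeta> i / 2"
  have b: "0 < b" using pos by (simp add: b_def)
  have ev1: "\<forall>\<^sub>F k in sequentially. b < ?W k i"
    using tendsto_weights_of[of \<sigma> n \<zeta>s \<zeta>, OF assms(1,3), of i] i(1) pos by (intro order_tendstoD(1)) (auto simp: b_def)
  \<comment> \<open>Chosen so that \<open>r * b\<close> exceeds the second-moment bound by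
    \<open>b\<close>; the summand 1 also ensures \<open>r \<le> r\<^sup>2\<close>.\<close>
  define r where "r = \<bar>2 * \<sigma>\<^sup>2 + 2 * c\<bar> / b + 1"
  have r1: "1 \<le> r" using b by (simp add: r_def)
  have ev2: "\<forall>\<^sub>F k in sequentially. r < \<bar>ys k i\<bar>"
  proof (cases \<eta>)
    case PInf
    then have "\<forall>\<^sub>F k in sequentially. ereal r < ereal (ys k i)" using i(2) by (simp only: tendsto_PInfty)
    then show ?thesis by eventually_elim auto
  next
    case MInf
    then have "\<forall>\<^sub>F k in sequentially. ereal (ys k i) < ereal (- r)" using i(2) by (simp only: tendsto_MInfty)
    then show ?thesis by eventually_elim auto
  qed (use i(3) in auto)
  obtain k where k: "b < ?W k i" "r < \<bar>ys k i\<bar>"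
    using eventually_happens[OF eventually_conj[OF ev1 ev2]] by auto
  have nn: "0 \<le> ?W k j" if "j \<in> {1..n}" for j
    using weights_of_simplex[OF assms(1,2), of k] that by (auto simp: weight_simplex_def)
  have "r \<le> r\<^sup>2" using r1 by (simp add: power2_eq_square)
  also have "r\<^sup>2 \<le> (ys k i)\<^sup>2" using power_mono[of r "\<bar>ys k i\<bar>" 2] k(2) r1 by simp
  finally have "r * b \<le> (ys k i)\<^sup>2 * ?W k i" using k b by (intro mult_mono) auto
  also have "\<dots> \<le> (\<Sum>j=1..n. (ys k j)\<^sup>2 * ?W k j)"
    using i(1) nn by (intro member_le_sum) auto
  also have "\<dots> \<le> 2 * \<sigma>\<^sup>2 + 2 * c"
    using second_moment_le[OF assms(1,2), of k "ys k"] assms(4)[of k] by (simp add: mult.commute)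
  finally have "r * b \<le> \<bar>2 * \<sigma>\<^sup>2 + 2 * c\<bar>" by linarith
  moreover have "r * b = \<bar>2 * \<sigma>\<^sup>2 + 2 * c\<bar> + b" using b by (simp add: r_def field_simps)
  ultimately show False using b by linarith
qed

text \<open>Levels may escape to \<open>\<plusminus>\<infinity>\<close>; \<open>real_of_ereal\<close> then returns the junk value 0, which is harmless because
  such levels carry no weight in the limit.\<close>

lemma transport_cost_lower_semicontinuous:
  assumes "\<sigma> > 0" "\<And>k. thresholds_ok n (\<zeta>s k)" "\<And>i. i \<le> n \<Longrightarrow> (\<lambda>k. \<zeta>s k i) \<longlonglongrightarrow> \<zeta> i"
    and \<eta>: "\<And>i. i \<in> {1..n} \<Longrightarrow> (\<lambda>k. ereal (ys k i)) \<longlonglongrightarrow> \<eta> i"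
    and W0: "\<And>i. i \<in> {1..n} \<Longrightarrow> \<bar>\<eta> i\<bar> = \<infinity> \<Longrightarrow> weights_of \<sigma> \<zeta> i = 0"
    and t: "(\<lambda>k. ereal (transport_cost \<sigma> n (ys k) (\<zeta>s k))) \<longlonglongrightarrow> t"
  shows "ereal (transport_cost \<sigma> n (\<lambda>i. real_of_ereal (\<eta> i)) \<zeta>) \<le> t"
proof -
  let ?y = "\<lambda>i. real_of_ereal (\<eta> i)"
  interpret prob_space "gauss \<sigma>" by (rule prob_space_gauss) fact
  have ok: "thresholds_ok n \<zeta>" by (rule thresholds_ok_tendsto[OF assms(2,3)])
  let ?u = "\<lambda>k x. (x - controller n (ys k) (\<zeta>s k) x)\<^sup>2"
  have "AE x in gauss \<sigma>. \<forall>i\<in>{1..n}. x \<noteq> real_of_ereal (\<zeta> i)"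
    by (rule AE_finite_allI) (auto intro: AE_gauss_neq[OF assms(1)])
  moreover have "AE x in gauss \<sigma>. \<forall>i\<in>{1..n}. \<bar>\<eta> i\<bar> = \<infinity> \<longrightarrow> x \<notin> bin \<zeta> i"
  proof (rule AE_finite_allI)
    fix i assume i: "i \<in> {1..n}"
    show "AE x in gauss \<sigma>. \<bar>\<eta> i\<bar> = \<infinity> \<longrightarrow> x \<notin> bin \<zeta> i"
    proof (cases "\<bar>\<eta> i\<bar> = \<infinity>")
      case True
      then have "measure (gauss \<sigma>) (bin \<zeta> i) = 0"
        using W0[OF i] weights_of_eq_measure[OF assms(1), of \<zeta> i] thresholds_ok_mono[OF ok, of "i - 1" i] i by simp
      then have "AE x in gauss \<sigma>. x \<notin> bin \<zeta> i"
        by (intro AE_not_in null_setsI) (auto simp: emeasure_eq_measure)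
      then show ?thesis by eventually_elim simp
    qed simp
  qed simp
  ultimately have lim: "AE x in gauss \<sigma>. (\<lambda>k. ?u k x) \<longlonglongrightarrow> (x - controller n ?y \<zeta> x)\<^sup>2"
  proof eventually_elim
    case (elim x)
    obtain i where i: "i \<in> {1..n}" "x \<in> bin \<zeta> i" using bin_exists[OF ok, of x] .
    have fin: "\<bar>\<eta> i\<bar> \<noteq> \<infinity>" using elim i by auto
    \<comment> \<open>Almost every \<open>x\<close> lies in the interior of its limiting bin and
      therefore in the bin with the same index for all late \<open>k\<close>; this gives pointwise
      convergence of the controllers.\<close>
    have lt: "\<zeta> (i - 1) < ereal x" "ereal x < \<zeta> i"
      using i elim(1) unfolding bin_def order_less_le by (auto, metis One_nat_def atLeastAtMost_iff real_of_ereal.simps(1))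
    have "\<forall>\<^sub>F k in sequentially. \<zeta>s k (i - 1) < ereal x"
      using i(1) by (intro order_tendstoD(2)[OF assms(3) lt(1)]) auto
    moreover have "\<forall>\<^sub>F k in sequentially. ereal x < \<zeta>s k i"
      using i(1) by (intro order_tendstoD(1)[OF assms(3) lt(2)]) auto
    ultimately have "\<forall>\<^sub>F k in sequentially. ys k i = controller n (ys k) (\<zeta>s k) x"
    proof eventually_elim
      case (elim k)
      then have "x \<in> bin (\<zeta>s k) i" by (simp add: bin_def)
      from controller_eq[OF assms(2) i(1) this] show ?case by simp
    qed
    moreover have "(\<lambda>k. ys k i) \<longlonglongrightarrow> ?y i"
      using \<eta>[OF i(1)] fin by (metis ereal_real' lim_ereal)
    ultimately have "(\<lambda>k. controller n (ys k) (\<zeta>s k) x) \<longlonglongrightarrow> ?y i"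
      by (rule Lim_transform_eventually[rotated])
    then show ?case unfolding controller_eq[OF ok i] by (intro tendsto_intros)
  qed
  show ?thesis
    unfolding transport_cost_integral(1)[OF assms(1) ok]
  proof (rule integral_le_of_liminf[OF transport_cost_integral(2)[OF assms(1) ok] _ _ _ lim])
    show "(\<lambda>k. ereal (\<integral>x. ?u k x \<partial>gauss \<sigma>)) \<longlonglongrightarrow> t"
      using t by (simp only: transport_cost_integral(1)[OF assms(1,2)])
  qed (auto intro: transport_cost_integral(2)[OF assms(1,2)])
qed

lemma phi_le_1: "phi x \<le> 1"
proof -
  have "1 \<le> sqrt (2 * pi)" using pi_ge_two by (intro real_le_rsqrt) simp
  moreover have "exp (- x\<^sup>2 / 2) \<le> 1" by simp
  ultimately have "exp (- x\<^sup>2 / 2) \<le> sqrt (2 * pi)" by (rule order_trans[rotated])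
  then show ?thesis by (simp add: std_normal_density_def divide_le_eq)
qed

lemma abs_mult_phi_le_1: "\<bar>x\<bar> * phi x \<le> 1"
proof -
  have "1 \<le> sqrt (2 * pi)" using pi_ge_two by (intro real_le_rsqrt) simp
  moreover have "\<bar>x\<bar> * exp (- x\<^sup>2 / 2) \<le> 1"
  proof -
    have "0 \<le> (\<bar>x\<bar> - 1)\<^sup>2" by simp
    then have "\<bar>x\<bar> \<le> 1 + x\<^sup>2 / 2" unfolding power2_diff power2_abs by simp
    also have "\<dots> \<le> exp (x\<^sup>2 / 2)" by (rule exp_ge_add_one_self)
    finally have "\<bar>x\<bar> * exp (- (x\<^sup>2 / 2)) \<le> exp (x\<^sup>2 / 2) * exp (- (x\<^sup>2 / 2))" by (intro mult_right_mono) auto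
    then show ?thesis by (simp flip: exp_add)
  qed
  ultimately have "\<bar>x\<bar> * exp (- x\<^sup>2 / 2) \<le> sqrt (2 * pi)" by (rule order_trans[rotated])
  then show ?thesis by (simp add: std_normal_density_def divide_le_eq)
qed

text \<open>By \<open>\<bar>y\<bar> \<le> \<bar>z\<bar> + \<bar>z - y\<bar>\<close>. The bound is
  uniform in \<open>y\<close>, so the contribution of an escaping level to \<open>mix_num\<close>
  vanishes together with its weight.\<close>

lemma abs_level_phi_le: "\<bar>y\<bar> * phi (z - y) \<le> \<bar>z\<bar> + 1"
proof -
  have "\<bar>y\<bar> * phi (z - y) \<le> (\<bar>z\<bar> + \<bar>z - y\<bar>) * phi (z - y)" by (intro mult_right_mono) auto
  also have "\<dots> \<le> \<bar>z\<bar> * 1 + 1"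
    unfolding distrib_right by (intro add_mono mult_left_mono phi_le_1 abs_mult_phi_le_1) auto
  finally show ?thesis by simp
qed

lemma isCont_phi: "isCont phi x"
  by (rule DERIV_isCont[OF has_real_derivative_normal_density]) simp

text \<open>Both mixtures converge pointwise, hence so does the posterior mean, whose denominator
  stays positive in the limit. The summands of escaping levels are dropped beforehand, which by
  nonnegativity only lowers the integrals.\<close>

lemma estimation_part_lower_semicontinuous:
  assumes ws: "\<And>k. ws k \<in> weight_simplex n" and w: "w \<in> weight_simplex n"
    and lw: "\<And>i. i \<in> {1..n} \<Longrightarrow> (\<lambda>k. ws k i) \<longlonglongrightarrow> w i"
    and \<eta>: "\<And>i. i \<in> {1..n} \<Longrightarrow> (\<lambda>k. ereal (ys k i)) \<longlonglongrightarrow> \<eta> i"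
    and W0: "\<And>i. i \<in> {1..n} \<Longrightarrow> \<bar>\<eta> i\<bar> = \<infinity> \<Longrightarrow> w i = 0"
    and t: "(\<lambda>k. ereal (estimation_part n (ys k) (ws k))) \<longlonglongrightarrow> t"
  shows "ereal (estimation_part n (\<lambda>i. real_of_ereal (\<eta> i)) w) \<le> t"
proof -
  let ?y = "\<lambda>i. real_of_ereal (\<eta> i)"
  let ?S = "{i\<in>{1..n}. \<bar>\<eta> i\<bar> \<noteq> \<infinity>}"
  let ?g = "\<lambda>k z. \<Sum>i=1..n. ws k i * (phi (z - ys k i) * (ys k i - post_mean n (ys k) (ws k) z)\<^sup>2)"
  let ?u = "\<lambda>k z. \<Sum>i\<in>?S. ws k i * (phi (z - ys k i) * (ys k i - post_mean n (ys k) (ws k) z)\<^sup>2)"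
  let ?f = "\<lambda>z. \<Sum>i=1..n. w i * (phi (z - ?y i) * (?y i - post_mean n ?y w z)\<^sup>2)"
  have nn: "0 \<le> ws k i" if "i \<in> {1..n}" for k i using ws[of k] that by (simp add: weight_simplex_def)
  have nn': "0 \<le> w i" if "i \<in> {1..n}" for i using w that by (simp add: weight_simplex_def)
  have ly: "(\<lambda>k. ys k i) \<longlonglongrightarrow> ?y i" if "i \<in> ?S" for i
  proof -
    have "(\<lambda>k. ereal (ys k i)) \<longlonglongrightarrow> ereal (?y i)" using \<eta>[of i] that by (simp add: ereal_real')
    then show ?thesis by (simp only: lim_ereal)
  qed
  have lphi: "(\<lambda>k. phi (z - ys k i)) \<longlonglongrightarrow> phi (z - ?y i)" if "i \<in> ?S" for i z
    by (rule isCont_tendsto_compose[OF isCont_phi]) (intro tendsto_intros ly[OF that])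
  have zero: "(\<lambda>k. ws k i * b k) \<longlonglongrightarrow> 0" if "i \<in> {1..n}" "i \<notin> ?S" "\<And>k. \<bar>b k\<bar> \<le> C" for i b C
  proof (rule Lim_null_comparison)
    show "\<forall>\<^sub>F k in sequentially. norm (ws k i * b k) \<le> ws k i * C"
      using nn[OF that(1)] that(3) by (intro always_eventually allI) (simp add: abs_mult mult_left_mono)
    have "w i = 0" using W0[OF that(1)] that(1,2) by simp
    then show "(\<lambda>k. ws k i * C) \<longlonglongrightarrow> 0" using tendsto_mult_left_zero[of "\<lambda>k. ws k i" sequentially C] lw[OF that(1)] by simp
  qed
  have ldens: "(\<lambda>k. mix_dens n (ys k) (ws k) z) \<longlonglongrightarrow> mix_dens n ?y w z" for z
    unfolding mix_dens_def
  proof (rule tendsto_sum)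
    fix i assume i: "i \<in> {1..n}"
    show "(\<lambda>k. ws k i * phi (z - ys k i)) \<longlonglongrightarrow> w i * phi (z - ?y i)"
    proof (cases "i \<in> ?S")
      case True
      then show ?thesis by (intro tendsto_intros lw lphi i)
    next
      case False
      then have "w i = 0" using W0[OF i] i by simp
      then show ?thesis using zero[OF i False, of "\<lambda>k. phi (z - ys k i)" 1] phi_le_1 by simp
    qed
  qed
  have lnum: "(\<lambda>k. mix_num n (ys k) (ws k) z) \<longlonglongrightarrow> mix_num n ?y w z" for z
    unfolding mix_num_def
  proof (rule tendsto_sum)
    fix i assume i: "i \<in> {1..n}"
    show "(\<lambda>k. ws k i * ys k i * phi (z - ys k i)) \<longlonglongrightarrow> w i * ?y i * phi (z - ?y i)"
    proof (cases "i \<in> ?S")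
      case True
      then show ?thesis by (intro tendsto_intros lw lphi ly i)
    next
      case False
      then have "w i = 0" using W0[OF i] i by simp
      then show ?thesis
        using zero[OF i False, of "\<lambda>k. ys k i * phi (z - ys k i)" "\<bar>z\<bar> + 1"] abs_level_phi_le
        by (simp add: abs_mult mult.assoc)
    qed
  qed
  have lim: "(\<lambda>k. ?u k z) \<longlonglongrightarrow> ?f z" for z
  proof -
    have "mix_dens n ?y w z \<noteq> 0" using mix_dens_pos[OF w, of ?y z] by simp
    then have "(\<lambda>k. post_mean n (ys k) (ws k) z) \<longlonglongrightarrow> post_mean n ?y w z"
      unfolding post_mean_def by (intro tendsto_divide lnum ldens)
    then have "(\<lambda>k. ?u k z) \<longlonglongrightarrow> (\<Sum>i\<in>?S. w i * (phi (z - ?y i) * (?y i - post_mean n ?y w z)\<^sup>2))"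
      by (intro tendsto_sum tendsto_mult tendsto_power tendsto_diff lw lphi ly) auto
    also have "(\<Sum>i\<in>?S. w i * (phi (z - ?y i) * (?y i - post_mean n ?y w z)\<^sup>2)) = ?f z"
      using W0 by (intro sum.mono_neutral_left) auto
    finally show ?thesis .
  qed
  show ?thesis
    unfolding estimation_part_integral(1)[OF w]
  proof (rule integral_le_of_liminf[OF estimation_part_integral(2)[OF w]])
    show "AE z in lborel. 0 \<le> ?f z" using nn' by (intro AE_I2 sum_nonneg) auto
    show "?u k \<in> borel_measurable lborel" for k by measurable
    show "0 \<le> ?u k z" for k z using nn by (intro sum_nonneg) auto
    show "AE z in lborel. (\<lambda>k. ?u k z) \<longlonglongrightarrow> ?f z" using lim by simp
    show "integrable lborel (?g k)" for k by (rule estimation_part_integral(2)[OF ws])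
    show "?u k z \<le> ?g k z" for k z using nn by (intro sum_mono2) auto
    show "(\<lambda>k. ereal (\<integral>z. ?g k z \<partial>lborel)) \<longlonglongrightarrow> t"
      using t by (simp only: estimation_part_integral(1)[OF ws])
  qed
qed

lemma transport_cost_nonneg:
  assumes "\<sigma> > 0" "thresholds_ok n \<zeta>"
  shows "0 \<le> transport_cost \<sigma> n y \<zeta>"
  unfolding transport_cost_integral(1)[OF assms] by simp

lemma J_star_attained:
  assumes "\<sigma> > 0" "k > 0" "1 \<le> n"
  obtains Q where "Q \<in> at_most_points n" "J \<sigma> k Q = J_star \<sigma> k n"
proof -
  have "discrete_law 1 (\<lambda>_. 0) (\<lambda>_. 1) \<in> at_most_points n"
    using assms(3) by (intro discrete_law_at_most_points) (auto simp: weight_simplex_def)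
  then have "J \<sigma> k ` at_most_points n \<noteq> {}" by blast
  from Inf_countable_INF[OF this] obtain f where f: "decseq f" "range f \<subseteq> J \<sigma> k ` at_most_points n"
    "J_star \<sigma> k n = (INF i. f i)" unfolding J_star_def by blast
  have limf: "f \<longlonglongrightarrow> J_star \<sigma> k n" unfolding f(3) by (rule LIMSEQ_INF[OF f(1)])
  have "\<exists>y w. y \<in> levels n \<and> w \<in> weight_simplex n \<and> f m = J \<sigma> k (discrete_law n y w)" for m
  proof -
    obtain Q where Q: "Q \<in> at_most_points n" "f m = J \<sigma> k Q" using f(2) by blast
    show ?thesis using at_most_points_discrete_law[OF Q(1)] Q(2) by metis
  qed
  then obtain Y V where Y: "\<And>m. Y m \<in> levels n" and V: "\<And>m. V m \<in> weight_simplex n"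
    and fm: "\<And>m. f m = J \<sigma> k (discrete_law n (Y m) (V m))" by metis
  define Z where "Z m = thresholds_of \<sigma> (V m)" for m
  have ok: "thresholds_ok n (Z m)" for m unfolding Z_def by (rule thresholds_of_ok[OF assms(1) V])
  let ?T = "\<lambda>m. transport_cost \<sigma> n (Y m) (Z m)" and ?E = "\<lambda>m. estimation_part n (Y m) (weights_of \<sigma> (Z m))"
  have fTE: "f m = ereal (k\<^sup>2 * ?T m + ?E m)" for m
  proof -
    have "discrete_law n (Y m) (V m) = discrete_law n (Y m) (weights_of \<sigma> (Z m))"
      unfolding Z_def by (rule discrete_law_cong) (simp add: weights_of_thresholds_of[OF assms(1) V])
    then show ?thesis unfolding fm using J_discrete_law[OF assms(1) ok levels_mono_on[OF Y]] by simp
  qed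
  have T0: "0 \<le> ?T m" for m by (rule transport_cost_nonneg[OF assms(1) ok])
  have E0: "0 \<le> ?E m" for m by (rule estimation_part_nonneg[OF weights_of_simplex[OF assms(1) ok]])
  \<comment> \<open>The values decrease and the estimation part is nonnegative, so
    \<open>k > 0\<close> yields the uniform transport bound that escaping levels require.\<close>
  have Tc: "?T m \<le> (k\<^sup>2 * ?T 0 + ?E 0) / k\<^sup>2" for m
  proof -
    have "f m \<le> f 0" using f(1) by (simp add: decseq_def)
    then have "k\<^sup>2 * ?T m + ?E m \<le> k\<^sup>2 * ?T 0 + ?E 0" by (simp add: fTE)
    then have "k\<^sup>2 * ?T m \<le> k\<^sup>2 * ?T 0 + ?E 0" using E0[of m] by linarith
    then show ?thesis using assms(2) by (simp add: pos_le_divide_eq mult.commute)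
  qed
  \<comment> \<open>Thresholds, levels and both parts of the objective are coded into one finite
    family, tagged 0 to 3, so that a single subsequence makes all of them converge and the two
    semicontinuity bounds can be added.\<close>
  define X where "X m p = (case p of (a, i) \<Rightarrow> if a = (0::nat) then Z m i else if a = 1 then ereal (Y m i)
     else if a = 2 then ereal (?T m) else ereal (?E m))" for m p
  obtain r where r: "strict_mono r" "\<And>p. p \<in> {0..3} \<times> {0..n} \<Longrightarrow> \<exists>l. (\<lambda>m. X (r m) p) \<longlonglongrightarrow> l"
    using seq_compact_ereal_family[of "{0..3} \<times> {0..n}" X] by auto
  have "\<exists>l. (\<lambda>m. Z (r m) i) \<longlonglongrightarrow> l" if "i \<le> n" for i
    using r(2)[of "(0, i)"] that by (simp add: X_def)
  then obtain \<zeta> where \<zeta>: "\<And>i. i \<le> n \<Longrightarrow> (\<lambda>m. Z (r m) i) \<longlonglongrightarrow> \<zeta> i" by metis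
  have "\<exists>l. (\<lambda>m. ereal (Y (r m) i)) \<longlonglongrightarrow> l" if "i \<le> n" for i
    using r(2)[of "(1, i)"] that by (simp add: X_def)
  then obtain \<eta> where \<eta>: "\<And>i. i \<le> n \<Longrightarrow> (\<lambda>m. ereal (Y (r m) i)) \<longlonglongrightarrow> \<eta> i" by metis
  obtain t where t: "(\<lambda>m. ereal (?T (r m))) \<longlonglongrightarrow> t"
    using r(2)[of "(2, 0)"] by (auto simp: X_def)
  obtain e where e: "(\<lambda>m. ereal (?E (r m))) \<longlonglongrightarrow> e"
    using r(2)[of "(3, 0)"] by (auto simp: X_def)
  let ?y = "\<lambda>i. real_of_ereal (\<eta> i)" and ?w = "weights_of \<sigma> \<zeta>"
  have ok\<zeta>: "thresholds_ok n \<zeta>" by (rule thresholds_ok_tendsto[OF ok \<zeta>])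
  have W0: "?w i = 0" if "i \<in> {1..n}" "\<bar>\<eta> i\<bar> = \<infinity>" for i
    using that by (intro weight_escaping_level[OF assms(1) ok \<zeta> Tc _ \<eta>]) auto
  have lt: "ereal (transport_cost \<sigma> n ?y \<zeta>) \<le> t"
    by (rule transport_cost_lower_semicontinuous[OF assms(1) ok \<zeta> \<eta> W0 t]) auto
  have le: "ereal (estimation_part n ?y ?w) \<le> e"
    by (rule estimation_part_lower_semicontinuous[OF weights_of_simplex[OF assms(1) ok]
          weights_of_simplex[OF assms(1) ok\<zeta>] tendsto_weights_of[OF assms(1) \<zeta>] \<eta> W0 e]) auto
  have sum: "(\<lambda>m. ereal (k\<^sup>2) * ereal (?T (r m)) + ereal (?E (r m))) \<longlonglongrightarrow> ereal (k\<^sup>2) * t + e"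
  proof (intro tendsto_add_ereal_nonneg tendsto_cmult_ereal t e)
    have "0 \<le> t" "0 \<le> e"
      using LIMSEQ_le_const[OF t, of 0] LIMSEQ_le_const[OF e, of 0] T0 E0 by auto
    then show "ereal (k\<^sup>2) * t \<noteq> - \<infinity>" "e \<noteq> - \<infinity>" by (cases t; cases e; auto)+
  qed simp_all
  have "(\<lambda>m. f (r m)) \<longlonglongrightarrow> J_star \<sigma> k n" using LIMSEQ_subseq_LIMSEQ[OF limf r(1)] by (simp add: comp_def)
  then have J: "J_star \<sigma> k n = ereal (k\<^sup>2) * t + e"
    using sum unfolding fTE by (intro LIMSEQ_unique[of "\<lambda>m. f (r m)"]) (simp_all add: fTE)
  let ?Q = "discrete_law n ?y ?w"
  have Q: "?Q \<in> at_most_points n"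
    by (rule discrete_law_at_most_points[OF weights_of_simplex[OF assms(1) ok\<zeta>]]) simp
  \<comment> \<open>The limiting levels may be out of order, since escaped ones were replaced by 0;
    the upper bound by the graph coupling still applies to them.\<close>
  have "J \<sigma> k ?Q \<le> ereal (k\<^sup>2) * ereal (transport_cost \<sigma> n ?y \<zeta>) + ereal (estimation_part n ?y ?w)"
    using J_discrete_law_le[OF assms(1) ok\<zeta>] by simp
  also have "\<dots> \<le> ereal (k\<^sup>2) * t + e"
    by (intro add_mono ereal_mult_left_mono lt le) simp
  finally have "J \<sigma> k ?Q \<le> J_star \<sigma> k n" unfolding J .
  moreover have "J_star \<sigma> k n \<le> J \<sigma> k ?Q" unfolding J_star_def by (rule INF_lower[OF Q])
  ultimately show ?thesis using that[OF Q] by simp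
qed

section \<open>From a minimising law to strictly increasing levels and thresholds\<close>

lemma J_prog_objective:
  assumes "\<sigma> > 0" "1 \<le> n" "v \<in> threshold_domain n" "mono_on {1..n} v"
  shows "J \<sigma> k (discrete_law n v (weights_of \<sigma> (thr n v))) = ereal (prog_objective \<sigma> k n v)"
  using J_discrete_law[OF assms(1) thr_ok[OF assms(2,3)] assms(4)] prog_objective_eq[OF assms(1-3)]
  by (simp add: prog_estimation_def)

lemma J_star_le_prog_objective:
  assumes "\<sigma> > 0" "1 \<le> m" "m \<le> n" "v \<in> threshold_domain m" "mono_on {1..m} v"
  shows "J_star \<sigma> k n \<le> ereal (prog_objective \<sigma> k m v)"
proof -
  have "discrete_law m v (weights_of \<sigma> (thr m v)) \<in> at_most_points n"
    using assms by (intro discrete_law_at_most_points weights_of_simplex thr_ok) auto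
  then show ?thesis
    unfolding J_star_def J_prog_objective[OF assms(1,2,4,5), symmetric] by (rule INF_lower)
qed

text \<open>Positive weights separate consecutive thresholds. The inner ones then lie strictly
  between \<open>- \<infinity>\<close> and \<open>\<infinity>\<close>, so they are finite and can be
  packed as real coordinates.\<close>

lemma prog_domain_of_positive_weights:
  assumes "\<sigma> > 0" "y \<in> levels m" and w: "w \<in> weight_simplex m" and pos: "\<And>i. i \<in> {1..m} \<Longrightarrow> 0 < w i"
  obtains v where "v \<in> prog_domain m" "discrete_law m v (weights_of \<sigma> (thr m v)) = discrete_law m y w"
proof -
  define \<zeta> where "\<zeta> = thresholds_of \<sigma> w"
  have ok: "thresholds_ok m \<zeta>" unfolding \<zeta>_def by (rule thresholds_of_ok[OF assms(1) w])
  have Suc: "\<zeta> i < \<zeta> (Suc i)" if "i < m" for i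
  proof -
    have "cdf_ext \<sigma> (\<zeta> i) < cdf_ext \<sigma> (\<zeta> (Suc i))"
      using that pos[of "Suc i"] by (simp add: \<zeta>_def cdf_ext_thresholds_of[OF assms(1) w])
    then show ?thesis by (simp add: cdf_ext_less_iff[OF assms(1)])
  qed
  have strict: "\<zeta> i < \<zeta> j" if "i < j" "j \<le> m" for i j
    using less_le_trans[OF Suc[of i] thresholds_ok_mono[OF ok, of "Suc i" j]] that by simp
  have fin: "\<bar>\<zeta> i\<bar> \<noteq> \<infinity>" if "i \<in> {1..<m}" for i
    using strict[of 0 i] strict[of i m] that ok by (auto simp: thresholds_ok_def)
  define v where "v i = (if i \<le> m then y i else real_of_ereal (\<zeta> (i - m)))" for i
  have thr: "thr m v i = \<zeta> i" if "i \<le> m" for i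
    using that fin[of i] ok by (auto simp: thr_def v_def thresholds_ok_def ereal_real')
  have "strict_mono_on {1..<m} (\<lambda>i. v (m + i))"
  proof (rule strict_mono_onI)
    fix i j assume ij: "i \<in> {1..<m}" "j \<in> {1..<m}" "i < j"
    then have "ereal (v (m + i)) < ereal (v (m + j))"
      using strict[of i j] thr[of i] thr[of j] by (auto simp: thr_def)
    then show "v (m + i) < v (m + j)" by simp
  qed
  moreover have "strict_mono_on {1..m} v"
    using assms(2) by (auto simp: levels_def strict_mono_on_def v_def)
  ultimately have "v \<in> prog_domain m" by (simp add: prog_domain_def)
  moreover have "discrete_law m v (weights_of \<sigma> (thr m v)) = discrete_law m y w"
  proof -
    have "weights_of \<sigma> (thr m v) i = w i" if "i \<in> {1..m}" for i
    proof -
      have "weights_of \<sigma> (thr m v) i = weights_of \<sigma> \<zeta> i"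
        unfolding weights_of_def using that thr[of i] thr[of "i - 1"] by (metis atLeastAtMost_iff diff_le_self order_trans)
      then show ?thesis using weights_of_thresholds_of[OF assms(1) w that] by (simp add: \<zeta>_def)
    qed
    moreover have "v i = y i" if "i \<in> {1..m}" for i using that by (simp add: v_def)
    ultimately show ?thesis
      by (intro measure_eqI) (auto simp: emeasure_discrete_law intro!: sum.cong)
  qed
  ultimately show ?thesis by (rule that)
qed

text \<open>Moving a level leaves the bins fixed, so the transport cost is a quadratic polynomial in
  that level.\<close>

lemma DERIV_prog_objective_level:
  assumes "\<sigma> > 0" "1 \<le> n" "v \<in> threshold_domain n" "j \<in> {1..n}"
  shows "((\<lambda>t. prog_objective \<sigma> k n (v(j := t))) has_real_derivative
    k\<^sup>2 * (2 * weights_of \<sigma> (thr n v) j * v j - 2 * bin_moment \<sigma> (thr n v) j) + estimation_grad_level \<sigma> n v j) (at (v j))"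
proof -
  let ?\<zeta> = "thr n v"
  have dom: "v(j := t) \<in> threshold_domain n" and thr: "thr n (v(j := t)) = ?\<zeta>" for t
    using assms(3,4) by (auto simp: threshold_domain_def thr_def strict_mono_on_def fun_eq_iff)
  have "((\<lambda>t. transport_cost \<sigma> n (v(j := t)) ?\<zeta>) has_real_derivative
     0 - 2 * (\<Sum>i=1..n. (if i = j then 1 else 0) * bin_moment \<sigma> ?\<zeta> i)
     + (\<Sum>i=1..n. weights_of \<sigma> ?\<zeta> i * ((if i = j then 2 * v j else 0)))) (at (v j))"
    unfolding transport_cost_def
  proof (intro DERIV_add DERIV_diff DERIV_const DERIV_cmult DERIV_sum)
    fix i
    show "((\<lambda>t. (v(j := t)) i * bin_moment \<sigma> ?\<zeta> i) has_real_derivative (if i = j then 1 else 0) * bin_moment \<sigma> ?\<zeta> i) (at (v j))"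
      by (cases "i = j") (auto intro!: derivative_eq_intros)
    show "((\<lambda>t. ((v(j := t)) i)\<^sup>2) has_real_derivative (if i = j then 2 * v j else 0)) (at (v j))"
      by (cases "i = j") (auto intro!: derivative_eq_intros)
  qed
  also have "0 - 2 * (\<Sum>i=1..n. (if i = j then 1 else 0) * bin_moment \<sigma> ?\<zeta> i)
     + (\<Sum>i=1..n. weights_of \<sigma> ?\<zeta> i * ((if i = j then 2 * v j else 0)))
     = 2 * weights_of \<sigma> ?\<zeta> j * v j - 2 * bin_moment \<sigma> ?\<zeta> j"
  proof -
    have "(\<Sum>i=1..n. (if i = j then 1 else 0) * bin_moment \<sigma> ?\<zeta> i) = (\<Sum>i=1..n. if i = j then bin_moment \<sigma> ?\<zeta> i else 0)"
      by (intro sum.cong) auto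
    moreover have "(\<Sum>i=1..n. weights_of \<sigma> ?\<zeta> i * ((if i = j then 2 * v j else 0))) = (\<Sum>i=1..n. if i = j then weights_of \<sigma> ?\<zeta> i * (2 * v j) else 0)"
      by (intro sum.cong) auto
    ultimately show ?thesis using assms(4) by simp
  qed
  finally have "((\<lambda>t. k\<^sup>2 * transport_cost \<sigma> n (v(j := t)) ?\<zeta> + prog_estimation \<sigma> n (v(j := t))) has_real_derivative
    k\<^sup>2 * (2 * weights_of \<sigma> ?\<zeta> j * v j - 2 * bin_moment \<sigma> ?\<zeta> j) + estimation_grad_level \<sigma> n v j) (at (v j))"
    by (intro DERIV_add DERIV_cmult DERIV_estimation_level assms)
  then show ?thesis
    by (simp only: prog_objective_eq[OF assms(1,2) dom] thr)
qed

lemma bin_moment_le: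
  assumes "\<sigma> > 0" "\<zeta> (i - 1) \<le> \<zeta> i" "\<zeta> i \<le> ereal c"
  shows "bin_moment \<sigma> \<zeta> i \<le> c * weights_of \<sigma> \<zeta> i"
proof -
  interpret prob_space "gauss \<sigma>" by (rule prob_space_gauss) fact
  have "bin_moment \<sigma> \<zeta> i \<le> (\<integral>x. c * indicator (bin \<zeta> i) x \<partial>gauss \<sigma>)"
    unfolding bin_moment_def set_lebesgue_integral_def
  proof (rule integral_mono)
    show "integrable (gauss \<sigma>) (\<lambda>x. indicator (bin \<zeta> i) x *\<^sub>R x)"
      by (rule integrable_mult_indicator) (use integrable_gauss_id[OF assms(1)] in auto)
    fix x
    have "x \<le> c" if "x \<in> bin \<zeta> i"
    proof -
      have "ereal x \<le> \<zeta> i" using that by (simp add: bin_def)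
      then have "ereal x \<le> ereal c" using assms(3) by (rule order_trans)
      then show ?thesis by simp
    qed
    then show "indicator (bin \<zeta> i) x *\<^sub>R x \<le> c * indicator (bin \<zeta> i) x" by (simp add: indicator_def)
  qed (auto intro!: integrable_mult_right integrable_real_indicator simp: emeasure_eq_measure)
  then show ?thesis using weights_of_eq_measure[OF assms(1,2)] by simp
qed

lemma bin_moment_tail_gt:
  assumes "\<sigma> > 0" "\<zeta> (i - 1) = ereal c" "\<zeta> i = \<infinity>"
  shows "c * weights_of \<sigma> \<zeta> i < bin_moment \<sigma> \<zeta> i"
proof -
  interpret prob_space "gauss \<sigma>" by (rule prob_space_gauss) fact
  have bin: "bin \<zeta> i = {c<..}" using assms(2,3) by (auto simp: bin_def)
  have le: "\<zeta> (i - 1) \<le> \<zeta> i" using assms by simp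
  \<comment> \<open>On this interval \<open>x - c\<close> exceeds 1, and its positive mass makes the
    inequality strict. Strictness on the tail cell settles the borderline case of the splitting
    argument.\<close>
  have "0 < measure (gauss \<sigma>) {c + 1<..c + 2}" by (rule gauss_Ioc[OF assms(1)]) simp
  also have "\<dots> = (\<integral>x. indicator {c + 1<..c + 2} x \<partial>gauss \<sigma>)" by simp
  also have "\<dots> \<le> (\<integral>x. indicator {c<..} x * x - c * indicator {c<..} x \<partial>gauss \<sigma>)"
  proof (rule integral_mono)
    show "integrable (gauss \<sigma>) (\<lambda>x. indicator {c<..} x * x - c * indicator {c<..} x)"
      using integrable_mult_indicator[of "{c<..}" "gauss \<sigma>" "\<lambda>x. x"] integrable_gauss_id[OF assms(1)]
      by (intro Bochner_Integration.integrable_diff integrable_mult_right integrable_real_indicator)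
         (auto simp: emeasure_eq_measure)
    show "integrable (gauss \<sigma>) (indicator {c + 1<..c + 2} :: real \<Rightarrow> real)"
      by (intro integrable_real_indicator) (auto simp: emeasure_eq_measure)
    show "indicator {c + 1<..c + 2} x \<le> indicator {c<..} x * x - c * indicator {c<..} x" for x
      by (auto simp: indicator_def)
  qed
  also have "\<dots> = bin_moment \<sigma> \<zeta> i - c * measure (gauss \<sigma>) {c<..}"
    unfolding bin_moment_def bin set_lebesgue_integral_def
    using integrable_mult_indicator[of "{c<..}" "gauss \<sigma>" "\<lambda>x. x"] integrable_gauss_id[OF assms(1)]
    by (subst Bochner_Integration.integral_diff)
       (auto intro!: integrable_mult_right integrable_real_indicator simp: emeasure_eq_measure)
  finally show ?thesis using weights_of_eq_measure[where \<zeta> = \<zeta>, OF assms(1) le] bin by simp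
qed

text \<open>Cutting the last cell in two and moving the two copies of its level apart strictly decreases the
  objective: the first-order effect on the estimation part is, per unit of weight, the same for both
  copies, whereas the barycenters of the two new cells are separated by the cut \<open>c\<close>.\<close>

lemma splitting_improves:
  assumes "\<sigma> > 0" "k > 0" "1 \<le> m" and v: "v \<in> prog_domain m"
  obtains v' where "v' \<in> threshold_domain (Suc m)" "mono_on {1..Suc m} v'"
    "prog_objective \<sigma> k (Suc m) v' < prog_objective \<sigma> k m v"
proof -
  let ?N = "Suc m"
  have vd: "v \<in> threshold_domain m" using v prog_domain_subset by blast
  have sm: "strict_mono_on {1..m} v" using v by (simp add: prog_domain_def)
  \<comment> \<open>The cut must lie beyond the last finite threshold; with a single cell there is
    none, and 0 is taken.\<close>
  define c where "c = (if m = 1 then 0 else v (m + (m - 1)) + 1)"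
  \<comment> \<open>With \<open>m + 1\<close> levels the thresholds start one coordinate later,
    hence \<open>v (i - 1)\<close>; the new level at \<open>?N\<close> repeats \<open>v m\<close>,
    and the new last threshold sits at \<open>?N + m\<close>.\<close>
  define u where "u i = (if i \<le> m then v i else if i = ?N then v m
      else if i = ?N + m then c else v (i - 1))" for i
  have u: "u \<in> threshold_domain ?N"
    unfolding threshold_domain_def mem_Collect_eq
  proof (rule strict_mono_onI)
    fix i j assume ij: "i \<in> {1..<?N}" "j \<in> {1..<?N}" "i < j"
    have vij: "v (m + i) < v (m + j)" if "j < m"
      using vd ij that by (auto simp: threshold_domain_def dest: strict_mono_onD[of _ _ i j])
    have vic: "v (m + i) < c" if "j = m"
    proof -
      have "m \<noteq> 1" using ij that by auto
      moreover have "v (m + i) \<le> v (m + (m - 1))"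
        using vd ij that by (cases "i = m - 1")
           (auto simp: threshold_domain_def less_imp_le dest: strict_mono_onD[of _ _ i "m - 1"])
      ultimately show ?thesis by (simp add: c_def)
    qed
    have "u (?N + i) = v (m + i)" using ij by (auto simp: u_def)
    moreover have "u (?N + j) = (if j = m then c else v (m + j))" using ij by (auto simp: u_def)
    ultimately show "u (?N + i) < u (?N + j)" using vij vic ij by auto
  qed
  have umono: "mono_on {1..?N} u"
  proof (rule mono_onI)
    fix i j assume ij: "i \<in> {1..?N}" "j \<in> {1..?N}" "i \<le> j"
    have "v (min i m) \<le> v (min j m)"
      using ij assms(3) by (intro mono_onD[OF strict_mono_on_imp_mono_on[OF sm]]) auto
    moreover have "u i = v (min i m)" "u j = v (min j m)"
      using ij by (auto simp: u_def min_def not_le le_Suc_eq)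
    ultimately show "u i \<le> u j" by simp
  qed
  let ?\<zeta> = "thr ?N u" and ?\<xi> = "thr m v"
  have ok: "thresholds_ok ?N ?\<zeta>" and ok': "thresholds_ok m ?\<xi>"
    using thr_ok[OF _ u] thr_ok[OF assms(3) vd] by auto
  have z1: "?\<zeta> i = ?\<xi> i" if "i < m" for i using that by (auto simp: thr_def u_def)
  have z2: "?\<zeta> m = ereal c" "?\<zeta> ?N = \<infinity>" using assms(3) by (auto simp: thr_def u_def)
  have z3: "?\<xi> m = \<infinity>" using assms(3) by (simp add: thr_def)
  have "controller ?N u ?\<zeta> x = controller m v ?\<xi> x" for x
  proof -
    obtain i where i: "i \<in> {1..?N}" "x \<in> bin ?\<zeta> i" using bin_exists[OF ok, of x] .
    have "x \<in> bin ?\<xi> (min i m)"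
    proof (cases "i < m")
      case True
      then show ?thesis using i z1[of i] z1[of "i - 1"] by (simp add: bin_def)
    next
      case False
      have "?\<zeta> (m - 1) \<le> ?\<zeta> (i - 1)"
        using False i(1) by (intro thresholds_ok_mono[OF ok]) auto
      then have "?\<zeta> (m - 1) < ereal x" using i(2) by (auto simp: bin_def intro: le_less_trans)
      then show ?thesis using False z1[of "m - 1"] z3 assms(3) by (simp add: bin_def min_def)
    qed
    then have "controller m v ?\<xi> x = v (min i m)"
      using i(1) assms(3) by (intro controller_eq[OF ok']) auto
    moreover have "u i = v (min i m)" using i(1) by (auto simp: u_def min_def not_le le_Suc_eq)
    ultimately show ?thesis using controller_eq[OF ok i, of u] by simp
  qed
  \<comment> \<open>Equal controllers push the Gaussian to the same law, so the functional
    \<open>J\<close> links the values of two programs with different numbers of variables.\<close>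
  then have "discrete_law ?N u (weights_of \<sigma> ?\<zeta>) = discrete_law m v (weights_of \<sigma> ?\<xi>)"
    unfolding distr_controller[OF assms(1) ok, symmetric] distr_controller[OF assms(1) ok', symmetric]
    by presburger
  then have eq: "prog_objective \<sigma> k ?N u = prog_objective \<sigma> k m v"
    using J_prog_objective[OF assms(1) _ u umono, of k]
      J_prog_objective[OF assms(1,3) vd strict_mono_on_imp_mono_on[OF sm], of k] by simp
  let ?a = "v m"
  have ua: "u m = ?a" "u ?N = ?a" by (auto simp: u_def)
  define C where "C = (\<integral>z. phi (z - ?a) * (2 * (?a - post_mean ?N u (weights_of \<sigma> ?\<zeta>) z)
      + (z - ?a) * (?a - post_mean ?N u (weights_of \<sigma> ?\<zeta>) z)\<^sup>2) \<partial>lborel)"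
  have gl: "estimation_grad_level \<sigma> ?N u j = weights_of \<sigma> ?\<zeta> j * C" if "u j = ?a" for j
    unfolding estimation_grad_level_def Let_def that C_def ..
  \<comment> \<open>The part of the derivative per unit of weight that both copies share, as they
    sit at the same level \<open>?a\<close>; the copies differ only through their bin
    moments.\<close>
  define E where "E = 2 * k\<^sup>2 * ?a + C"
  have der: "((\<lambda>t. prog_objective \<sigma> k ?N (u(j := t))) has_real_derivative
      weights_of \<sigma> ?\<zeta> j * E - 2 * k\<^sup>2 * bin_moment \<sigma> ?\<zeta> j) (at (u j))" if "j \<in> {m, ?N}" for j
    by (rule DERIV_cong[OF DERIV_prog_objective_level[OF assms(1) _ u]])
       (use that ua gl[of j] assms(3) in \<open>auto simp: E_def algebra_simps\<close>)
  have dom: "u(j := t) \<in> threshold_domain ?N" if "j \<in> {m, ?N}" for j t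
    using u that by (auto simp: threshold_domain_def strict_mono_on_def)
  have k2: "0 < 2 * k\<^sup>2" using assms(2) by simp
  have wpos: "0 < weights_of \<sigma> ?\<zeta> m" "0 < weights_of \<sigma> ?\<zeta> ?N"
    using weights_of_thr_pos[OF assms(1) u] assms(3) by auto
  have "bin_moment \<sigma> ?\<zeta> m \<le> c * weights_of \<sigma> ?\<zeta> m"
    using z2 thresholds_ok_mono[OF ok, of "m - 1" m] by (intro bin_moment_le[OF assms(1)]) auto
  from mult_left_mono[OF this, of "2 * k\<^sup>2"]
  have mm: "2 * k\<^sup>2 * bin_moment \<sigma> ?\<zeta> m \<le> weights_of \<sigma> ?\<zeta> m * (2 * k\<^sup>2 * c)"
    by (simp add: mult_ac)
  have "c * weights_of \<sigma> ?\<zeta> ?N < bin_moment \<sigma> ?\<zeta> ?N"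
    using z2 by (intro bin_moment_tail_gt[OF assms(1)]) auto
  from mult_strict_left_mono[OF this k2]
  have mN: "weights_of \<sigma> ?\<zeta> ?N * (2 * k\<^sup>2 * c) < 2 * k\<^sup>2 * bin_moment \<sigma> ?\<zeta> ?N"
    by (simp add: mult_ac)
  show ?thesis
  \<comment> \<open>The barycenter of the upper cell exceeds \<open>c\<close>, that of the lower one
    does not. So for small \<open>E\<close> raising the upper copy helps, and otherwise lowering the
    lower copy does; either move keeps the levels weakly ordered.\<close>
  proof (cases "E \<le> 2 * k\<^sup>2 * c")
    case True
    then have "weights_of \<sigma> ?\<zeta> ?N * E \<le> weights_of \<sigma> ?\<zeta> ?N * (2 * k\<^sup>2 * c)"
      using wpos by (intro mult_left_mono) auto
    then have "weights_of \<sigma> ?\<zeta> ?N * E - 2 * k\<^sup>2 * bin_moment \<sigma> ?\<zeta> ?N < 0" using mN by linarith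
    from DERIV_neg_dec_right[OF der this]
    obtain d where d: "0 < d" "\<And>h. 0 < h \<Longrightarrow> h < d \<Longrightarrow>
        prog_objective \<sigma> k ?N (u(?N := u ?N + h)) < prog_objective \<sigma> k ?N (u(?N := u ?N))" by auto
    have "mono_on {1..?N} (u(?N := u ?N + d / 2))"
    proof (rule mono_onI)
      fix i j assume ij: "i \<in> {1..?N}" "j \<in> {1..?N}" "i \<le> j"
      then have "u i \<le> u j" by (rule mono_onD[OF umono])
      then show "(u(?N := u ?N + d / 2)) i \<le> (u(?N := u ?N + d / 2)) j"
        using ij d(1) by auto
    qed
    then show ?thesis
      using that[of "u(?N := u ?N + d / 2)"] dom[of ?N "u ?N + d / 2"] d(2)[of "d / 2"] d(1) eq by simp
  next
    case False
    then have "weights_of \<sigma> ?\<zeta> m * (2 * k\<^sup>2 * c) < weights_of \<sigma> ?\<zeta> m * E"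
      using wpos by (intro mult_strict_left_mono) auto
    then have "0 < weights_of \<sigma> ?\<zeta> m * E - 2 * k\<^sup>2 * bin_moment \<sigma> ?\<zeta> m" using mm by linarith
    from DERIV_pos_inc_left[OF der this]
    obtain d where d: "0 < d" "\<And>h. 0 < h \<Longrightarrow> h < d \<Longrightarrow>
        prog_objective \<sigma> k ?N (u(m := u m - h)) < prog_objective \<sigma> k ?N (u(m := u m))" by auto
    \<comment> \<open>The step must not carry the lowered copy below the preceding level, of which
      there is none when \<open>m = 1\<close>.\<close>
    define h where "h = (if m = 1 then d / 2 else min (d / 2) (v m - v (m - 1)))"
    have "v (m - 1) < v m" if "m \<noteq> 1"
      using that assms(3) by (intro strict_mono_onD[OF sm]) auto
    then have h: "0 < h" "h < d" "m \<noteq> 1 \<Longrightarrow> h \<le> v m - v (m - 1)"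
      using d(1) by (auto simp: h_def)
    have "mono_on {1..?N} (u(m := u m - h))"
    proof (rule mono_onI)
      fix i j assume ij: "i \<in> {1..?N}" "j \<in> {1..?N}" "i \<le> j"
      then have le: "u i \<le> u j" by (intro mono_onD[OF umono])
      have "u i \<le> u m - h" if "i < m"
      proof -
        have "v i \<le> v (m - 1)"
          using that ij by (intro mono_onD[OF strict_mono_on_imp_mono_on[OF sm]]) auto
        then show ?thesis using that ij h(3) by (auto simp: u_def)
      qed
      then show "(u(m := u m - h)) i \<le> (u(m := u m - h)) j"
        using ij h(1) le by auto
    qed
    then show ?thesis
      using that[of "u(m := u m - h)"] dom[of m "u m - h"] d(2)[OF h(1,2)] eq by simp
  qed
qed

text \<open>Atoms of mass zero are removed first, leaving \<open>?m\<close> positive weights. If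
  \<open>?m < n\<close>, the split configuration is still a competitor with at most \<open>n\<close>
  points and would lie below the infimum.\<close>

lemma J_star_attained_prog_domain:
  assumes "\<sigma> > 0" "k > 0" "1 \<le> n"
  obtains v where "v \<in> prog_domain n" "ereal (prog_objective \<sigma> k n v) = J_star \<sigma> k n"
proof -
  obtain Q where Q: "Q \<in> at_most_points n" "J \<sigma> k Q = J_star \<sigma> k n"
    using J_star_attained[OF assms] .
  then obtain S where S: "prob_space Q" "sets Q = sets borel" "finite S" "card S \<le> n" "emeasure Q (- S) = 0"
    by (auto simp: at_most_points_def)
  interpret prob_space Q by fact
  define S' where "S' = {s\<in>S. measure Q {s} > 0}"
  have S': "finite S'" "card S' \<le> n"
    using S(3,4) card_mono[of S S'] by (auto simp: S'_def)
  have "{s} \<in> null_sets Q" if "s \<in> S - S'" for s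
  proof -
    have "measure Q {s} = 0" using that measure_nonneg[of Q "{s}"] by (auto simp: S'_def)
    then show ?thesis using S(2) by (intro null_setsI) (auto simp: emeasure_eq_measure)
  qed
  then have "(\<Union>s\<in>S - S'. {s}) \<in> null_sets Q" using S(3) by (intro null_sets_UN') (auto intro: countable_finite)
  moreover have "- S \<in> null_sets Q" using S by (intro null_setsI) (auto simp: finite_imp_closed)
  moreover have "- S' = - S \<union> (\<Union>s\<in>S - S'. {s})" by (auto simp: S'_def)
  ultimately have "emeasure Q (- S') = 0" by (simp only: null_sets.Un null_setsD1)
  from discrete_law_of_finite_support[OF S(1,2) S'(1) this]
  obtain y w where yw: "y \<in> levels (card S')" "w \<in> weight_simplex (card S')"
    "Q = discrete_law (card S') y w" "y ` {1..card S'} = S'" "\<And>i. w i = measure Q {y i}" by metis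
  let ?m = "card S'"
  have m: "1 \<le> ?m" using yw(2) by (cases ?m) (auto simp: weight_simplex_def)
  have pos: "0 < w i" if "i \<in> {1..?m}" for i
  proof -
    have "y i \<in> S'" using yw(4) that by blast
    then show ?thesis by (simp add: yw(5) S'_def)
  qed
  obtain v where v: "v \<in> prog_domain ?m" "discrete_law ?m v (weights_of \<sigma> (thr ?m v)) = Q"
    using prog_domain_of_positive_weights[OF assms(1) yw(1,2) pos] yw(3) by metis
  have vd: "v \<in> threshold_domain ?m" using v(1) prog_domain_subset by blast
  have "mono_on {1..?m} v" using v(1) by (auto simp: prog_domain_def intro: strict_mono_on_imp_mono_on)
  from J_prog_objective[OF assms(1) m vd this, of k]
  have Jv: "ereal (prog_objective \<sigma> k ?m v) = J_star \<sigma> k n" by (simp add: v(2) Q(2))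
  have "?m = n"
  proof (rule ccontr)
    assume "?m \<noteq> n"
    then have le: "Suc ?m \<le> n" using S'(2) by simp
    obtain v' where v': "v' \<in> threshold_domain (Suc ?m)" "mono_on {1..Suc ?m} v'"
      "prog_objective \<sigma> k (Suc ?m) v' < prog_objective \<sigma> k ?m v"
      using splitting_improves[OF assms(1,2) m v(1)] .
    have "J_star \<sigma> k n \<le> ereal (prog_objective \<sigma> k (Suc ?m) v')"
      by (rule J_star_le_prog_objective[OF assms(1) _ le v'(1,2)]) simp
    also have "\<dots> < J_star \<sigma> k n" using v'(3) by (simp flip: Jv)
    finally show False by simp
  qed
  then show ?thesis using that[of v] v(1) Jv by simp
qed

text \<open>With \<open>c\<close> the limits of the cumulative weights, all mass collapses on the
  level \<open>y a\<close>. The bin moments vanish, so the transport cost tends to that of a point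
  mass, and the estimation part is squeezed to 0 by the second moment about
  \<open>y a\<close>.\<close>

lemma tendsto_prog_objective_degenerate:
  fixes V :: "real \<Rightarrow> nat \<Rightarrow> real"
  assumes "\<sigma> > 0" "1 \<le> n" and V: "\<And>t. V t \<in> threshold_domain n" and y: "\<And>t i. i \<in> {1..n} \<Longrightarrow> V t i = y i"
    and c: "\<And>i. i \<le> n \<Longrightarrow> ((\<lambda>t. cdf_ext \<sigma> (thr n (V t) i)) \<longlongrightarrow> c i) F"
    and d: "\<And>i. i \<le> n \<Longrightarrow> ((\<lambda>t. dens_ext \<sigma> (thr n (V t) i)) \<longlongrightarrow> 0) F"
    and a: "a \<in> {1..n}" "\<And>i. i \<in> {1..n} \<Longrightarrow> c i - c (i - 1) = (if i = a then 1 else 0)"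
  shows "((\<lambda>t. prog_objective \<sigma> k n (V t)) \<longlongrightarrow> k\<^sup>2 * (\<sigma>\<^sup>2 + (y a)\<^sup>2)) F"
proof -
  let ?W = "\<lambda>t. weights_of \<sigma> (thr n (V t))"
  have ok: "thresholds_ok n (thr n (V t))" for t by (rule thr_ok[OF assms(2) V])
  have W: "((\<lambda>t. ?W t i) \<longlongrightarrow> (if i = a then 1 else 0)) F" if "i \<in> {1..n}" for i
    unfolding weights_of_def a(2)[OF that, symmetric] using that by (intro tendsto_diff c) auto
  have mom: "bin_moment \<sigma> (thr n (V t)) i = \<sigma>\<^sup>2 * (dens_ext \<sigma> (thr n (V t) (i - 1)) - dens_ext \<sigma> (thr n (V t) i))"
    if "i \<in> {1..n}" for i t
    using that thresholds_ok_mono[OF ok] by (intro bin_moment_eq[OF assms(1)]) auto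
  have "((\<lambda>t. \<sigma>\<^sup>2 * (dens_ext \<sigma> (thr n (V t) (i - 1)) - dens_ext \<sigma> (thr n (V t) i))) \<longlongrightarrow> \<sigma>\<^sup>2 * (0 - 0)) F"
    if "i \<in> {1..n}" for i
    using that by (intro tendsto_mult tendsto_const tendsto_diff d) auto
  then have M: "((\<lambda>t. bin_moment \<sigma> (thr n (V t)) i) \<longlongrightarrow> 0) F" if "i \<in> {1..n}" for i
    using that by (simp add: mom[OF that])
  have "((\<lambda>t. \<sigma>\<^sup>2 - 2 * (\<Sum>i=1..n. y i * bin_moment \<sigma> (thr n (V t)) i) + (\<Sum>i=1..n. ?W t i * (y i)\<^sup>2)) \<longlongrightarrow>
      \<sigma>\<^sup>2 - 2 * (\<Sum>i=1..n. y i * 0) + (\<Sum>i=1..n. (if i = a then 1 else 0) * (y i)\<^sup>2)) F"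
    by (intro tendsto_add tendsto_diff tendsto_const tendsto_mult tendsto_sum M W)
  also have "(\<lambda>t. \<sigma>\<^sup>2 - 2 * (\<Sum>i=1..n. y i * bin_moment \<sigma> (thr n (V t)) i) + (\<Sum>i=1..n. ?W t i * (y i)\<^sup>2))
      = (\<lambda>t. transport_cost \<sigma> n (V t) (thr n (V t)))"
    unfolding transport_cost_def using y by (intro ext arg_cong2[of _ _ _ _ "(+)"] arg_cong2[of _ _ _ _ "(-)"]
        arg_cong2[of _ _ _ _ "(*)"] sum.cong refl) simp_all
  also have "(\<Sum>i=1..n. (if i = a then 1 else 0) * (y i)\<^sup>2) = (\<Sum>i=1..n. if i = a then (y i)\<^sup>2 else 0)"
    by (intro sum.cong) auto
  finally have T: "((\<lambda>t. transport_cost \<sigma> n (V t) (thr n (V t))) \<longlongrightarrow> \<sigma>\<^sup>2 + (y a)\<^sup>2) F"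
    using a(1) by simp
  have E: "((\<lambda>t. prog_estimation \<sigma> n (V t)) \<longlongrightarrow> 0) F"
  proof (rule tendsto_sandwich)
    have Ws: "?W t \<in> weight_simplex n" for t by (rule weights_of_simplex[OF assms(1) ok])
    show "\<forall>\<^sub>F t in F. 0 \<le> prog_estimation \<sigma> n (V t)"
      unfolding prog_estimation_def by (intro always_eventually allI estimation_part_nonneg Ws)
    have "prog_estimation \<sigma> n (V t) \<le> (\<Sum>i=1..n. ?W t i * (y i - y a)\<^sup>2)" for t
      unfolding prog_estimation_def
    proof -
      have "(\<Sum>i=1..n. ?W t i * (V t i - y a)\<^sup>2) = (\<Sum>i=1..n. ?W t i * (y i - y a)\<^sup>2)"
        using y by (intro sum.cong refl) simp
      then show "estimation_part n (V t) (?W t) \<le> (\<Sum>i=1..n. ?W t i * (y i - y a)\<^sup>2)"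
        using estimation_part_le_var[OF Ws, of "V t" t "y a"] by (simp only:)
    qed
    then show "\<forall>\<^sub>F t in F. prog_estimation \<sigma> n (V t) \<le> (\<Sum>i=1..n. ?W t i * (y i - y a)\<^sup>2)"
      by (simp add: always_eventually)
    have "((\<lambda>t. \<Sum>i=1..n. ?W t i * (y i - y a)\<^sup>2) \<longlongrightarrow> (\<Sum>i=1..n. (if i = a then 1 else 0) * (y i - y a)\<^sup>2)) F"
      by (intro tendsto_sum tendsto_mult W tendsto_const)
    moreover have "(\<Sum>i=1..n. (if i = a then 1 else 0) * (y i - y a)\<^sup>2) = 0"
      by (intro sum.neutral) auto
    ultimately show "((\<lambda>t. \<Sum>i=1..n. ?W t i * (y i - y a)\<^sup>2) \<longlongrightarrow> 0) F" by simp
  qed simp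
  have "((\<lambda>t. k\<^sup>2 * transport_cost \<sigma> n (V t) (thr n (V t)) + prog_estimation \<sigma> n (V t)) \<longlongrightarrow> k\<^sup>2 * (\<sigma>\<^sup>2 + (y a)\<^sup>2) + 0) F"
    by (intro tendsto_add tendsto_mult tendsto_const T E)
  then show ?thesis by (simp add: prog_objective_eq[OF assms(1,2) V])
qed

subsection \<open>Nonconvexity\<close>

text \<open>Along the line that translates all thresholds with the levels fixed at \<open>1, \<dots>, n\<close>, the mass
  ends up on the level \<open>n\<close> in one direction and on the level \<open>1\<close> in the other, so the objective has
  two distinct finite limits; a function that is midpoint convex on the line cannot have this.\<close>

lemma prog_objective_not_convex:
  assumes "\<sigma> > 0" "k > 0" "2 \<le> n"
  shows "\<not> convex_fun_on (prog_domain n) (prog_objective \<sigma> k n)"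
proof
  assume conv: "convex_fun_on (prog_domain n) (prog_objective \<sigma> k n)"
  define V :: "real \<Rightarrow> nat \<Rightarrow> real" where "V t i = (if i \<le> n then real i else t + real i)" for t i
  let ?f = "\<lambda>t. prog_objective \<sigma> k n (V t)"
  have n: "1 \<le> n" using assms(3) by simp
  have dom: "V t \<in> prog_domain n" for t
    by (auto simp: prog_domain_def V_def strict_mono_on_def)
  have tdom: "V t \<in> threshold_domain n" for t using dom prog_domain_subset by blast
  interpret G: real_distribution "gauss \<sigma>" by (rule real_distribution_gauss) fact
  have thr: "thr n (V t) i = (if i = 0 then - \<infinity> else if n \<le> i then \<infinity> else ereal (t + real (n + i)))" for t i
    by (simp add: thr_def V_def)
  have shift: "filterlim (\<lambda>t. t + b) at_top at_top" "filterlim (\<lambda>t. t + b) at_bot at_bot" for b :: real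
    by real_asymp+
  have ctop: "((\<lambda>t. cdf_ext \<sigma> (thr n (V t) i)) \<longlongrightarrow> (if i = 0 then 0 else 1)) at_top" if "i \<le> n" for i
    using filterlim_compose[OF G.cdf_lim_at_top_prob shift(1)] assms(1) n by (cases "i = 0"; cases "n \<le> i") (simp_all add: thr)
  have cbot: "((\<lambda>t. cdf_ext \<sigma> (thr n (V t) i)) \<longlongrightarrow> (if i = n then 1 else 0)) at_bot" if "i \<le> n" for i
    using filterlim_compose[OF G.cdf_lim_at_bot shift(2)] assms(1) n that by (cases "i = 0"; cases "n \<le> i") (simp_all add: thr)
  have dtop: "((\<lambda>t. dens_ext \<sigma> (thr n (V t) i)) \<longlongrightarrow> 0) at_top" for i
    using filterlim_compose[OF normal_density_tendsto_0(1)[OF assms(1)] shift(1)] n by (cases "i = 0"; cases "n \<le> i") (simp_all add: thr dens_ext_def)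
  have dbot: "((\<lambda>t. dens_ext \<sigma> (thr n (V t) i)) \<longlongrightarrow> 0) at_bot" for i
    using filterlim_compose[OF normal_density_tendsto_0(2)[OF assms(1)] shift(2)] n by (cases "i = 0"; cases "n \<le> i") (simp_all add: thr dens_ext_def)
  define Lp where "Lp = k\<^sup>2 * (\<sigma>\<^sup>2 + (real 1)\<^sup>2)"
  define Lm where "Lm = k\<^sup>2 * (\<sigma>\<^sup>2 + (real n)\<^sup>2)"
  have ltop: "(?f \<longlongrightarrow> Lp) at_top"
    unfolding Lp_def
    by (rule tendsto_prog_objective_degenerate[OF assms(1) n tdom _ ctop dtop]) (use n in \<open>auto simp: V_def\<close>)
  have lbot: "(?f \<longlongrightarrow> Lm) at_bot"
    unfolding Lm_def
    by (rule tendsto_prog_objective_degenerate[OF assms(1) n tdom _ cbot dbot]) (use n in \<open>auto simp: V_def\<close>)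
  have "(real 1)\<^sup>2 < (real n)\<^sup>2" using assms(3) by (intro power_strict_mono) auto
  then have less: "Lp < Lm" using assms(2) by (simp add: Lp_def Lm_def)
  have mid: "?f x \<le> (1 / 2) * ?f (x - s) + (1 / 2) * ?f (x + s)" for x s
  proof -
    have "?f x = prog_objective \<sigma> k n (\<lambda>i. (1 - 1 / 2) * V (x - s) i + (1 / 2) * V (x + s) i)"
      by (rule arg_cong[of _ _ "prog_objective \<sigma> k n"]) (auto simp: V_def fun_eq_iff field_simps)
    also have "\<dots> \<le> (1 - 1 / 2) * ?f (x - s) + (1 / 2) * ?f (x + s)"
      using conv[unfolded convex_fun_on_def, rule_format, OF dom dom, of "1 / 2" "x - s" "x + s"] by simp
    finally show ?thesis by simp
  qed
  \<comment> \<open>Fixing the midpoint and sending the endpoints to opposite ends bounds the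
    function everywhere by the average of its two limits, which is below the larger one.\<close>
  have bound: "?f x \<le> (Lm + Lp) / 2" for x
  proof -
    have "filterlim (\<lambda>s. x - s) at_bot at_top" "filterlim (\<lambda>s. x + s) at_top at_top" by real_asymp+
    then have "((\<lambda>s. (1 / 2) * ?f (x - s) + (1 / 2) * ?f (x + s)) \<longlongrightarrow> (1 / 2) * Lm + (1 / 2) * Lp) at_top"
      by (intro tendsto_add tendsto_mult tendsto_const filterlim_compose[OF lbot] filterlim_compose[OF ltop])
    then have "?f x \<le> (1 / 2) * Lm + (1 / 2) * Lp"
      by (rule tendsto_lowerbound) (use mid in \<open>auto intro: always_eventually\<close>)
    then show ?thesis by simp
  qed
  have "Lm \<le> (Lm + Lp) / 2"
    by (rule tendsto_upperbound[OF lbot]) (use bound in \<open>auto intro: always_eventually\<close>)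
  then show False using less by simp
qed

subsection \<open>The reduction to a finite-dimensional program\<close>

text \<open>Integrability is asserted because the integral of a non-integrable function is 0 by
  default. The round trip between weights and thresholds expresses the equivalence of the two
  parametrisations. Nonconvexity starts at \<open>n = 2\<close>: a single level \<open>y\<close> has
  the convex objective \<open>k\<^sup>2 * (\<sigma>\<^sup>2 + y\<^sup>2)\<close>.\<close>

theorem proposition4p2:
  fixes \<sigma> k :: real and n :: nat
  assumes "\<sigma> > 0" and "k > 0" and "n \<ge> 1"
  shows
    "(\<forall>y\<in>levels n. \<forall>w\<in>weight_simplex n.
        let P = gauss \<sigma>; \<zeta> = thresholds_of \<sigma> w; Q = discrete_law n y w; f = controller n y \<zeta> in
          \<zeta> 0 = - \<infinity> \<and> \<zeta> n = \<infinity> \<and>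
          (\<forall>i\<in>{1..n}.
             w i = measure P (bin \<zeta> i) \<and>
             w i = cdf_ext \<sigma> (\<zeta> i) - cdf_ext \<sigma> (\<zeta> (i - 1)) \<and>
             bin_moment \<sigma> \<zeta> i = \<sigma>\<^sup>2 * (dens_ext \<sigma> (\<zeta> (i - 1)) - dens_ext \<sigma> (\<zeta> i))) \<and>
          integrable lborel (\<lambda>z. (mix_num n y w z)\<^sup>2 / mix_dens n y w z) \<and>
          wasserstein2_sq P Q = ereal (transport_part \<sigma> n y w \<zeta>) \<and>
          mmse Q = estimation_part n y w \<and>
          J \<sigma> k Q = ereal (k\<^sup>2 * transport_part \<sigma> n y w \<zeta> + estimation_part n y w) \<and>
          (\<forall>i\<in>{1..n}. f -` {y i} = bin \<zeta> i) \<and>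
          distr P borel f = Q) \<and>
     is_minimum (J_star \<sigma> k n) (\<lambda>v. ereal (prog_objective \<sigma> k n v)) (prog_domain n) \<and>
     is_minimum (J_star \<sigma> k n)
       (\<lambda>(y, w). ereal (objective \<sigma> k n y w (thresholds_of \<sigma> w)))
       (levels n \<times> weight_simplex n) \<and>
     (\<forall>v\<in>prog_domain n.
        weights_of \<sigma> (thr n v) \<in> weight_simplex n \<and>
        (\<forall>i\<in>{0..n}. thresholds_of \<sigma> (weights_of \<sigma> (thr n v)) i = thr n v i)) \<and>
     smooth_coords_on {1..2 * n - 1} (prog_domain n) (prog_objective \<sigma> k n) \<and>
     (n \<ge> 2 \<longrightarrow> \<not> convex_fun_on (prog_domain n) (prog_objective \<sigma> k n)) \<and>
     smooth_coords_on {1..2 * n - 1} (prog_domain n) (prog_estimation \<sigma> n) \<and>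
     (\<forall>v\<in>prog_domain n.
        (\<forall>i\<in>{1..n}.
           ((\<lambda>t. prog_estimation \<sigma> n (v(i := t))) has_real_derivative
              estimation_grad_level \<sigma> n v i) (at (v i))) \<and>
        (\<forall>j\<in>{1..<n}.
           ((\<lambda>t. prog_estimation \<sigma> n (v(n + j := t))) has_real_derivative
              estimation_grad_threshold \<sigma> n v j) (at (v (n + j)))))"
    (is "?closed_form \<and> ?min1 \<and> ?min2 \<and> ?roundtrip \<and> ?smooth1 \<and> ?nonconvex \<and> ?smooth2 \<and> ?gradient")
proof (intro conjI)
  have law: "discrete_law n y w = discrete_law n y (weights_of \<sigma> (thresholds_of \<sigma> w))"
    if "w \<in> weight_simplex n" for y w
    by (rule discrete_law_cong) (simp add: weights_of_thresholds_of[OF assms(1) that])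
  have W2: "wasserstein2_sq (gauss \<sigma>) (discrete_law n y w) = ereal (transport_part \<sigma> n y w (thresholds_of \<sigma> w))"
    if "y \<in> levels n" "w \<in> weight_simplex n" for y w
    using wasserstein2_sq_eq[OF assms(1) thresholds_of_ok[OF assms(1) that(2)] levels_mono_on[OF that(1)]]
      transport_part_eq[OF assms(1) thresholds_of_ok[OF assms(1) that(2)], of w y]
      weights_of_thresholds_of[OF assms(1) that(2)] law[OF that(2), of y] by simp
  have Jeq: "J \<sigma> k (discrete_law n y w) = ereal (k\<^sup>2 * transport_part \<sigma> n y w (thresholds_of \<sigma> w) + estimation_part n y w)"
    if "y \<in> levels n" "w \<in> weight_simplex n" for y w
    by (simp add: J_def W2[OF that] mmse_discrete_law[OF that(2)])
  show ?closed_form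
    unfolding Let_def
  proof (intro ballI conjI)
    fix y w assume y: "y \<in> levels n" and w: "w \<in> weight_simplex n"
    let ?\<zeta> = "thresholds_of \<sigma> w"
    have ok: "thresholds_ok n ?\<zeta>" by (rule thresholds_of_ok[OF assms(1) w])
    show "?\<zeta> 0 = - \<infinity>" "?\<zeta> n = \<infinity>" using ok by (auto simp: thresholds_ok_def)
    show "integrable lborel (\<lambda>z. (mix_num n y w z)\<^sup>2 / mix_dens n y w z)" by (rule integrable_estimation[OF w])
    show "mmse (discrete_law n y w) = estimation_part n y w" by (rule mmse_discrete_law[OF w])
    show "distr (gauss \<sigma>) borel (controller n y ?\<zeta>) = discrete_law n y w"
      using distr_controller[OF assms(1) ok] law[OF w] by simp
    fix i assume i: "i \<in> {1..n}"
    have le: "?\<zeta> (i - 1) \<le> ?\<zeta> i" using i by (intro thresholds_ok_mono[OF ok]) auto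
    show "w i = measure (gauss \<sigma>) (bin ?\<zeta> i)"
      using weights_of_eq_measure[OF assms(1) le] weights_of_thresholds_of[OF assms(1) w i] by simp
    show "w i = cdf_ext \<sigma> (?\<zeta> i) - cdf_ext \<sigma> (?\<zeta> (i - 1))"
      using weights_of_thresholds_of[OF assms(1) w i] by (simp add: weights_of_def)
    show "bin_moment \<sigma> ?\<zeta> i = \<sigma>\<^sup>2 * (dens_ext \<sigma> (?\<zeta> (i - 1)) - dens_ext \<sigma> (?\<zeta> i))"
      by (rule bin_moment_eq[OF assms(1) le])
    show "controller n y ?\<zeta> -` {y i} = bin ?\<zeta> i" by (rule controller_vimage[OF ok y i])
  qed (use W2 Jeq in auto)
  have mono: "mono_on {1..n} v" if "v \<in> prog_domain n" for v
    using that by (auto simp: prog_domain_def intro: strict_mono_on_imp_mono_on)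
  have dom: "v \<in> threshold_domain n" if "v \<in> prog_domain n" for v
    using that prog_domain_subset by blast
  obtain v where v: "v \<in> prog_domain n" "ereal (prog_objective \<sigma> k n v) = J_star \<sigma> k n"
    using J_star_attained_prog_domain[OF assms] .
  show ?min1
    unfolding is_minimum_def using v J_star_le_prog_objective[OF assms(1,3) order_refl dom mono] by blast
  have simplex: "weights_of \<sigma> (thr n v) \<in> weight_simplex n" if "v \<in> prog_domain n" for v
    by (rule weights_of_simplex[OF assms(1) thr_ok[OF assms(3) dom[OF that]]])
  have recover: "thresholds_of \<sigma> (weights_of \<sigma> (thr n v)) = thr n v" for v
    by (rule ext) (rule thresholds_of_weights_of[OF assms(1)], simp add: thr_def)
  then show ?roundtrip using simplex by simp
  show ?min2
    unfolding is_minimum_def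
  proof (intro conjI ballI bexI)
    show "(v, weights_of \<sigma> (thr n v)) \<in> levels n \<times> weight_simplex n"
      using v(1) simplex[OF v(1)] by (auto simp: prog_domain_def levels_def)
    show "(case (v, weights_of \<sigma> (thr n v)) of (y, w) \<Rightarrow> ereal (objective \<sigma> k n y w (thresholds_of \<sigma> w))) = J_star \<sigma> k n"
      using v(2) by (simp add: recover prog_objective_def)
    fix p assume "p \<in> levels n \<times> weight_simplex n"
    then obtain y w where p: "p = (y, w)" and yw: "y \<in> levels n" "w \<in> weight_simplex n" by blast
    have "J_star \<sigma> k n \<le> J \<sigma> k (discrete_law n y w)"
      unfolding J_star_def by (rule INF_lower[OF discrete_law_at_most_points[OF yw(2) order_refl]])
    then show "J_star \<sigma> k n \<le> (case p of (y, w) \<Rightarrow> ereal (objective \<sigma> k n y w (thresholds_of \<sigma> w)))"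
      by (simp add: p Jeq[OF yw] objective_def)
  qed
  show ?smooth1 by (rule calc_smooth[OF calc_prog_objective[OF assms(1,3)] assms(1)])
  show ?smooth2 by (rule calc_smooth[OF calc_prog_estimation[OF assms(1,3)] assms(1)])
  show ?nonconvex using prog_objective_not_convex[OF assms(1,2)] by blast
  show ?gradient
    using DERIV_estimation_level[OF assms(1,3) dom] DERIV_estimation_threshold[OF assms(1,3) dom] by blast
qed

end
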